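(* Let $k\ge 1$, let $f_1,\dots,f_k$ be Möbius maps of $\widehat{\mathbb C}$, let $G=\langle f_1,\dots,f_k\rangle$ be the Möbius semigroup they generate, let $a\in\widehat{\mathbb C}$, and let $b=(b_1,\dots,b_k)$ be a probability vector. Suppose $J_{\ker}(G^{-1})=\emptyset$ and $J(G^{-1})\neq\emptyset$. Then, for $P_b$-almost all $(i_1,i_2,\dots)\in\Sigma_k^+$, the probability measures $\mu^a_{i_1,\dots,i_n}$ converge weakly, as $n\to\infty$, to $\mu^b$ in the space of Borel probability measures on $\widehat{\mathbb C}$.
   Context: $\widehat{\mathbb C}$ is the Riemann sphere. A Möbius semigroup is a semigroup of Möbius maps of $\widehat{\mathbb C}$ under composition; $\langle f_1,\dots,f_k\rangle$ is the semigroup (not group) of all finite (nonempty) compositions of the $f_j$. The inverse semigroup is $G^{-1}=\{g^{-1}:g\in G\}=\langle f_1^{-1},\dots,f_k^{-1}\rangle$. For a Möbius semigroup $H$: the Fatou set $F(H)$ is the set of points of $\widehat{\mathbb C}$ having a neighborhood on which $H$ is a normal family (with respect to the spherical metric), the Julia set is $J(H)=\widehat{\mathbb C}\setminus F(H)$, and the kernel Julia set is $J_{\ker}(H)=\bigcap_{h\in H}h^{-1}(J(H))$. A probability vector $b=(b_1,\dots,b_k)$ has every $b_j>0$ and $\sum_j b_j=1$. $\Sigma_k^+=\prod_{n=1}^\infty\{1,\dots,k\}$ with the product topology and Borel $\sigma$-algebra, and $P_b$ is the Bernoulli measure on $\Sigma_k^+$: $P_b(\{(i_1,i_2,\dots):i_n=j_n,\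 n=1,\dots,m\})=b_{j_1}\cdots b_{j_m}$. Write $z_{i_1,\dots,i_n}=f_{i_n}^{-1}\circ\cdots\circ f_{i_1}^{-1}(a)$, and, with $\delta_z$ the unit point mass at $z$, $\mu^a_{i_1,\dots,i_n}=\frac1n\sum_{j=1}^n\delta_{z_{i_1,\dots,i_j}}$. Under the hypotheses on $G$, $\mu^b$ denotes the unique Borel probability measure on $\widehat{\mathbb C}$ with $T_b^*\mu^b=\mu^b$, i.e. $\int\sum_{j=1}^k b_j\,\phi(f_j^{-1}(z))\,d\mu^b(z)=\int\phi\,d\mu^b$ for all continuous $\phi:\widehat{\mathbb C}\to\mathbb C$; it is also the weak limit, for every $a\in\widehat{\mathbb C}$, of $\sum_{i_1,\dots,i_n=1}^k b_{i_1}\cdots b_{i_n}\delta_{f_{i_n}^{-1}\circ\cdots\circ f_{i_1}^{-1}(a)}$ as $n\to\infty$. *)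

theory Defs
  imports "HOL-Probability.Probability"
begin

section \<open>The Riemann sphere\<close>

datatype rsphere = Fin complex | Infinity

text \<open>Inverse stereographic projection onto the unit sphere of \<open>\<complex> \<times> \<real>\<close>.\<close>

fun stereo :: "rsphere \<Rightarrow> complex \<times> real" where
  "stereo (Fin z) = (of_real (2 / (1 + (norm z)\<^sup>2)) * z, ((norm z)\<^sup>2 - 1) / ((norm z)\<^sup>2 + 1))"
| "stereo Infinity = (0, 1)"

lemma inj_stereo: "inj stereo"
proof (rule injI)
  fix x y :: rsphere
  assume eq: "stereo x = stereo y"
  have pos: "1 + (norm z)\<^sup>2 > 0" for z :: complex
    by (simp add: add_pos_nonneg)
  have snd_eq: "snd (stereo (Fin z)) = 1 - 2 / (1 + (norm z)\<^sup>2)" for z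
    using pos[of z] by (simp add: field_simps)
  have coef: "2 / (1 + (norm z)\<^sup>2) > 0" for z :: complex
    using pos by simp
  show "x = y"
  proof (cases x)
    case (Fin z)
    show ?thesis
    proof (cases y)
      case y: (Fin w)
      have c: "2 / (1 + (norm z)\<^sup>2) = 2 / (1 + (norm w)\<^sup>2)"
        using eq snd_eq[of z] snd_eq[of w] Fin y by simp
      have "of_real (2 / (1 + (norm z)\<^sup>2)) * z = of_real (2 / (1 + (norm w)\<^sup>2)) * w"
        using eq Fin y by simp
      then have "of_real (2 / (1 + (norm w)\<^sup>2)) * z = of_real (2 / (1 + (norm w)\<^sup>2)) * w"
        by (simp only: c)
      moreover have "complex_of_real (2 / (1 + (norm w)\<^sup>2)) \<noteq> 0"
        using coef[of w] by (simp only: of_real_eq_0_iff)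
      ultimately show ?thesis
        using Fin y mult_left_cancel by blast
    next
      case Infinity
      then show ?thesis using eq snd_eq[of z] coef[of z] Fin by simp
    qed
  next
    case x: Infinity
    then show ?thesis
    proof (cases y)
      case (Fin w)
      then show ?thesis using eq snd_eq[of w] coef[of w] x by simp
    qed simp
  qed
qed

text \<open>The sphere carries the chordal metric, which is uniformly equivalent to the geodesic one.\<close>

instantiation rsphere :: metric_space
begin

definition dist_rsphere :: "rsphere \<Rightarrow> rsphere \<Rightarrow> real" where
  "dist_rsphere x y = dist (stereo x) (stereo y)"

definition uniformity_rsphere :: "(rsphere \<times> rsphere) filter" where
  "uniformity_rsphere = (INF e\<in>{0<..}. principal {(x, y). dist x y < e})"

definition open_rsphere :: "rsphere set \<Rightarrow> bool" where
  "open_rsphere U = (\<forall>x\<in>U. eventually (\<lambda>(x', y). x' = x \<longrightarrow> y \<in> U) uniformity)"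

instance
proof
  fix x y z :: rsphere
  show "(dist x y = 0) = (x = y)"
    using inj_stereo by (simp add: dist_rsphere_def inj_eq)
  show "dist x y \<le> dist x z + dist y z"
    by (simp add: dist_rsphere_def dist_triangle2)
qed (simp_all add: uniformity_rsphere_def open_rsphere_def)

end

section \<open>Moebius maps and semigroups\<close>

definition mobius :: "complex \<Rightarrow> complex \<Rightarrow> complex \<Rightarrow> complex \<Rightarrow> rsphere \<Rightarrow> rsphere" where
  "mobius \<alpha> \<beta> \<gamma> \<delta> x =
     (case x of
        Fin z \<Rightarrow> (if \<gamma> * z + \<delta> = 0 then Infinity else Fin ((\<alpha> * z + \<beta>) / (\<gamma> * z + \<delta>)))
      | Infinity \<Rightarrow> (if \<gamma> = 0 then Infinity else Fin (\<alpha> / \<gamma>)))"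

definition is_mobius :: "(rsphere \<Rightarrow> rsphere) \<Rightarrow> bool" where
  "is_mobius f \<longleftrightarrow> (\<exists>\<alpha> \<beta> \<gamma> \<delta>. \<alpha> * \<delta> - \<beta> * \<gamma> \<noteq> 0 \<and> f = mobius \<alpha> \<beta> \<gamma> \<delta>)"

lemma mobius_inverse:
  assumes "\<alpha> * \<delta> - \<beta> * \<gamma> \<noteq> 0"
  shows "mobius \<delta> (- \<beta>) (- \<gamma>) \<alpha> (mobius \<alpha> \<beta> \<gamma> \<delta> x) = x"
proof (cases x)
  case (Fin z)
  show ?thesis
  proof (cases "\<gamma> * z + \<delta> = 0")
    case True
    then have d: "\<delta> = - (\<gamma> * z)" by (simp add: eq_neg_iff_add_eq_0 add.commute)
    with assms have "\<gamma> \<noteq> 0" by auto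
    with Fin True d show ?thesis by (simp add: mobius_def)
  next
    case False
    have "(- \<gamma>) * ((\<alpha> * z + \<beta>) / (\<gamma> * z + \<delta>)) + \<alpha> = (\<alpha> * \<delta> - \<beta> * \<gamma>) / (\<gamma> * z + \<delta>)"
      using False by (simp add: field_simps)
    moreover have "\<delta> * ((\<alpha> * z + \<beta>) / (\<gamma> * z + \<delta>)) + (- \<beta>)
        = (\<alpha> * \<delta> - \<beta> * \<gamma>) * z / (\<gamma> * z + \<delta>)"
      using False by (simp add: field_simps)
    ultimately show ?thesis
      using Fin False assms by (simp add: mobius_def)
  qed
next
  case Infinity
  show ?thesis
  proof (cases "\<gamma> = 0")
    case True
    then show ?thesis using Infinity by (simp add: mobius_def)
  next
    case False
    then show ?thesis using Infinity by (simp add: mobius_def)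
  qed
qed

lemma is_mobius_imp_bij:
  assumes "is_mobius f"
  shows "bij f"
proof -
  obtain \<alpha> \<beta> \<gamma> \<delta> where det: "\<alpha> * \<delta> - \<beta> * \<gamma> \<noteq> 0" and f: "f = mobius \<alpha> \<beta> \<gamma> \<delta>"
    using assms by (auto simp: is_mobius_def)
  have det': "\<delta> * \<alpha> - (- \<beta>) * (- \<gamma>) \<noteq> 0"
    using det by (simp add: mult.commute)
  show ?thesis
    using mobius_inverse[OF det] mobius_inverse[OF det'] unfolding f
    by (intro o_bij[of "mobius \<delta> (- \<beta>) (- \<gamma>) \<alpha>"]) (auto simp: fun_eq_iff)
qed

inductive_set semigroup_gen :: "('a \<Rightarrow> 'a) set \<Rightarrow> ('a \<Rightarrow> 'a) set" for S where
  gen: "f \<in> S \<Longrightarrow> f \<in> semigroup_gen S"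
| comp: "f \<in> semigroup_gen S \<Longrightarrow> g \<in> semigroup_gen S \<Longrightarrow> f \<circ> g \<in> semigroup_gen S"

definition inverse_semigroup :: "('a \<Rightarrow> 'a) set \<Rightarrow> ('a \<Rightarrow> 'a) set" where
  "inverse_semigroup G = inv ` G"

section \<open>Fatou, Julia and kernel Julia sets\<close>

definition normal_family_on ::
    "'a::topological_space set \<Rightarrow> ('a \<Rightarrow> 'b::metric_space) set \<Rightarrow> bool" where
  "normal_family_on U H \<longleftrightarrow>
     (\<forall>h :: nat \<Rightarrow> 'a \<Rightarrow> 'b. range h \<subseteq> H \<longrightarrow>
        (\<exists>r g. strict_mono r \<and>
           (\<forall>K. compact K \<and> K \<subseteq> U \<longrightarrow> uniform_limit K (\<lambda>n. h (r n)) g sequentially)))"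

definition fatou :: "(rsphere \<Rightarrow> rsphere) set \<Rightarrow> rsphere set" where
  "fatou H = {z. \<exists>U. open U \<and> z \<in> U \<and> normal_family_on U H}"

definition julia :: "(rsphere \<Rightarrow> rsphere) set \<Rightarrow> rsphere set" where
  "julia H = - fatou H"

definition kernel_julia :: "(rsphere \<Rightarrow> rsphere) set \<Rightarrow> rsphere set" where
  "kernel_julia H = (\<Inter>h\<in>H. h -` julia H)"

section \<open>Bernoulli measure, random backward orbits and stationary measures\<close>

definition prob_vector :: "nat \<Rightarrow> (nat \<Rightarrow> real) \<Rightarrow> bool" where
  "prob_vector k b \<longleftrightarrow> (\<forall>j\<in>{1..k}. b j > 0) \<and> (\<Sum>j=1..k. b j) = 1"

text \<open>Sequences are indexed from \<open>0\<close>: the symbol \<open>i\<^sub>n\<close> of \<open>(i\<^sub>1, i\<^sub>2, \<dots>)\<close> is \<open>\<omega> (n - 1)\<close>.\<close>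

definition bernoulli :: "nat \<Rightarrow> (nat \<Rightarrow> real) \<Rightarrow> (nat \<Rightarrow> nat) measure" where
  "bernoulli k b = PiM UNIV (\<lambda>_. point_measure {1..k} (\<lambda>j. ennreal (b j)))"

lemma space_bernoulli: "space (bernoulli k b) = (UNIV \<rightarrow> {1..k})"
  by (auto simp: bernoulli_def space_PiM space_point_measure)

lemma prob_space_point_measure_prob_vector:
  assumes "prob_vector k b"
  shows "prob_space (point_measure {1..k} (\<lambda>j. ennreal (b j)))"
proof
  have "(\<Sum>j=1..k. ennreal (b j)) = ennreal (\<Sum>j=1..k. b j)"
    using assms by (intro sum_ennreal) (auto simp: prob_vector_def intro: less_imp_le)
  then show "emeasure (point_measure {1..k} (\<lambda>j. ennreal (b j)))
      (space (point_measure {1..k} (\<lambda>j. ennreal (b j)))) = 1"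
    using assms by (simp add: space_point_measure emeasure_point_measure_finite prob_vector_def)
qed

lemma bernoulli_cylinder:
  assumes "prob_vector k b" and "\<And>n. n < m \<Longrightarrow> j n \<in> {1..k}"
  shows "measure (bernoulli k b) {\<omega> \<in> space (bernoulli k b). \<forall>n<m. \<omega> n = j n} = (\<Prod>n<m. b (j n))"
proof -
  interpret product_prob_space "\<lambda>_::nat. point_measure {1..k} (\<lambda>j. ennreal (b j))" UNIV
    by (intro product_prob_spaceI prob_space_point_measure_prob_vector assms)
  have "emeasure (bernoulli k b) {\<omega> \<in> space (bernoulli k b). \<forall>n\<in>{..<m}. \<omega> n \<in> {j n}}
      = (\<Prod>n<m. emeasure (point_measure {1..k} (\<lambda>j. ennreal (b j))) {j n})"
    unfolding bernoulli_def
    using assms(2) by (intro emeasure_PiM_Collect) (auto simp: sets_point_measure)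
  also have "\<dots> = (\<Prod>n<m. ennreal (b (j n)))"
    using assms(2) by (intro prod.cong) (auto simp: emeasure_point_measure_finite)
  also have "\<dots> = ennreal (\<Prod>n<m. b (j n))"
    using assms by (intro prod_ennreal) (auto simp: prob_vector_def intro: less_imp_le)
  finally have "emeasure (bernoulli k b) {\<omega> \<in> space (bernoulli k b). \<forall>n<m. \<omega> n = j n}
      = ennreal (\<Prod>n<m. b (j n))"
    by (simp add: Ball_def)
  moreover have "(\<Prod>n<m. b (j n)) \<ge> 0"
    using assms by (intro prod_nonneg) (auto simp: prob_vector_def intro: less_imp_le)
  ultimately show ?thesis
    by (simp add: measure_def)
qed

primrec backward_orbit ::
    "(nat \<Rightarrow> 'a \<Rightarrow> 'a) \<Rightarrow> 'a \<Rightarrow> (nat \<Rightarrow> nat) \<Rightarrow> nat \<Rightarrow> 'a" where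
  "backward_orbit f a \<omega> 0 = a"
| "backward_orbit f a \<omega> (Suc n) = inv (f (\<omega> n)) (backward_orbit f a \<omega> n)"

definition empirical_measure :: "(nat \<Rightarrow> 'a::topological_space) \<Rightarrow> nat \<Rightarrow> 'a measure" where
  "empirical_measure z n = measure_of UNIV (sets borel)
     (\<lambda>A. ennreal (1 / real n) * (\<Sum>j=1..n. emeasure (return borel (z j)) A))"

lemma sets_empirical_measure [simp]: "sets (empirical_measure z n) = sets borel"
  unfolding empirical_measure_def using sets.sets_measure_of_eq[of borel] by simp

lemma emeasure_empirical_measure:
  assumes "A \<in> sets borel"
  shows "emeasure (empirical_measure z n) A
    = ennreal (1 / real n) * (\<Sum>j=1..n. emeasure (return borel (z j)) A)"
proof -
  have "countably_additive (sets borel)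
      (\<lambda>A. ennreal (1 / real n) * (\<Sum>j=1..n. emeasure (return borel (z j)) A))"
  proof (rule countably_additiveI)
    fix B :: "nat \<Rightarrow> 'a set"
    assume B: "range B \<subseteq> sets borel" "disjoint_family B"
    have "(\<Sum>i. \<Sum>j=1..n. emeasure (return borel (z j)) (B i))
        = (\<Sum>j=1..n. \<Sum>i. emeasure (return borel (z j)) (B i))"
      by (intro suminf_sum) simp
    also have "\<dots> = (\<Sum>j=1..n. emeasure (return borel (z j)) (\<Union>i. B i))"
      using B by (intro sum.cong refl suminf_emeasure) auto
    finally show "(\<Sum>i. ennreal (1 / real n) * (\<Sum>j=1..n. emeasure (return borel (z j)) (B i)))
        = ennreal (1 / real n) * (\<Sum>j=1..n. emeasure (return borel (z j)) (\<Union>i. B i))"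
      by (simp add: ennreal_suminf_cmult)
  qed
  moreover have "positive (sets borel)
      (\<lambda>A. ennreal (1 / real n) * (\<Sum>j=1..n. emeasure (return borel (z j)) A))"
    by (simp add: positive_def)
  moreover have "sigma_algebra UNIV (sets borel :: 'a set set)"
    using sets.sigma_algebra_axioms[of borel] by simp
  ultimately show ?thesis
    using assms unfolding empirical_measure_def by (simp add: emeasure_measure_of_sigma)
qed

definition transition_op ::
    "nat \<Rightarrow> (nat \<Rightarrow> rsphere \<Rightarrow> rsphere) \<Rightarrow> (nat \<Rightarrow> real) \<Rightarrow> (rsphere \<Rightarrow> complex) \<Rightarrow> rsphere \<Rightarrow> complex"
  where "transition_op k f b \<phi> z = (\<Sum>j=1..k. of_real (b j) * \<phi> (inv (f j) z))"

definition stationary ::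
    "nat \<Rightarrow> (nat \<Rightarrow> rsphere \<Rightarrow> rsphere) \<Rightarrow> (nat \<Rightarrow> real) \<Rightarrow> rsphere measure \<Rightarrow> bool" where
  "stationary k f b \<mu> \<longleftrightarrow> prob_space \<mu> \<and> sets \<mu> = sets borel \<and>
     (\<forall>\<phi>. continuous_on UNIV \<phi> \<longrightarrow>
        (\<integral>z. transition_op k f b \<phi> z \<partial>\<mu>) = (\<integral>z. \<phi> z \<partial>\<mu>))"

definition stationary_measure ::
    "nat \<Rightarrow> (nat \<Rightarrow> rsphere \<Rightarrow> rsphere) \<Rightarrow> (nat \<Rightarrow> real) \<Rightarrow> rsphere measure" where
  "stationary_measure k f b = (THE \<mu>. stationary k f b \<mu>)"

text \<open>The library's \<open>weak_conv_m\<close> is only available for measures on \<open>\<real>\<close>.\<close>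

definition weakly_converges :: "(nat \<Rightarrow> 'a::topological_space measure) \<Rightarrow> 'a measure \<Rightarrow> bool" where
  "weakly_converges M N \<longleftrightarrow>
     (\<forall>\<phi> :: 'a \<Rightarrow> real. continuous_on UNIV \<phi> \<and> bounded (range \<phi>) \<longrightarrow>
        (\<lambda>n. \<integral>z. \<phi> z \<partial>M n) \<longlonglongrightarrow> (\<integral>z. \<phi> z \<partial>N))"

end

theory Submission
  imports
    Defs
    "HOL-Library.Discrete_Functions"
    "HOL-Complex_Analysis.Great_Picard"
begin

text \<open>
  The chordal metric turns Moebius maps into maps \<open>h\<close> with \<open>d(h x, h y) = \<tau>(x) \<tau>(y) d(x, y)\<close>, so the
  absolute cross-ratio is invariant. If two points at which the semigroup \<open>G\<inverse>\<close> is equicontinuous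
  could not be brought together by its elements, a nearby third point would stay separated from
  both, and cross-ratios would give equicontinuity on the whole sphere, contradicting
  \<open>J(G\<inverse>) \<noteq> \<emptyset>\<close>. Since \<open>J\<^sub>k\<^sub>e\<^sub>r(G\<inverse>) = \<emptyset>\<close>, every point enters the Fatou set with a
  probability bounded below; hence the expected distance of two orbits driven by the same symbols is
  equicontinuous near the diagonal and tends to \<open>0\<close> uniformly. So the iterates of the transfer
  operator on a continuous function converge uniformly to a constant, which gives uniqueness of the
  invariant measure; it exists as the law of a limit of reversed products. The deviations
  \<open>\<phi>(z\<^sub>j\<^sub>+\<^sub>1) - T\<phi>(z\<^sub>j)\<close> are orthogonal with bounded variance, so their averages vanish almost surely;
  applied to all \<open>T\<^sup>i\<phi>\<close>, this reduces the averages of \<open>\<phi>\<close> to those of the nearly constant \<open>T\<^sup>m\<phi>\<close>.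
\<close>

section \<open>Measures on metric spaces and a law of large numbers\<close>

text \<open>Bringing two orbits together once is not enough: later symbols may tear them apart
  again, since single words can expand strongly near the Julia set. This is why equicontinuity of
  the expected distances, uniform in time, is proved before any contraction: it makes a gain once
  achieved permanent on average. Contraction is then needed along only one word per pair.
  Compactness bounds the length of these words by some \<open>N\<close>, so each has probability at
  least \<open>c ^ N\<close>, where \<open>c\<close> bounds the weights from below.

  The order of composition matters for existence. In the orbit of the theorem the newest map is
  outermost, and the orbit keeps moving; in the reversed product it is innermost, which for each
  fixed length gives the same law but allows almost sure convergence.

  An exceptional null set may depend on the test function, while weak convergence needs one null set
  for all of them. The uncountably many test functions are therefore replaced by countably many
  bumps whose finite combinations approximate every continuous function uniformly.\<close>

lemma Cauchy_summable_dist: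
  fixes X :: "nat \<Rightarrow> 'a::metric_space"
  assumes "summable (\<lambda>n. dist (X n) (X (Suc n)))"
  shows "Cauchy X"
proof -
  have le: "dist (X m) (X n) \<le> (\<Sum>i=m..<n. dist (X i) (X (Suc i)))" if "m \<le> n" for m n
    using that
  proof (induction n rule: dec_induct)
    case (step n)
    then show ?case using dist_triangle[of "X m" "X (Suc n)" "X n"] by simp
  qed simp
  show ?thesis unfolding Cauchy_altdef
  proof (intro allI impI)
    fix e :: real assume "e > 0"
    then obtain N where N: "\<And>m n. m \<ge> N \<Longrightarrow> norm (\<Sum>i=m..<n. dist (X i) (X (Suc i))) < e"
      using assms unfolding summable_Cauchy by meson
    have "dist (X m) (X n) < e" if "m \<ge> N" "n > m" for m n
      using le[of m n] N[of m n] that by auto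
    then show "\<exists>M. \<forall>m\<ge>M. \<forall>n>m. dist (X m) (X n) < e" by blast
  qed
qed

text \<open>Closed sets form an intersection-stable generator of the Borel sets, and the indicator
  of a nonempty closed set is the pointwise limit of continuous bumps that fall off linearly with
  the distance to the set.\<close>

lemma measure_eqI_continuous:
  fixes M N :: "'a::metric_space measure"
  assumes "finite_measure M" "finite_measure N" and sets: "sets M = sets borel" "sets N = sets borel"
    and eq: "\<And>\<phi>::'a \<Rightarrow> real. continuous_on UNIV \<phi> \<Longrightarrow> bounded (range \<phi>) \<Longrightarrow> (\<integral>x. \<phi> x \<partial>M) = (\<integral>x. \<phi> x \<partial>N)"
  shows "M = N"
proof -
  interpret M: finite_measure M by fact
  interpret N: finite_measure N by fact
  have [measurable_cong]: "sets M = sets borel" "sets N = sets borel" by fact+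
  have sp: "space M = UNIV" "space N = UNIV" using sets by (auto dest: sets_eq_imp_space_eq)
  have closed_eq: "emeasure M A = emeasure N A" if "closed A" for A
  \<comment> \<open>\<open>infdist x {}\<close> is 0 by convention, so the bumps would not tend to
    the indicator of the empty set.\<close>
  proof (cases "A = {}")
    case False
    define \<phi> where "\<phi> n x = max 0 (1 - real n * infdist x A)" for n :: nat and x
    have lim: "(\<lambda>n. \<phi> n x) \<longlonglongrightarrow> indicator A x" for x
    proof (cases "x \<in> A")
      case True
      then show ?thesis by (simp add: \<phi>_def)
    next
      case False
      then have pos: "infdist x A > 0"
        using \<open>A \<noteq> {}\<close> \<open>closed A\<close> infdist_pos_not_in_closed by blast
      obtain n0 where "1 < real n0 * infdist x A"
        using reals_Archimedean3[OF pos] by blast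
      then have "\<phi> n x = 0" if "n \<ge> n0" for n
      proof -
        have "real n0 * infdist x A \<le> real n * infdist x A"
          using that pos by (intro mult_right_mono) auto
        with \<open>1 < real n0 * infdist x A\<close> show ?thesis by (simp add: \<phi>_def)
      qed
      then have "eventually (\<lambda>n. \<phi> n x = indicator A x) sequentially"
        using False by (auto simp: eventually_sequentially)
      then show ?thesis by (rule tendsto_eventually)
    qed
    have cont: "continuous_on UNIV (\<phi> n)" for n
      unfolding \<phi>_def by (intro continuous_intros)
    have meas [measurable]: "\<phi> n \<in> borel_measurable borel" for n
      using cont by (rule borel_measurable_continuous_onI)
    have bd: "norm (\<phi> n x) \<le> 1" for n x
      by (auto simp: \<phi>_def max_def infdist_nonneg)
    have A [measurable]: "A \<in> sets borel" using \<open>closed A\<close> by simp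
    have lM: "(\<lambda>n. \<integral>x. \<phi> n x \<partial>M) \<longlonglongrightarrow> (\<integral>x. indicator A x \<partial>M)"
      by (rule integral_dominated_convergence[where w="\<lambda>_. 1"]) (use lim bd in auto)
    have lN: "(\<lambda>n. \<integral>x. \<phi> n x \<partial>N) \<longlonglongrightarrow> (\<integral>x. indicator A x \<partial>N)"
      by (rule integral_dominated_convergence[where w="\<lambda>_. 1"]) (use lim bd in auto)
    have "(\<integral>x. \<phi> n x \<partial>M) = (\<integral>x. \<phi> n x \<partial>N)" for n
      using bd by (intro eq cont) (auto simp: bounded_iff)
    then have "(\<integral>x. indicator A x \<partial>M) = (\<integral>x. indicator A x \<partial>N :: real)"
      using LIMSEQ_unique[OF lM] lN by simp
    then show ?thesis
      using sp by (simp add: M.emeasure_eq_measure N.emeasure_eq_measure)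
  qed simp
  show ?thesis
  proof (rule measure_eqI_generator_eq[where \<Omega>=UNIV and E="{A. closed A}" and A="\<lambda>_. UNIV"])
    show "Int_stable {A::'a set. closed A}" by (auto simp: Int_stable_def)
    show "sets M = sigma_sets UNIV {A. closed A}" "sets N = sigma_sets UNIV {A. closed A}"
      using sets by (simp_all add: borel_eq_closed sets_measure_of)
  qed (use closed_eq M.emeasure_finite in auto)
qed

text \<open>Along the squares the second moments of \<open>S n / n\<close> are summable, which gives
  almost sure convergence there. Bounded increments then control the indices between consecutive
  squares. No independence is involved, only the linear growth of the second moment.\<close>

lemma (in prob_space) AE_quadratic_lln:
  fixes S :: "nat \<Rightarrow> 'a \<Rightarrow> real"
  assumes [measurable]: "\<And>n. S n \<in> borel_measurable M"
    and incr: "\<And>n \<omega>. \<omega> \<in> space M \<Longrightarrow> \<bar>S (Suc n) \<omega> - S n \<omega>\<bar> \<le> C"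
    and int: "\<And>n. integrable M (\<lambda>\<omega>. (S n \<omega>)\<^sup>2)"
    and var: "\<And>n. (\<integral>\<omega>. (S n \<omega>)\<^sup>2 \<partial>M) \<le> C' * real n"
  shows "AE \<omega> in M. (\<lambda>n. S n \<omega> / real n) \<longlonglongrightarrow> 0"
proof -
  have "C' \<ge> 0"
    using order_trans[OF Bochner_Integration.integral_nonneg var[of 1]] by simp
  obtain \<omega>0 where "\<omega>0 \<in> space M" using not_empty by blast
  then have "C \<ge> 0" using incr[of \<omega>0 0] by linarith
  \<comment> \<open>The index \<open>Suc m\<close> keeps the denominators nonzero.\<close>
  define Q where "Q m \<omega> = (S ((Suc m)\<^sup>2) \<omega> / real ((Suc m)\<^sup>2))\<^sup>2" for m \<omega>
  have [measurable]: "Q m \<in> borel_measurable M" for m unfolding Q_def by measurable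
  have Q0: "Q m \<omega> \<ge> 0" for m \<omega> by (simp add: Q_def)
  have EQ: "(\<integral>\<^sup>+\<omega>. ennreal (Q m \<omega>) \<partial>M) \<le> ennreal (C' * (1 / real ((Suc m)\<^sup>2)))" for m
  proof -
    have I: "integrable M (Q m)"
      unfolding Q_def power_divide using int by simp
    have "(\<integral>\<omega>. Q m \<omega> \<partial>M) = (\<integral>\<omega>. (S ((Suc m)\<^sup>2) \<omega>)\<^sup>2 \<partial>M) / (real ((Suc m)\<^sup>2))\<^sup>2"
      unfolding Q_def power_divide by simp
    also have "\<dots> \<le> C' * real ((Suc m)\<^sup>2) / (real ((Suc m)\<^sup>2))\<^sup>2"
      by (intro divide_right_mono var) simp
    also have "\<dots> = C' * (1 / real ((Suc m)\<^sup>2))"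
      by (simp add: power2_eq_square)
    finally show ?thesis
      using I Q0 by (subst nn_integral_eq_integral) (auto intro: ennreal_leI)
  qed
  have sm: "summable (\<lambda>m. C' * (1 / real ((Suc m)\<^sup>2)))"
  proof -
    have "summable (\<lambda>m. 1 / (real (Suc m))\<^sup>2)"
      using inverse_power_summable[of 2, where 'a=real] summable_Suc_iff[of "\<lambda>n. inverse ((real n)\<^sup>2)"]
      by (simp add: inverse_eq_divide)
    then show ?thesis by (intro summable_mult) (simp add: of_nat_power)
  qed
  have "(\<integral>\<^sup>+\<omega>. (\<Sum>m. ennreal (Q m \<omega>)) \<partial>M) = (\<Sum>m. \<integral>\<^sup>+\<omega>. ennreal (Q m \<omega>) \<partial>M)"
    by (intro nn_integral_suminf) auto
  also have "\<dots> \<le> (\<Sum>m. ennreal (C' * (1 / real ((Suc m)\<^sup>2))))"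
    by (intro suminf_le EQ) auto
  also have "\<dots> < \<infinity>"
    using sm \<open>C' \<ge> 0\<close> by (subst suminf_ennreal2) (auto simp: less_top[symmetric])
  finally have "AE \<omega> in M. (\<Sum>m. ennreal (Q m \<omega>)) \<noteq> \<infinity>"
    by (intro nn_integral_PInf_AE) auto
  from this AE_space show ?thesis
  proof eventually_elim
    case \<omega>: (elim \<omega>)
    have "summable (\<lambda>m. Q m \<omega>)"
      using \<omega>(1) Q0 by (intro summable_suminf_not_top) auto
    then have "(\<lambda>m. sqrt (Q m \<omega>)) \<longlonglongrightarrow> sqrt 0"
      by (intro tendsto_real_sqrt summable_LIMSEQ_zero)
    then have sq: "(\<lambda>m. \<bar>S ((Suc m)\<^sup>2) \<omega>\<bar> / real ((Suc m)\<^sup>2)) \<longlonglongrightarrow> 0"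
      by (simp add: Q_def del: of_nat_Suc of_nat_power)
    have step: "\<bar>S (n + i) \<omega> - S n \<omega>\<bar> \<le> C * real i" for n i
    proof (induction i)
      case (Suc i)
      then show ?case using incr[OF \<omega>(2), of "n + i"] by (simp add: algebra_simps)
    qed simp
    \<comment> \<open>For \<open>n\<close> at least 1, \<open>Suc (r n)\<close> is the integer
      square root of \<open>n\<close>; the shift by one matches the index of
      \<open>Q\<close>.\<close>
    define r where "r n = floor_sqrt n - 1" for n :: nat
    have r: "filterlim r sequentially sequentially"
      unfolding filterlim_at_top
    proof
      fix Z
      show "eventually (\<lambda>n. Z \<le> r n) sequentially"
        unfolding eventually_sequentially r_def
        by (rule exI[of _ "(Suc Z)\<^sup>2"]) (use mono_floor_sqrt'[of "(Suc Z)\<^sup>2"] in fastforce)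
    qed
    have lim: "(\<lambda>n. \<bar>S ((Suc (r n))\<^sup>2) \<omega>\<bar> / real ((Suc (r n))\<^sup>2) + 2 * C * (1 / real (Suc (r n)))) \<longlonglongrightarrow> 0 + 2 * C * 0"
      by (intro tendsto_add tendsto_mult tendsto_const filterlim_compose[OF sq r]
          filterlim_compose[OF LIMSEQ_inverse_real_of_nat[unfolded inverse_eq_divide] r])
    have bound: "norm (S n \<omega> / real n) \<le> \<bar>S ((Suc (r n))\<^sup>2) \<omega>\<bar> / real ((Suc (r n))\<^sup>2) + 2 * C * (1 / real (Suc (r n)))"
      if "n \<ge> 1" for n
    proof -
      define m where "m = Suc (r n)"
      have m: "m = floor_sqrt n" "m \<ge> 1"
        using that by (simp_all add: m_def r_def Suc_leI)
      \<comment> \<open>The distance to the last square is at most \<open>2 * m\<close>, negligible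
        against \<open>m\<^sup>2\<close>.\<close>
      have le: "m\<^sup>2 \<le> n" "n \<le> m\<^sup>2 + 2 * m"
        using m floor_sqrt_power2_le[of n] Suc_floor_sqrt_power2_gt[of n] by (auto simp: power2_eq_square)
      have "\<bar>S n \<omega> - S (m\<^sup>2) \<omega>\<bar> \<le> C * real (n - m\<^sup>2)"
        using step[of "m\<^sup>2" "n - m\<^sup>2"] le by simp
      also have "\<dots> \<le> C * real (2 * m)"
        using le \<open>C \<ge> 0\<close> by (intro mult_left_mono of_nat_mono) auto
      finally have "\<bar>S n \<omega>\<bar> \<le> \<bar>S (m\<^sup>2) \<omega>\<bar> + 2 * C * real m" by (simp add: algebra_simps)
      then have "\<bar>S n \<omega>\<bar> / real n \<le> (\<bar>S (m\<^sup>2) \<omega>\<bar> + 2 * C * real m) / real n"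
        by (intro divide_right_mono) auto
      also have "\<dots> \<le> (\<bar>S (m\<^sup>2) \<omega>\<bar> + 2 * C * real m) / real (m\<^sup>2)"
        using le m(2) that \<open>C \<ge> 0\<close> by (intro divide_left_mono mult_pos_pos of_nat_mono) auto
      also have "\<dots> = \<bar>S (m\<^sup>2) \<omega>\<bar> / real (m\<^sup>2) + 2 * C * (1 / real m)"
        using m by (simp add: add_divide_distrib power2_eq_square)
      finally show ?thesis by (simp add: m_def)
    qed
    show "(\<lambda>n. S n \<omega> / real n) \<longlonglongrightarrow> 0"
      by (rule Lim_null_comparison[OF _ lim[simplified]])
         (use bound in \<open>auto simp: eventually_sequentially intro!: exI[of _ 1]\<close>)
  qed
qed

text \<open>Tents of radius \<open>1 / (m + 1)\<close> around a finite net, divided by their sum.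
  The functions \<open>u m c\<close> do not depend on \<open>\<phi>\<close>, which enters only
  through its values at the centres; this is what makes one countable family serve all continuous
  functions.\<close>

lemma compact_partition_of_unity:
  assumes "compact (UNIV :: 'a::metric_space set)"
  obtains C :: "nat \<Rightarrow> 'a::metric_space set" and u :: "nat \<Rightarrow> 'a \<Rightarrow> 'a \<Rightarrow> real"
  where "\<And>m. finite (C m)" "\<And>m c. continuous_on UNIV (u m c)"
    "\<And>\<phi> \<epsilon>. continuous_on UNIV \<phi> \<Longrightarrow> 0 < \<epsilon> \<Longrightarrow> \<exists>m. \<forall>x. \<bar>\<phi> x - (\<Sum>c\<in>C m. \<phi> c * u m c x)\<bar> \<le> \<epsilon>"
proof -
  have "\<exists>K. finite K \<and> (UNIV :: 'a set) \<subseteq> (\<Union>x\<in>K. ball x (1 / real (Suc m)))" for m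
    using compact_eq_totally_bounded[of "UNIV::'a set"] assms by auto
  then obtain C :: "nat \<Rightarrow> 'a set" where C: "\<And>m. finite (C m)"
      "\<And>m. UNIV \<subseteq> (\<Union>x\<in>C m. ball x (1 / real (Suc m)))" by metis
  define t where "t m c x = max 0 (1 / real (Suc m) - dist c x)" for m :: nat and c x :: 'a
  define u where "u m c x = t m c x / (\<Sum>c\<in>C m. t m c x)" for m c x
  have t0: "t m c x \<ge> 0" for m c x by (simp add: t_def)
  have s: "(\<Sum>c\<in>C m. t m c x) > 0" for m x
  proof -
    have "x \<in> (\<Union>c\<in>C m. ball c (1 / real (Suc m)))" using C(2)[of m] by blast
    then obtain c where c: "c \<in> C m" "dist c x < 1 / real (Suc m)" by auto
    then show ?thesis using C(1) t0 by (intro sum_pos2[of _ c]) (auto simp: t_def)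
  qed
  have u0: "u m c x \<ge> 0" for m c x using t0 s[of m x] by (simp add: u_def)
  have u1: "(\<Sum>c\<in>C m. u m c x) = 1" for m x
    using s[of m x] by (simp add: u_def sum_divide_distrib[symmetric])
  show ?thesis
  proof
    show "continuous_on UNIV (u m c)" for m c
    proof -
      have "continuous_on UNIV (t m c)" for c unfolding t_def by (intro continuous_intros)
      then show ?thesis
        unfolding u_def using s[of m] by (intro continuous_on_divide continuous_on_sum) (auto simp: less_le)
    qed
    fix \<phi> :: "'a \<Rightarrow> real" and \<epsilon> :: real assume "continuous_on UNIV \<phi>" "\<epsilon> > 0"
    then obtain d where d: "d > 0" "\<And>x y. dist x y < d \<Longrightarrow> \<bar>\<phi> x - \<phi> y\<bar> < \<epsilon>"
      using compact_uniformly_continuous[of UNIV \<phi>] assms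
      unfolding uniformly_continuous_on_def by (metis UNIV_I dist_commute dist_real_def)
    obtain m where m: "1 / real (Suc m) < d"
      using nat_approx_posE[OF d(1)] by blast
    have "\<bar>\<phi> x - (\<Sum>c\<in>C m. \<phi> c * u m c x)\<bar> \<le> \<epsilon>" for x
    proof -
      have "\<phi> x - (\<Sum>c\<in>C m. \<phi> c * u m c x) = (\<Sum>c\<in>C m. \<phi> x * u m c x) - (\<Sum>c\<in>C m. \<phi> c * u m c x)"
        by (simp add: sum_distrib_left[symmetric] u1)
      also have "\<dots> = (\<Sum>c\<in>C m. (\<phi> x - \<phi> c) * u m c x)"
        by (simp add: sum_subtractf algebra_simps)
      also have "\<bar>\<dots>\<bar> \<le> (\<Sum>c\<in>C m. \<epsilon> * u m c x)"
      proof (rule order_trans[OF sum_abs sum_mono])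
        fix c
        show "\<bar>(\<phi> x - \<phi> c) * u m c x\<bar> \<le> \<epsilon> * u m c x"
        \<comment> \<open>Centres outside this radius have weight 0 at \<open>x\<close>; at the
          others uniform continuity applies.\<close>
        proof (cases "dist c x < 1 / real (Suc m)")
          case True
          then have "\<bar>\<phi> x - \<phi> c\<bar> \<le> \<epsilon>" using d(2)[of x c] m by (auto simp: dist_commute)
          then show ?thesis using u0[of m c x] by (auto simp: abs_mult intro!: mult_right_mono)
        next
          case False
          then show ?thesis by (simp add: u_def t_def)
        qed
      qed
      also have "\<dots> = \<epsilon>" by (simp add: sum_distrib_left[symmetric] u1)
      finally show ?thesis .
    qed
    then show "\<exists>m. \<forall>x. \<bar>\<phi> x - (\<Sum>c\<in>C m. \<phi> c * u m c x)\<bar> \<le> \<epsilon>" by blast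
  qed (rule C)
qed

text \<open>As the image of the uniform distribution on the times 1 to \<open>n\<close>, the
  empirical measure has integrals that are finite averages.\<close>

lemma empirical_measure_eq_distr:
  fixes z :: "nat \<Rightarrow> 'a::topological_space"
  assumes "n \<ge> 1"
  shows "empirical_measure z n = distr (uniform_count_measure {1..n}) borel z"
proof (rule measure_eqI)
  fix A assume "A \<in> sets (empirical_measure z n)"
  then have A: "A \<in> sets borel" by simp
  have "(\<Sum>j=1..n. emeasure (return borel (z j)) A) = (\<Sum>j=1..n. ennreal (indicator A (z j)))"
    using A by (intro sum.cong) (auto simp: ennreal_indicator)
  also have "\<dots> = ennreal (\<Sum>j=1..n. indicator A (z j))"
    by (intro sum_ennreal) auto
  also have "(\<Sum>j=1..n. indicator A (z j)) = real (card (z -` A \<inter> {1..n}))"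
    by (simp add: indicator_def sum.If_cases Int_commute vimage_def)
  finally have "emeasure (empirical_measure z n) A = ennreal (1 / real n) * ennreal (real (card (z -` A \<inter> {1..n})))"
    using emeasure_empirical_measure[OF A] by simp
  also have "\<dots> = ennreal (real (card (z -` A \<inter> {1..n})) / real n)"
    by (subst ennreal_mult[symmetric]) auto
  also have "\<dots> = emeasure (distr (uniform_count_measure {1..n}) borel z) A"
    using A assms by (subst emeasure_distr)
      (auto simp: space_uniform_count_measure emeasure_uniform_count_measure measurable_def sets_uniform_count_measure)
  finally show "emeasure (empirical_measure z n) A = emeasure (distr (uniform_count_measure {1..n}) borel z) A" .
qed simp

lemma integral_empirical_measure:
  fixes z :: "nat \<Rightarrow> 'a::topological_space" and \<phi> :: "'a \<Rightarrow> real"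
  assumes "n \<ge> 1" "\<phi> \<in> borel_measurable borel"
  shows "(\<integral>x. \<phi> x \<partial>empirical_measure z n) = (\<Sum>j=1..n. \<phi> (z j)) / real n"
proof -
  have "z \<in> uniform_count_measure {1..n} \<rightarrow>\<^sub>M borel"
    by (auto simp: measurable_def sets_uniform_count_measure space_uniform_count_measure)
  then show ?thesis
    using assms by (simp add: empirical_measure_eq_distr integral_distr integral_uniform_count_measure)
qed

section \<open>Random iteration on a compact metric space\<close>

text \<open>\<open>g j\<close> stands for the inverse of the \<open>j\<close>-th generator. Second
  countability makes the Borel sets of the square the product sigma-algebra, so that continuous
  functions of two random points are measurable.\<close>

locale random_system =
  fixes k :: nat and b :: "nat \<Rightarrow> real"
    and g :: "nat \<Rightarrow> 'a::{metric_space, second_countable_topology} \<Rightarrow> 'a"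
  assumes prob_vector: "prob_vector k b"
    and continuous_g: "j \<in> {1..k} \<Longrightarrow> continuous_on UNIV (g j)"
    and compact_space: "compact (UNIV :: 'a set)"
begin

section \<open>Averaging over one symbol and the mean distance of coupled orbits\<close>

definition avg :: "(nat \<Rightarrow> 'v::real_vector) \<Rightarrow> 'v" where
  "avg F = (\<Sum>j=1..k. b j *\<^sub>R F j)"

text \<open>General vector values let one operator act on real and on complex test
  functions.\<close>

definition transfer :: "('a \<Rightarrow> 'v::real_vector) \<Rightarrow> 'a \<Rightarrow> 'v" where
  "transfer \<phi> x = avg (\<lambda>j. \<phi> (g j x))"

definition pair_op :: "('a \<Rightarrow> 'a \<Rightarrow> real) \<Rightarrow> 'a \<Rightarrow> 'a \<Rightarrow> real" where
  "pair_op \<Phi> x y = avg (\<lambda>j. \<Phi> (g j x) (g j y))"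

text \<open>The expected distance after \<open>n\<close> steps of two points moved by the same
  random symbols. Iterating a finite average instead of integrating over sequences keeps the
  contraction argument free of measure theory.\<close>

definition mean_dist :: "nat \<Rightarrow> 'a \<Rightarrow> 'a \<Rightarrow> real" where
  "mean_dist n = (pair_op ^^ n) dist"

text \<open>The points of equicontinuity of the semigroup with the identity adjoined, since the
  empty word is allowed. \<open>fold\<close> applies the first letter of a word first. This set
  replaces the Fatou set in the abstract argument; it is not known to be open, hence the interiors
  below.\<close>

definition equi_set :: "'a set" where
  "equi_set = {x. \<forall>\<epsilon>>0. \<exists>\<delta>>0. \<forall>w \<in> lists {1..k}. \<forall>y. dist y x < \<delta> \<longrightarrow> dist (fold g w y) (fold g w x) < \<epsilon>}"

lemma b_nonneg: "j \<in> {1..k} \<Longrightarrow> 0 \<le> b j" and b_pos: "j \<in> {1..k} \<Longrightarrow> 0 < b j"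
  and sum_b: "(\<Sum>j=1..k. b j) = 1"
  using prob_vector by (auto simp: prob_vector_def intro: less_imp_le)

lemma avg_const [simp]: "avg (\<lambda>_. c) = c"
  unfolding avg_def scaleR_left.sum[symmetric] by (simp only: sum_b scaleR_one)

lemma avg_mono: "(\<And>j. j \<in> {1..k} \<Longrightarrow> F j \<le> F' j) \<Longrightarrow> avg F \<le> avg F'" for F F' :: "nat \<Rightarrow> real"
  unfolding avg_def using b_nonneg by (intro sum_mono) (auto intro!: mult_left_mono)

lemma avg_cong: "(\<And>j. j \<in> {1..k} \<Longrightarrow> F j = F' j) \<Longrightarrow> avg F = avg F'"
  unfolding avg_def by (intro sum.cong) auto

lemma avg_le: "(\<And>j. j \<in> {1..k} \<Longrightarrow> F j \<le> c) \<Longrightarrow> avg F \<le> c" for F :: "nat \<Rightarrow> real"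
  using avg_mono[of F "\<lambda>_. c"] by simp

lemma avg_nonneg: "(\<And>j. j \<in> {1..k} \<Longrightarrow> 0 \<le> F j) \<Longrightarrow> 0 \<le> avg F" for F :: "nat \<Rightarrow> real"
  using avg_mono[of "\<lambda>_. 0" F] by simp

lemma norm_avg_le: "norm (avg F) \<le> avg (\<lambda>j. norm (F j))"
  for F :: "nat \<Rightarrow> 'v::real_normed_vector"
  unfolding avg_def using b_nonneg by (intro sum_norm_le) simp

lemma avg_add: "avg (\<lambda>j. F j + F' j) = avg F + avg F'"
  by (simp add: avg_def scaleR_add_right sum.distrib)

lemma avg_diff: "avg (\<lambda>j. F j - F' j) = avg F - avg F'"
  by (simp add: avg_def scaleR_diff_right sum_subtractf)

lemma avg_cmult: "avg (\<lambda>j. c * F j) = c * avg F" for F :: "nat \<Rightarrow> real"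
  by (simp add: avg_def sum_distrib_left mult_ac)

text \<open>The source of every contraction factor: a gain on a single symbol survives averaging in
  proportion to a lower bound \<open>c\<close> of its weight. Lowering \<open>b i\<close> to
  \<open>c\<close> is harmless because \<open>v \<le> u\<close>.\<close>

lemma avg_le_convex:
  fixes F :: "nat \<Rightarrow> real"
  assumes "i \<in> {1..k}" "\<And>j. j \<in> {1..k} \<Longrightarrow> F j \<le> u" "F i \<le> v" "v \<le> u" "c \<le> b i"
  shows "avg F \<le> (1 - c) * u + c * v"
proof -
  have "avg F = b i * F i + (\<Sum>j\<in>{1..k} - {i}. b j * F j)"
    using assms(1) by (simp add: avg_def sum.remove)
  also have "\<dots> \<le> b i * v + (\<Sum>j\<in>{1..k} - {i}. b j * u)"
    using assms b_nonneg by (intro add_mono sum_mono mult_left_mono) auto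
  also have "(\<Sum>j\<in>{1..k} - {i}. b j * u) = (1 - b i) * u"
    using assms(1) sum_b by (simp add: sum_distrib_right[symmetric] sum_diff1)
  also have "b i * v + (1 - b i) * u = u - b i * (u - v)"
    by (simp add: algebra_simps)
  also have "\<dots> \<le> u - c * (u - v)"
    using assms by (intro diff_left_mono mult_right_mono) auto
  finally show ?thesis by (simp add: algebra_simps)
qed

lemma mean_dist_0 [simp]: "mean_dist 0 x y = dist x y"
  by (simp add: mean_dist_def)

lemma mean_dist_Suc: "mean_dist (Suc n) x y = avg (\<lambda>j. mean_dist n (g j x) (g j y))"
  by (simp add: mean_dist_def pair_op_def)

lemma mean_dist_nonneg: "0 \<le> mean_dist n x y"
  by (induction n arbitrary: x y) (auto simp: mean_dist_Suc intro: avg_nonneg)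

lemma mean_dist_commute: "mean_dist n x y = mean_dist n y x"
  by (induction n arbitrary: x y) (auto simp: mean_dist_Suc dist_commute intro: avg_cong)

lemma mean_dist_triangle: "mean_dist n x z \<le> mean_dist n x y + mean_dist n y z"
proof (induction n arbitrary: x y z)
  case (Suc n)
  then show ?case unfolding mean_dist_Suc avg_add[symmetric] by (intro avg_mono)
qed (simp add: dist_triangle)

lemma mean_dist_le_words:
  assumes "\<And>w. w \<in> lists {1..k} \<Longrightarrow> dist (fold g w x) (fold g w y) \<le> \<epsilon>"
  shows "mean_dist n x y \<le> \<epsilon>"
  using assms
proof (induction n arbitrary: x y)
  case 0
  then show ?case using 0[of "[]"] by simp
next
  case (Suc n)
  show ?case unfolding mean_dist_Suc
  proof (intro avg_le Suc.IH)
    fix j w assume "j \<in> {1..k}" "w \<in> lists {1..k}"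
    then show "dist (fold g w (g j x)) (fold g w (g j y)) \<le> \<epsilon>"
      using Suc.prems[of "j # w"] by simp
  qed
qed

text \<open>One more step averages old values at other pairs, so a bound persists in time provided
  it holds at all pairs.\<close>

lemma mean_dist_mono:
  assumes "\<And>x y. mean_dist n x y \<le> \<epsilon>" "n \<le> m"
  shows "mean_dist m x y \<le> \<epsilon>"
  using assms(2)
proof (induction m arbitrary: x y rule: dec_induct)
  case (step m)
  then show ?case unfolding mean_dist_Suc by (intro avg_le)
qed (rule assms)

section \<open>Equicontinuity of the mean distance near the diagonal\<close>

lemma continuous_fold: "w \<in> lists {1..k} \<Longrightarrow> continuous_on UNIV (fold g w)"
proof (induction w)
  case (Cons j w)
  then show ?case
    using continuous_on_compose[OF continuous_g[of j] continuous_on_subset[OF Cons.IH]] by auto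
qed (simp add: id_def)

lemma open_vimage_fold: "w \<in> lists {1..k} \<Longrightarrow> open U \<Longrightarrow> open (fold g w -` U)"
  using continuous_fold by (simp add: continuous_on_open_vimage)

text \<open>Equicontinuity at \<open>x\<close> up to the error \<open>\<epsilon>\<close>. The radius
  must serve all times \<open>m\<close>, but the error is fixed; errors can thus be improved step by
  step while the radius shrinks freely.\<close>

definition good :: "real \<Rightarrow> 'a \<Rightarrow> bool" where
  "good \<epsilon> x \<longleftrightarrow> (\<exists>\<delta>>0. \<forall>m y. dist y x < \<delta> \<longrightarrow> mean_dist m x y \<le> \<epsilon>)"

lemma good_mono: "good \<epsilon> x \<Longrightarrow> \<epsilon> \<le> \<epsilon>' \<Longrightarrow> good \<epsilon>' x"
  unfolding good_def by (meson order_trans)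

lemma good_equi_set:
  assumes "x \<in> equi_set" "\<epsilon> > 0"
  shows "good \<epsilon> x"
proof -
  obtain \<delta> where "\<delta> > 0"
    and \<delta>: "\<And>w y. w \<in> lists {1..k} \<Longrightarrow> dist y x < \<delta> \<Longrightarrow> dist (fold g w y) (fold g w x) < \<epsilon>"
    using assms unfolding equi_set_def by blast
  have "mean_dist m x y \<le> \<epsilon>" if "dist y x < \<delta>" for m y
    using \<delta>[OF _ that] by (intro mean_dist_le_words) (auto simp: dist_commute less_imp_le)
  then show ?thesis using \<open>\<delta> > 0\<close> unfolding good_def by blast
qed

text \<open>The errors at the images of \<open>x\<close> average to an error at \<open>x\<close>,
  since conditioning on the first symbol leaves a mean distance that starts at the images.\<close>

lemma good_step:
  assumes "\<And>j. j \<in> {1..k} \<Longrightarrow> good (e j) (g j x)" and "0 < avg e"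
  shows "good (avg e) x"
proof -
  have "\<forall>j\<in>{1..k}. \<exists>\<delta>>0. \<forall>m y. dist y (g j x) < \<delta> \<longrightarrow> mean_dist m (g j x) y \<le> e j"
    using assms(1) by (auto simp: good_def)
  then obtain d where d: "\<And>j. j \<in> {1..k} \<Longrightarrow> d j > 0"
      "\<And>j m y. j \<in> {1..k} \<Longrightarrow> dist y (g j x) < d j \<Longrightarrow> mean_dist m (g j x) y \<le> e j"
    by metis
  have "\<forall>j\<in>{1..k}. \<exists>\<delta>>0. \<forall>y. dist y x < \<delta> \<longrightarrow> dist (g j y) (g j x) < d j"
    using continuous_g d(1) unfolding continuous_on_iff by (metis UNIV_I)
  then obtain d' where d': "\<And>j. j \<in> {1..k} \<Longrightarrow> d' j > 0"
      "\<And>j y. j \<in> {1..k} \<Longrightarrow> dist y x < d' j \<Longrightarrow> dist (g j y) (g j x) < d j"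
    by metis
  \<comment> \<open>\<open>avg e\<close> is included because of time 0, where the mean distance is
    the distance itself.\<close>
  define \<delta> where "\<delta> = Min (insert (avg e) (d' ` {1..k}))"
  have "\<delta> > 0" using d'(1) assms(2) by (simp add: \<delta>_def)
  have \<delta>: "\<delta> \<le> avg e" "j \<in> {1..k} \<Longrightarrow> \<delta> \<le> d' j" for j
    unfolding \<delta>_def by (rule Min_le; simp)+
  have "mean_dist m x y \<le> avg e" if "dist y x < \<delta>" for m y
  proof (cases m)
    case 0
    then show ?thesis using \<delta>(1) that by (simp add: dist_commute)
  next
    case (Suc n)
    show ?thesis unfolding Suc mean_dist_Suc
    proof (intro avg_mono d(2) d'(2))
      fix j assume "j \<in> {1..k}"
      then show "dist y x < d' j" using \<delta>(2)[of j] that by simp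
    qed
  qed
  then show ?thesis using \<open>\<delta> > 0\<close> unfolding good_def by blast
qed

lemma bounded_below_weights: obtains c where "0 < c" "c \<le> 1" "\<And>j. j \<in> {1..k} \<Longrightarrow> c \<le> b j"
proof
  show "0 < Min (insert 1 (b ` {1..k}))" using b_pos by simp
  show "Min (insert 1 (b ` {1..k})) \<le> b j" if "j \<in> {1..k}" for j
    using that by (intro Min_le) auto
qed simp

text \<open>A finite subcover turns reachability by some word into reachability by words of bounded
  length. The type of points is left open because both points and pairs of points are covered in
  this way.\<close>

lemma finite_reach:
  assumes "\<And>x::'z::topological_space. \<exists>w\<in>lists {1..k}. x \<in> V w" "\<And>w. w \<in> lists {1..k} \<Longrightarrow> open (V w)"
    and "compact (UNIV::'z set)"
  obtains N where "\<And>x. \<exists>w\<in>lists {1..k}. length w \<le> N \<and> x \<in> V w"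
proof -
  obtain W where W: "W \<subseteq> lists {1..k}" "finite W" "UNIV \<subseteq> (\<Union>w\<in>W. V w)"
    using compactE_image[OF assms(3), of "lists {1..k}" V] assms(1,2) by (metis UNIV_I UN_iff subsetI)
  show ?thesis
  proof
    fix x
    obtain w where w: "w \<in> W" "x \<in> V w" using W by blast
    have "length w \<le> Max (length ` W)" using w W by (intro Max_ge) auto
    with w W show "\<exists>w\<in>lists {1..k}. length w \<le> Max (length ` W) \<and> x \<in> V w" by blast
  qed
qed

text \<open>The error is halved at the end of the word. Going back one letter costs a factor
  \<open>c\<close> in the gain, as all other letters are only known to have error
  \<open>\<epsilon>\<close>; hence the gain \<open>c ^ length w / 2\<close>.\<close>

lemma good_word:
  assumes "\<And>y. good \<epsilon> y" "\<epsilon> > 0" and c: "0 < c" "c \<le> 1" "\<And>j. j \<in> {1..k} \<Longrightarrow> c \<le> b j"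
    and "w \<in> lists {1..k}" "good (\<epsilon> / 2) (fold g w x)"
  shows "good ((1 - c ^ length w / 2) * \<epsilon>) x"
  using assms(6,7)
proof (induction w arbitrary: x)
  case (Cons j w)
  define u where "u = (1 - c ^ length w / 2) * \<epsilon>"
  have j: "j \<in> {1..k}" using Cons by simp
  have cp: "0 < c ^ n" "c ^ n \<le> 1" for n using c by (auto intro: power_le_one)
  have ule: "0 < u" "u \<le> \<epsilon>" using cp[of "length w"] \<open>\<epsilon> > 0\<close>
    by (auto simp: u_def intro!: mult_pos_pos)
  have "good u (g j x)" unfolding u_def using Cons by (intro Cons.IH) auto
  define e where "e i = (if i = j then u else \<epsilon>)" for i
  have "0 < avg e"
  proof -
    have "min u \<epsilon> \<le> avg e"
      using avg_mono[of "\<lambda>_. min u \<epsilon>" e] by (auto simp: e_def)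
    then show ?thesis using ule \<open>\<epsilon> > 0\<close> by linarith
  qed
  then have "good (avg e) x"
    using assms(1) \<open>good u (g j x)\<close> by (intro good_step) (auto simp: e_def)
  moreover have "avg e \<le> (1 - c) * \<epsilon> + c * u"
    using j ule c by (intro avg_le_convex[where i = j]) (auto simp: e_def)
  moreover have "(1 - c) * \<epsilon> + c * u = (1 - c ^ length (j # w) / 2) * \<epsilon>"
    by (simp add: u_def algebra_simps)
  ultimately show ?case by (metis good_mono)
qed simp

text \<open>Every point reaches the equicontinuity set with a probability bounded below, so each round
  shrinks the modulus by a fixed factor.\<close>

lemma good_all:
  assumes reach: "\<And>x. \<exists>w\<in>lists {1..k}. fold g w x \<in> interior equi_set" and "\<epsilon> > 0"
  shows "good \<epsilon> x"
proof -
  obtain c where c: "0 < c" "c \<le> 1" "\<And>j. j \<in> {1..k} \<Longrightarrow> c \<le> b j"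
    using bounded_below_weights by blast
  obtain N where N: "\<And>x. \<exists>w\<in>lists {1..k}. length w \<le> N \<and> x \<in> fold g w -` interior equi_set"
    using finite_reach[of "\<lambda>w. fold g w -` interior equi_set"] reach open_vimage_fold compact_space
    by (metis open_interior vimage_eq)
  define q where "q = 1 - c ^ N / 2"
  have cN: "0 < c ^ N" "c ^ N \<le> 1" using c by (auto intro: power_le_one)
  then have q: "0 < q" "q < 1" by (auto simp: q_def)
  obtain K where K: "\<And>x y::'a. dist x y \<le> K"
    using compact_imp_bounded[OF compact_space] unfolding bounded_two_points by blast
  \<comment> \<open>The diameter bound starts the iteration; the maximum makes it positive, as
    \<open>good_word\<close> demands.\<close>
  define K' where "K' = max K 1"
  have K': "K' > 0" "K \<le> K'" by (auto simp: K'_def)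
  have base: "good K' x" for x
    unfolding good_def
    by (rule exI[of _ 1]) (auto intro!: mean_dist_le_words order_trans[OF K K'(2)])
  have all: "good (q ^ n * K') x" for n x
  proof (induction n arbitrary: x)
    case (Suc n)
    obtain w where w: "w \<in> lists {1..k}" "length w \<le> N" "fold g w x \<in> equi_set"
      using N[of x] interior_subset by blast
    have pos: "0 < q ^ n * K'" using q K' by simp
    have "good ((1 - c ^ length w / 2) * (q ^ n * K')) x"
      using good_word[OF Suc pos c w(1) good_equi_set[OF w(3)]] pos by simp
    \<comment> \<open>As \<open>c \<le> 1\<close>, the longest admissible word gives the worst
      factor, which is \<open>q\<close>.\<close>
    moreover have "(1 - c ^ length w / 2) * (q ^ n * K') \<le> q * (q ^ n * K')"
      using c w pos by (intro mult_right_mono) (auto simp: q_def power_decreasing)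
    ultimately show ?case by (metis good_mono mult.assoc power_Suc)
  qed (use base in simp)
  have "(\<lambda>n. q ^ n * K') \<longlonglongrightarrow> 0 * K'"
    using q by (intro tendsto_intros LIMSEQ_power_zero) auto
  then have "eventually (\<lambda>n. q ^ n * K' < \<epsilon>) sequentially"
    using \<open>\<epsilon> > 0\<close> by (intro order_tendstoD(2)) auto
  then obtain n where "q ^ n * K' < \<epsilon>" by (auto simp: eventually_sequentially)
  then show ?thesis using all good_mono less_imp_le by blast
qed

text \<open>A Lebesgue number for the cover by the balls of pointwise equicontinuity gives a uniform
  radius; two halves of \<open>\<epsilon>\<close> are spent in the triangle inequality through the
  centre of a ball.\<close>

lemma mean_dist_equicontinuous:
  assumes reach: "\<And>x. \<exists>w\<in>lists {1..k}. fold g w x \<in> interior equi_set" and "\<epsilon> > 0"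
  obtains \<delta> where "\<delta> > 0" "\<And>m x y. dist x y < \<delta> \<Longrightarrow> mean_dist m x y \<le> \<epsilon>"
proof -
  have "\<exists>\<delta>>0. \<forall>m y. dist y x < \<delta> \<longrightarrow> mean_dist m x y \<le> \<epsilon> / 2" for x
    using good_all[OF reach, of "\<epsilon> / 2" x] \<open>\<epsilon> > 0\<close> by (simp add: good_def)
  then obtain d where d: "\<And>x. d x > 0" "\<And>x m y. dist y x < d x \<Longrightarrow> mean_dist m x y \<le> \<epsilon> / 2"
    by metis
  obtain \<delta> where \<delta>: "\<delta> > 0" "\<And>x::'a. x \<in> UNIV \<Longrightarrow> \<exists>G\<in>(\<lambda>x. ball x (d x)) ` UNIV. ball x \<delta> \<subseteq> G"
    using Heine_Borel_lemma[OF compact_space, of "(\<lambda>x. ball x (d x)) ` UNIV"] d(1)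
    by (metis (no_types, lifting) UN_iff centre_in_ball imageE open_ball subsetI UNIV_I)
  show ?thesis
  proof
    fix m and x y :: 'a assume "dist x y < \<delta>"
    obtain z where "ball x \<delta> \<subseteq> ball z (d z)" using \<delta>(2)[of x] by auto
    then have "x \<in> ball z (d z)" "y \<in> ball z (d z)"
      using \<open>dist x y < \<delta>\<close> \<delta>(1) by (metis centre_in_ball mem_ball subset_iff)+
    then have "mean_dist m z x \<le> \<epsilon> / 2" "mean_dist m z y \<le> \<epsilon> / 2"
      using d(2) by (auto simp: dist_commute)
    then show "mean_dist m x y \<le> \<epsilon>"
      using mean_dist_triangle[of m x y z] mean_dist_commute[of m x z] by simp
  qed fact
qed

section \<open>Uniform decay of the mean distance\<close>

text \<open>The counterpart of \<open>good_word\<close> for arbitrary pairs. The condition on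
  \<open>m\<close> leaves at least \<open>n\<close> steps on each branch that departs from the word,
  so that the general bound \<open>\<epsilon>\<close> is available there.\<close>

lemma mean_dist_word:
  assumes "\<And>x y. mean_dist n x y \<le> \<epsilon>" "\<epsilon> \<ge> 0" and c: "0 < c" "c \<le> 1" "\<And>j. j \<in> {1..k} \<Longrightarrow> c \<le> b j"
    and "w \<in> lists {1..k}" "\<And>m. mean_dist m (fold g w x) (fold g w y) \<le> \<epsilon> / 2"
    and "m \<ge> n + length w"
  shows "mean_dist m x y \<le> (1 - c ^ length w / 2) * \<epsilon>"
  using assms(6-8)
proof (induction w arbitrary: x y m rule: list.induct)
  case (Cons j w)
  define u where "u = (1 - c ^ length w / 2) * \<epsilon>"
  obtain m' where m: "m = Suc m'" "m' \<ge> n + length w" using Cons.prems(3) by (cases m) auto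
  have cp: "0 < c ^ n" "c ^ n \<le> 1" for n using c by (auto intro: power_le_one)
  have u: "u \<le> \<epsilon>" using cp[of "length w"] \<open>\<epsilon> \<ge> 0\<close>
    unfolding u_def by (intro mult_left_le_one_le) auto
  have "mean_dist m' (g j x) (g j y) \<le> u"
    unfolding u_def using Cons.prems m by (intro Cons.IH) auto
  then have "avg (\<lambda>i. mean_dist m' (g i x) (g i y)) \<le> (1 - c) * \<epsilon> + c * u"
    using Cons.prems m u c by (intro avg_le_convex[where i = j] mean_dist_mono[OF assms(1)]) auto
  also have "\<dots> = (1 - c ^ length (j # w) / 2) * \<epsilon>"
    by (simp add: u_def algebra_simps)
  finally show ?case by (simp add: m mean_dist_Suc)
qed (use assms in auto)

definition synchronizing :: bool where
  "synchronizing \<longleftrightarrow> (\<forall>\<epsilon>>0. \<exists>N. \<forall>n\<ge>N. \<forall>x y. mean_dist n x y \<le> \<epsilon>)"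

text \<open>Let \<open>r\<close> be the infimum of the uniform bounds attained at some time. If it
  were positive, sufficiently close pairs would stay within \<open>r / 2\<close> in mean at all
  times, and every pair becomes that close along a word of bounded length; a bound slightly above
  \<open>r\<close> could then be improved to one below \<open>r\<close>.\<close>

theorem synchronizingI:
  assumes reach: "\<And>x. \<exists>w\<in>lists {1..k}. fold g w x \<in> interior equi_set"
    and contract: "\<And>x y \<epsilon>. \<epsilon> > 0 \<Longrightarrow> \<exists>w\<in>lists {1..k}. dist (fold g w x) (fold g w y) < \<epsilon>"
  shows synchronizing
proof -
  obtain c where c: "0 < c" "c \<le> 1" "\<And>j. j \<in> {1..k} \<Longrightarrow> c \<le> b j"
    using bounded_below_weights by blast
  obtain K where K: "\<And>x y::'a. dist x y \<le> K"
    using compact_imp_bounded[OF compact_space] unfolding bounded_two_points by blast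
  have "0 \<le> K" using K[of undefined undefined] by simp
  define E where "E = {\<epsilon>. \<exists>n. \<forall>x y. mean_dist n x y \<le> \<epsilon>}"
  have "K \<in> E" using K by (auto simp: E_def intro: exI[of _ 0])
  have lb: "0 \<le> \<epsilon>" if "\<epsilon> \<in> E" for \<epsilon>
    using that mean_dist_nonneg order_trans unfolding E_def by blast
  have bdd: "bdd_below E" using lb by (auto simp: bdd_below_def)
  define r where "r = Inf E"
  have "r \<ge> 0" unfolding r_def using \<open>K \<in> E\<close> lb by (intro cInf_greatest) auto
  have "r = 0"
  proof (rule ccontr)
    assume "r \<noteq> 0"
    then have "r > 0" using \<open>r \<ge> 0\<close> by simp
    obtain \<delta> where \<delta>: "\<delta> > 0" "\<And>m x y. dist x y < \<delta> \<Longrightarrow> mean_dist m x y \<le> r / 2"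
      using mean_dist_equicontinuous[OF reach, of "r / 2"] \<open>r > 0\<close> by auto
    let ?V = "\<lambda>w. {p. dist (fold g w (fst p)) (fold g w (snd p)) < \<delta>}"
    have op: "open (?V w)" if "w \<in> lists {1..k}" for w
    proof -
      have "continuous_on UNIV (\<lambda>p::'a\<times>'a. fold g w (fst p))" "continuous_on UNIV (\<lambda>p::'a\<times>'a. fold g w (snd p))"
        using continuous_fold[OF that]
        by (auto intro!: continuous_on_compose2[of UNIV "fold g w"] continuous_intros)
      then show ?thesis by (intro open_Collect_less continuous_intros)
    qed
    have "compact (UNIV :: ('a \<times> 'a) set)"
      using compact_Times[OF compact_space compact_space] by simp
    then obtain N where N: "\<And>p. \<exists>w\<in>lists {1..k}. length w \<le> N \<and> p \<in> ?V w"
      using finite_reach[of ?V] contract[OF \<delta>(1)] op by (metis (mono_tags, lifting) mem_Collect_eq)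
    define q where "q = 1 - c ^ N / 2"
    have cN: "0 < c ^ N" "c ^ N \<le> 1" using c by (auto intro: power_le_one)
    then have q: "0 < q" "q < 1" by (auto simp: q_def)
    \<comment> \<open>A bound below \<open>r / q\<close> falls below \<open>r\<close> once it is
      multiplied by \<open>q\<close>.\<close>
    have "r < r / q" using q \<open>r > 0\<close> by (simp add: field_simps)
    then obtain \<epsilon> where \<epsilon>: "\<epsilon> \<in> E" "\<epsilon> < r / q"
      using cInf_lessD[of E "r / q"] \<open>K \<in> E\<close> unfolding r_def by blast
    have "r \<le> \<epsilon>" unfolding r_def using \<epsilon> bdd by (intro cInf_lower)
    obtain n where n: "\<And>x y. mean_dist n x y \<le> \<epsilon>" using \<epsilon> by (auto simp: E_def)
    have "mean_dist (n + N) x y \<le> q * \<epsilon>" for x y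
    proof -
      obtain w where w: "w \<in> lists {1..k}" "length w \<le> N" "dist (fold g w x) (fold g w y) < \<delta>"
        using N[of "(x, y)"] by auto
      have "mean_dist m (fold g w x) (fold g w y) \<le> \<epsilon> / 2" for m
        using \<delta>(2)[OF w(3), of m] \<open>r \<le> \<epsilon>\<close> by linarith
      then have "mean_dist (n + N) x y \<le> (1 - c ^ length w / 2) * \<epsilon>"
        using n c w \<open>r \<le> \<epsilon>\<close> \<open>r > 0\<close> by (intro mean_dist_word) auto
      also have "\<dots> \<le> q * \<epsilon>"
        using c w \<open>r \<le> \<epsilon>\<close> \<open>r > 0\<close> by (intro mult_right_mono) (auto simp: q_def power_decreasing)
      finally show ?thesis .
    qed
    then have "q * \<epsilon> \<in> E" by (auto simp: E_def)
    then have "r \<le> q * \<epsilon>" unfolding r_def using bdd by (intro cInf_lower)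
    with \<epsilon> q show False by (simp add: field_simps)
  qed
  show ?thesis unfolding synchronizing_def
  proof (intro allI impI)
    fix \<epsilon> :: real assume "\<epsilon> > 0"
    then obtain e where e: "e \<in> E" "e < \<epsilon>"
      using cInf_lessD[of E \<epsilon>] \<open>K \<in> E\<close> \<open>r = 0\<close> unfolding r_def by auto
    then obtain N where N: "\<And>x y. mean_dist N x y \<le> e" by (auto simp: E_def)
    show "\<exists>N. \<forall>n\<ge>N. \<forall>x y. mean_dist n x y \<le> \<epsilon>"
      using mean_dist_mono[OF N] e(2) by (meson less_imp_le order_trans)
  qed
qed

section \<open>Bernoulli sequences and the two orders of composition\<close>

abbreviation "symbol_measure \<equiv> point_measure {1..k} (\<lambda>j. ennreal (b j))"
abbreviation "P \<equiv> bernoulli k b"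

lemma sequence_space: "sequence_space symbol_measure"
  unfolding sequence_space_def
  by (intro product_prob_spaceI prob_space_point_measure_prob_vector prob_vector)

lemma prob_space_P: "prob_space P"
proof -
  interpret sequence_space symbol_measure by (rule sequence_space)
  show ?thesis unfolding bernoulli_def by (rule prob_space_axioms)
qed

lemma measurable_shift [measurable]: "(\<lambda>\<omega> i. \<omega> (Suc i)) \<in> P \<rightarrow>\<^sub>M P"
  unfolding bernoulli_def
  by (intro measurable_PiM_single' measurable_component_singleton) (auto simp: space_PiM space_point_measure)

lemma measurable_symbol: "(\<lambda>\<omega>. \<omega> n) \<in> P \<rightarrow>\<^sub>M count_space {1..k}"
proof -
  have "(\<lambda>\<omega>. \<omega> n) \<in> P \<rightarrow>\<^sub>M symbol_measure"
    unfolding bernoulli_def by measurable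
  then show ?thesis using measurable_cong_sets[OF refl sets_point_measure_count_space] by blast
qed

text \<open>Fubini for the splitting of a sequence into its first symbol and the rest, which are
  independent and the rest again Bernoulli. The expectations below are computed by induction with
  this identity, in place of conditional expectations.\<close>

lemma integral_peel:
  fixes F :: "(nat \<Rightarrow> nat) \<Rightarrow> 'v::{banach, second_countable_topology}"
  assumes F: "integrable P F"
  shows "(\<integral>\<omega>. F \<omega> \<partial>P) = avg (\<lambda>j. \<integral>\<omega>. F (case_nat j \<omega>) \<partial>P)"
proof -
  interpret sequence_space symbol_measure by (rule sequence_space)
  interpret pair_sigma_finite symbol_measure S ..
  have PS: "P = S" by (simp add: bernoulli_def)
  have meas: "(\<lambda>(s, \<omega>). case_nat s \<omega>) \<in> symbol_measure \<Otimes>\<^sub>M S \<rightarrow>\<^sub>M S" by measurable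
  have int: "integrable (symbol_measure \<Otimes>\<^sub>M S) (\<lambda>p. F (case p of (s, \<omega>) \<Rightarrow> case_nat s \<omega>))"
  proof -
    have "integrable (distr (symbol_measure \<Otimes>\<^sub>M S) S (\<lambda>(s, \<omega>). case_nat s \<omega>)) F"
      using F by (simp only: PiM_iter PS)
    then show ?thesis using F by (subst (asm) integrable_distr_eq[OF meas]) (auto simp: PS)
  qed
  have "(\<integral>\<omega>. F \<omega> \<partial>P) = (\<integral>\<omega>. F \<omega> \<partial>distr (symbol_measure \<Otimes>\<^sub>M S) S (\<lambda>(s, \<omega>). case_nat s \<omega>))"
    by (simp only: PiM_iter PS)
  also have "\<dots> = (\<integral>p. F (case p of (s, \<omega>) \<Rightarrow> case_nat s \<omega>) \<partial>(symbol_measure \<Otimes>\<^sub>M S))"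
    using F meas by (intro integral_distr) (auto simp: PS)
  also have "\<dots> = (\<integral>s. \<integral>\<omega>. F (case_nat s \<omega>) \<partial>S \<partial>symbol_measure)"
    using integral_fst'[OF int] by simp
  also have "\<dots> = avg (\<lambda>j. \<integral>\<omega>. F (case_nat j \<omega>) \<partial>P)"
    unfolding avg_def PS using b_nonneg by (intro lebesgue_integral_point_measure_finite) auto
  finally show ?thesis .
qed

primrec orbit :: "'a \<Rightarrow> (nat \<Rightarrow> nat) \<Rightarrow> nat \<Rightarrow> 'a" where
  "orbit x \<omega> 0 = x"
| "orbit x \<omega> (Suc n) = g (\<omega> n) (orbit x \<omega> n)"

text \<open>The symbol \<open>\<omega> 0\<close> acts last, so passing from \<open>n\<close> to
  \<open>Suc n\<close> only changes the innermost argument; this is what can converge for a fixed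
  sequence.\<close>

primrec rev_orbit :: "nat \<Rightarrow> 'a \<Rightarrow> (nat \<Rightarrow> nat) \<Rightarrow> 'a" where
  "rev_orbit 0 x \<omega> = x"
| "rev_orbit (Suc n) x \<omega> = g (\<omega> 0) (rev_orbit n x (\<lambda>i. \<omega> (Suc i)))"

lemma measurable_g_compose:
  assumes Y: "Y \<in> P \<rightarrow>\<^sub>M borel"
  shows "(\<lambda>\<omega>. g (\<omega> n) (Y \<omega>)) \<in> P \<rightarrow>\<^sub>M borel"
proof (rule measurable_compose_countable'[where f="\<lambda>j \<omega>. g j (Y \<omega>)" and g="\<lambda>\<omega>. \<omega> n" and I="{1..k}"])
  show "(\<lambda>\<omega>. g j (Y \<omega>)) \<in> P \<rightarrow>\<^sub>M borel" if "j \<in> {1..k}" for j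
    by (rule measurable_compose[OF Y borel_measurable_continuous_onI[OF continuous_g[OF that]]])
qed (use measurable_symbol in auto)

lemma measurable_orbit: "(\<lambda>\<omega>. orbit x \<omega> n) \<in> P \<rightarrow>\<^sub>M borel"
  by (induction n) (auto intro: measurable_g_compose)

lemma measurable_rev_orbit: "rev_orbit n x \<in> P \<rightarrow>\<^sub>M borel"
proof (induction n)
  case (Suc n)
  then have "(\<lambda>\<omega>. rev_orbit n x (\<lambda>i. \<omega> (Suc i))) \<in> P \<rightarrow>\<^sub>M borel"
    by (rule measurable_compose[OF measurable_shift])
  from measurable_g_compose[OF this, of 0] show ?case by simp
qed simp

text \<open>The first symbol moves the starting point of an orbit but is the outermost map of a
  reversed orbit. Inductions on orbits therefore generalise the point, those on reversed orbits the
  test function.\<close>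

lemma orbit_case_nat: "orbit x (case_nat j \<omega>) (Suc n) = orbit (g j x) \<omega> n"
  by (induction n) auto

lemma rev_orbit_case_nat: "rev_orbit (Suc n) x (case_nat j \<omega>) = g j (rev_orbit n x \<omega>)"
  by simp

section \<open>The transfer operator on continuous functions\<close>

lemma continuous_comp_g: "continuous_on UNIV \<phi> \<Longrightarrow> j \<in> {1..k} \<Longrightarrow> continuous_on UNIV (\<lambda>x. \<phi> (g j x))"
  using continuous_on_compose2[of UNIV \<phi> UNIV "g j"] continuous_g by auto

lemma transfer_continuous:
  "continuous_on UNIV \<phi> \<Longrightarrow> continuous_on UNIV (transfer \<phi>)" for \<phi> :: "'a \<Rightarrow> 'v::real_normed_vector"
  unfolding transfer_def avg_def
  by (intro continuous_on_sum continuous_on_scaleR continuous_on_const continuous_comp_g[of \<phi>])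

lemma transfer_power_continuous:
  "continuous_on UNIV \<phi> \<Longrightarrow> continuous_on UNIV ((transfer ^^ n) \<phi>)" for \<phi> :: "'a \<Rightarrow> 'v::real_normed_vector"
  by (induction n) (auto intro: transfer_continuous)

lemma continuous_bound:
  fixes \<phi> :: "'a \<Rightarrow> 'v::real_normed_vector"
  assumes "continuous_on UNIV \<phi>"
  obtains C where "0 \<le> C" "\<And>x. norm (\<phi> x) \<le> C"
proof -
  have "bounded (range \<phi>)"
    using compact_continuous_image[OF assms compact_space] by (rule compact_imp_bounded)
  then obtain C where C: "\<And>x. norm (\<phi> x) \<le> C" by (auto simp: bounded_iff)
  moreover have "0 \<le> C" using C[of undefined] norm_ge_zero order_trans by blast
  ultimately show ?thesis using that by blast
qed

lemma integrable_continuous: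
  fixes \<phi> :: "'a \<Rightarrow> 'v::{banach, second_countable_topology}"
  assumes \<phi>: "continuous_on UNIV \<phi>" and "finite_measure M" and Y: "Y \<in> M \<rightarrow>\<^sub>M borel"
  shows "integrable M (\<lambda>\<omega>. \<phi> (Y \<omega>))"
proof -
  obtain C where C: "\<And>x. norm (\<phi> x) \<le> C" using continuous_bound[OF \<phi>] by blast
  have "(\<lambda>\<omega>. \<phi> (Y \<omega>)) \<in> M \<rightarrow>\<^sub>M borel"
    by (rule measurable_compose[OF Y borel_measurable_continuous_onI[OF \<phi>]])
  then show ?thesis using C by (intro finite_measure.integrable_const_bound[OF assms(2), of _ C]) auto
qed

lemma avg_integral:
  fixes F :: "nat \<Rightarrow> 'w \<Rightarrow> 'v::{banach, second_countable_topology}"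
  assumes "\<And>j. j \<in> {1..k} \<Longrightarrow> integrable M (F j)"
  shows "avg (\<lambda>j. \<integral>\<omega>. F j \<omega> \<partial>M) = (\<integral>\<omega>. avg (\<lambda>j. F j \<omega>) \<partial>M)"
  unfolding avg_def using assms by (subst Bochner_Integration.integral_sum) auto

lemma expectation_rev_orbit:
  fixes \<phi> :: "'a \<Rightarrow> 'v::{banach, second_countable_topology}"
  assumes "continuous_on UNIV \<phi>"
  shows "(\<integral>\<omega>. \<phi> (rev_orbit n x \<omega>) \<partial>P) = (transfer ^^ n) \<phi> x"
  using assms
proof (induction n arbitrary: \<phi>)
  case 0
  interpret prob_space P by (rule prob_space_P)
  show ?case by (simp add: prob_space)
next
  case (Suc n)
  have fin: "finite_measure P" using prob_space_P by (simp add: prob_space_def)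
  have "(\<integral>\<omega>. \<phi> (rev_orbit (Suc n) x \<omega>) \<partial>P) = avg (\<lambda>j. \<integral>\<omega>. \<phi> (rev_orbit (Suc n) x (case_nat j \<omega>)) \<partial>P)"
    by (intro integral_peel integrable_continuous[where \<phi>=\<phi> and Y="rev_orbit (Suc n) x"] Suc.prems fin measurable_rev_orbit)
  also have "\<dots> = avg (\<lambda>j. \<integral>\<omega>. \<phi> (g j (rev_orbit n x \<omega>)) \<partial>P)"
    by (simp only: rev_orbit_case_nat)
  also have "\<dots> = (\<integral>\<omega>. transfer \<phi> (rev_orbit n x \<omega>) \<partial>P)"
    unfolding transfer_def
  proof (rule avg_integral)
    fix j assume "j \<in> {1..k}"
    then show "integrable P (\<lambda>\<omega>. \<phi> (g j (rev_orbit n x \<omega>)))"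
      by (intro integrable_continuous[where \<phi>="\<lambda>x. \<phi> (g j x)" and Y="rev_orbit n x"]
          continuous_comp_g Suc.prems fin measurable_rev_orbit)
  qed
  also have "\<dots> = (transfer ^^ n) (transfer \<phi>) x"
    by (intro Suc.IH transfer_continuous Suc.prems)
  finally show ?case by (simp add: funpow_swap1)
qed

text \<open>Both reversed orbits begin with the same \<open>n\<close> outer maps, applied to
  \<open>x\<close> and to a point determined by the later symbols. With that point frozen, the
  expectation is a \<open>mean_dist n\<close>, for which the hypothesis is uniform in the second
  argument.\<close>

lemma expectation_dist_rev_orbit:
  assumes "\<And>y. mean_dist n x y \<le> \<epsilon>"
  shows "(\<integral>\<omega>. dist (rev_orbit n x \<omega>) (rev_orbit (n + m) x \<omega>) \<partial>P) \<le> \<epsilon>"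
proof -
  interpret prob_space P by (rule prob_space_P)
  have fin: "finite_measure P" by (rule finite_measure_axioms)
  have int: "integrable P (\<lambda>\<omega>. \<Phi> (rev_orbit i x \<omega>) (rev_orbit l x \<omega>))"
    if "continuous_on UNIV (\<lambda>p. \<Phi> (fst p) (snd p))" for \<Phi> :: "'a \<Rightarrow> 'a \<Rightarrow> real" and i l
  proof -
    have "compact ((\<lambda>p. \<Phi> (fst p) (snd p)) ` (UNIV \<times> UNIV))"
      using that by (intro compact_continuous_image compact_Times compact_space) simp
    then have "bounded ((\<lambda>p. \<Phi> (fst p) (snd p)) ` (UNIV \<times> UNIV))"
      by (rule compact_imp_bounded)
    then obtain C where "\<And>t. t \<in> (\<lambda>p. \<Phi> (fst p) (snd p)) ` (UNIV \<times> UNIV) \<Longrightarrow> norm t \<le> C"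
      unfolding bounded_iff by blast
    then have C: "norm (\<Phi> u v) \<le> C" for u v
      using image_eqI[of "\<Phi> u v" "\<lambda>p. \<Phi> (fst p) (snd p)" "(u, v)" "UNIV \<times> UNIV"] by simp
    have "(\<lambda>\<omega>. (rev_orbit i x \<omega>, rev_orbit l x \<omega>)) \<in> P \<rightarrow>\<^sub>M borel \<Otimes>\<^sub>M borel"
      by (intro measurable_Pair measurable_rev_orbit)
    then have "(\<lambda>\<omega>. (rev_orbit i x \<omega>, rev_orbit l x \<omega>)) \<in> P \<rightarrow>\<^sub>M borel"
      by (simp add: borel_prod)
    from measurable_compose[OF this borel_measurable_continuous_onI[OF that]]
    show ?thesis using C by (intro integrable_const_bound[of _ C]) auto
  qed
  have cont_step: "continuous_on UNIV (\<lambda>p. \<Phi> (g j (fst p)) (g j (snd p)))"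
    if "continuous_on UNIV (\<lambda>p. \<Phi> (fst p) (snd p))" "j \<in> {1..k}" for \<Phi> :: "'a \<Rightarrow> 'a \<Rightarrow> real" and j
  proof -
    have "continuous_on UNIV (\<lambda>p::'a \<times> 'a. (g j (fst p), g j (snd p)))"
      by (intro continuous_on_Pair continuous_on_compose2[OF continuous_g[OF that(2)]] continuous_intros) auto
    from continuous_on_compose2[OF that(1) this] show ?thesis by simp
  qed
  have cont: "continuous_on UNIV (\<lambda>p. pair_op \<Phi> (fst p) (snd p))"
    if "continuous_on UNIV (\<lambda>p. \<Phi> (fst p) (snd p))" for \<Phi> :: "'a \<Rightarrow> 'a \<Rightarrow> real"
    unfolding pair_op_def avg_def using that
    by (intro continuous_on_sum continuous_on_scaleR continuous_on_const cont_step[of \<Phi>])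
  \<comment> \<open>Stated for every jointly continuous kernel, because each peeled symbol replaces
    the kernel by its \<open>pair_op\<close>.\<close>
  have main: "(\<integral>\<omega>. \<Phi> (rev_orbit n x \<omega>) (rev_orbit (n + m) x \<omega>) \<partial>P) = (\<integral>\<omega>. (pair_op ^^ n) \<Phi> x (rev_orbit m x \<omega>) \<partial>P)"
    if "continuous_on UNIV (\<lambda>p. \<Phi> (fst p) (snd p))" for \<Phi> n
    using that
  proof (induction n arbitrary: \<Phi>)
    case (Suc n)
    have "(\<integral>\<omega>. \<Phi> (rev_orbit (Suc n) x \<omega>) (rev_orbit (Suc (n + m)) x \<omega>) \<partial>P)
      = avg (\<lambda>j. \<integral>\<omega>. \<Phi> (rev_orbit (Suc n) x (case_nat j \<omega>)) (rev_orbit (Suc (n + m)) x (case_nat j \<omega>)) \<partial>P)"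
      by (rule integral_peel[OF int[of \<Phi> "Suc n" "Suc (n + m)", OF Suc.prems]])
    also have "\<dots> = avg (\<lambda>j. \<integral>\<omega>. \<Phi> (g j (rev_orbit n x \<omega>)) (g j (rev_orbit (n + m) x \<omega>)) \<partial>P)"
      by (simp only: rev_orbit_case_nat)
    also have "\<dots> = (\<integral>\<omega>. pair_op \<Phi> (rev_orbit n x \<omega>) (rev_orbit (n + m) x \<omega>) \<partial>P)"
      unfolding pair_op_def
    proof (rule avg_integral)
      fix j assume "j \<in> {1..k}"
      then show "integrable P (\<lambda>\<omega>. \<Phi> (g j (rev_orbit n x \<omega>)) (g j (rev_orbit (n + m) x \<omega>)))"
        by (intro int[of "\<lambda>u v. \<Phi> (g j u) (g j v)" n "n + m"] cont_step[of \<Phi> j] Suc.prems)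
    qed
    also have "\<dots> = (\<integral>\<omega>. (pair_op ^^ n) (pair_op \<Phi>) x (rev_orbit m x \<omega>) \<partial>P)"
      by (intro Suc.IH cont Suc.prems)
    finally show ?case by (simp add: funpow_swap1)
  qed simp
  have c: "continuous_on UNIV (\<lambda>p::'a \<times> 'a. dist (fst p) (snd p))" by (intro continuous_intros)
  have ci: "continuous_on UNIV (\<lambda>p::'a \<times> 'a. (pair_op ^^ n) dist (fst p) (snd p))" for n
  proof (induction n)
    case (Suc n)
    then show ?case using cont[of "(pair_op ^^ n) dist"] by simp
  qed (simp add: c)
  have "(\<integral>\<omega>. dist (rev_orbit n x \<omega>) (rev_orbit (n + m) x \<omega>) \<partial>P) = (\<integral>\<omega>. mean_dist n x (rev_orbit m x \<omega>) \<partial>P)"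
    unfolding mean_dist_def by (rule main[of dist n, OF c])
  also have "\<dots> \<le> (\<integral>\<omega>. \<epsilon> \<partial>P)"
  proof (intro integral_mono)
    have "integrable P (\<lambda>\<omega>. (pair_op ^^ n) dist (rev_orbit 0 x \<omega>) (rev_orbit m x \<omega>))"
      by (rule int[of "(pair_op ^^ n) dist" 0 m, OF ci])
    then show "integrable P (\<lambda>\<omega>. mean_dist n x (rev_orbit m x \<omega>))" by (simp add: mean_dist_def)
  qed (use assms in auto)
  finally show ?thesis by (simp add: prob_space)
qed

text \<open>Uniform continuity in a form linear in the distance, which survives averaging where a
  threshold would not. Beyond the threshold \<open>\<delta>\<close> the trivial bound
  \<open>2 * C\<close> is at most \<open>2 * C / \<delta>\<close> times the distance.\<close>

lemma continuous_modulus: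
  fixes \<phi> :: "'a \<Rightarrow> 'v::real_normed_vector"
  assumes \<phi>: "continuous_on UNIV \<phi>" and "\<epsilon> > 0"
  obtains K where "0 \<le> K" "\<And>x y. norm (\<phi> x - \<phi> y) \<le> \<epsilon> + K * dist x y"
proof -
  obtain C where C: "0 \<le> C" "\<And>x. norm (\<phi> x) \<le> C" using continuous_bound[OF \<phi>] by blast
  obtain \<delta> where \<delta>: "\<delta> > 0" "\<And>x y. dist y x < \<delta> \<Longrightarrow> dist (\<phi> y) (\<phi> x) < \<epsilon>"
    using compact_uniformly_continuous[OF \<phi> compact_space] \<open>\<epsilon> > 0\<close>
    unfolding uniformly_continuous_on_def by (metis UNIV_I)
  show ?thesis
  proof
    show "0 \<le> 2 * C / \<delta>" using C \<delta> by simp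
    fix x y
    show "norm (\<phi> x - \<phi> y) \<le> \<epsilon> + 2 * C / \<delta> * dist x y"
    proof (cases "dist x y < \<delta>")
      case True
      then have "norm (\<phi> x - \<phi> y) \<le> \<epsilon>" using \<delta>(2)[of x y] by (simp add: dist_norm)
      also have "\<dots> \<le> \<epsilon> + 2 * C / \<delta> * dist x y" using C \<delta> by simp
      finally show ?thesis .
    next
      case False
      have "norm (\<phi> x - \<phi> y) \<le> C + C" using norm_triangle_le_diff[of "\<phi> x" "\<phi> y" "C + C"] C(2)[of x] C(2)[of y] by simp
      also have "\<dots> = 2 * C / \<delta> * \<delta>" using \<delta> by simp
      also have "\<dots> \<le> 2 * C / \<delta> * dist x y" using False C \<delta> by (intro mult_left_mono) auto
      also have "\<dots> \<le> \<epsilon> + 2 * C / \<delta> * dist x y" using \<open>\<epsilon> > 0\<close> by simp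
      finally show ?thesis .
    qed
  qed
qed

lemma transfer_osc:
  fixes \<phi> :: "'a \<Rightarrow> 'v::real_normed_vector"
  assumes "\<And>x y. norm (\<phi> x - \<phi> y) \<le> \<epsilon> + K * dist x y"
  shows "norm ((transfer ^^ n) \<phi> x - (transfer ^^ n) \<phi> y) \<le> \<epsilon> + K * mean_dist n x y"
proof (induction n arbitrary: x y)
  case (Suc n)
  have "norm ((transfer ^^ Suc n) \<phi> x - (transfer ^^ Suc n) \<phi> y)
    = norm (avg (\<lambda>j. (transfer ^^ n) \<phi> (g j x) - (transfer ^^ n) \<phi> (g j y)))"
    by (simp add: transfer_def avg_diff)
  also have "\<dots> \<le> avg (\<lambda>j. \<epsilon> + K * mean_dist n (g j x) (g j y))"
    by (intro order_trans[OF norm_avg_le] avg_mono Suc.IH)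
  also have "\<dots> = \<epsilon> + K * mean_dist (Suc n) x y"
    by (simp add: avg_add avg_cmult mean_dist_Suc)
  finally show ?case .
qed (use assms in simp)

text \<open>The operator fixes constants and does not increase the supremum norm.\<close>

lemma transfer_near_const:
  fixes \<phi> :: "'a \<Rightarrow> 'v::real_normed_vector"
  assumes "\<And>x. norm (\<phi> x - c) \<le> \<epsilon>"
  shows "norm ((transfer ^^ n) \<phi> x - c) \<le> \<epsilon>"
proof (induction n arbitrary: x)
  case (Suc n)
  have "norm ((transfer ^^ Suc n) \<phi> x - c) = norm (avg (\<lambda>j. (transfer ^^ n) \<phi> (g j x) - c))"
    by (simp add: transfer_def avg_diff)
  also have "\<dots> \<le> \<epsilon>"
    by (intro order_trans[OF norm_avg_le] avg_le Suc.IH)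
  finally show ?case .
qed (use assms in simp)

text \<open>Synchronization makes the oscillation of the iterates tend to 0. Once an iterate is
  within \<open>\<epsilon>\<close> of one of its values, all later ones are too, so the iterates are
  uniformly Cauchy and their limit is constant.\<close>

lemma transfer_limit:
  fixes \<phi> :: "'a \<Rightarrow> 'v::banach"
  assumes synchronizing and \<phi>: "continuous_on UNIV \<phi>"
  obtains L where "\<And>\<epsilon>. \<epsilon> > 0 \<Longrightarrow> \<exists>N. \<forall>n\<ge>N. \<forall>x. norm ((transfer ^^ n) \<phi> x - L) \<le> \<epsilon>"
proof -
  have osc: "\<exists>N. \<forall>x y. norm ((transfer ^^ N) \<phi> x - (transfer ^^ N) \<phi> y) \<le> \<epsilon>" if pos: "\<epsilon> > 0" for \<epsilon> :: real
  proof -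
    obtain K where K: "0 \<le> K" "\<And>x y. norm (\<phi> x - \<phi> y) \<le> \<epsilon> / 2 + K * dist x y"
      using continuous_modulus[OF \<phi>, of "\<epsilon> / 2"] pos by auto
    \<comment> \<open>\<open>K\<close> may be 0, hence \<open>K + 1\<close> in the
      denominator.\<close>
    have "\<epsilon> / 2 / (K + 1) > 0" using pos K by simp
    then obtain N where N: "\<And>x y. mean_dist N x y \<le> \<epsilon> / 2 / (K + 1)"
      using assms(1) unfolding synchronizing_def by blast
    have "norm ((transfer ^^ N) \<phi> x - (transfer ^^ N) \<phi> y) \<le> \<epsilon>" for x y
    proof -
      have "K * mean_dist N x y \<le> (K + 1) * (\<epsilon> / 2 / (K + 1))"
        using K(1) N mean_dist_nonneg by (intro mult_mono) auto
      also have "\<dots> = \<epsilon> / 2"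
      proof -
        have "K + 1 \<noteq> 0" using K(1) by linarith
        then show ?thesis by (rule nonzero_mult_div_cancel_left[THEN trans[OF times_divide_eq_right]])
      qed
      finally show ?thesis using transfer_osc[where \<phi>=\<phi> and K=K and n=N and x=x and y=y, OF K(2)] by linarith
    qed
    then show ?thesis by blast
  qed
  have cau: "\<exists>N. \<forall>n\<ge>N. \<forall>x y. norm ((transfer ^^ n) \<phi> x - (transfer ^^ N) \<phi> y) \<le> \<epsilon>" if pos: "\<epsilon> > 0" for \<epsilon> :: real
  proof -
    obtain N where N: "\<And>x y. norm ((transfer ^^ N) \<phi> x - (transfer ^^ N) \<phi> y) \<le> \<epsilon>"
      using osc[OF pos] by blast
    have "norm ((transfer ^^ n) \<phi> x - (transfer ^^ N) \<phi> y) \<le> \<epsilon>" if "n \<ge> N" for n x y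
    proof -
      have "(transfer ^^ n) \<phi> = (transfer ^^ (n - N)) ((transfer ^^ N) \<phi>)"
        using that by (metis comp_apply funpow_add le_add_diff_inverse2)
      then show ?thesis using transfer_near_const[of "(transfer ^^ N) \<phi>" "(transfer ^^ N) \<phi> y" \<epsilon>, OF N] by simp
    qed
    then show ?thesis by blast
  qed
  have "Cauchy (\<lambda>n. (transfer ^^ n) \<phi> undefined)"
  proof (rule metric_CauchyI)
    fix e :: real assume "e > 0"
    obtain N where N: "\<And>n x y. n \<ge> N \<Longrightarrow> norm ((transfer ^^ n) \<phi> x - (transfer ^^ N) \<phi> y) \<le> e / 3"
      using cau[of "e / 3"] \<open>e > 0\<close> by auto
    have "dist ((transfer ^^ m) \<phi> undefined) ((transfer ^^ n) \<phi> undefined) < e" if "m \<ge> N" "n \<ge> N" for m n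
      using N[OF that(1), of undefined undefined] N[OF that(2), of undefined undefined] \<open>e > 0\<close>
        dist_triangle2[of "(transfer ^^ m) \<phi> undefined" "(transfer ^^ n) \<phi> undefined" "(transfer ^^ N) \<phi> undefined"]
      by (simp add: dist_norm)
    then show "\<exists>M. \<forall>m\<ge>M. \<forall>n\<ge>M. dist ((transfer ^^ m) \<phi> undefined) ((transfer ^^ n) \<phi> undefined) < e" by blast
  qed
  then obtain L where L: "(\<lambda>n. (transfer ^^ n) \<phi> undefined) \<longlonglongrightarrow> L"
    using Cauchy_convergent convergent_def by blast
  show ?thesis
  proof
    fix \<epsilon> :: real assume "\<epsilon> > 0"
    obtain N where N: "\<And>n x y. n \<ge> N \<Longrightarrow> norm ((transfer ^^ n) \<phi> x - (transfer ^^ N) \<phi> y) \<le> \<epsilon> / 2"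
      using cau[of "\<epsilon> / 2"] \<open>\<epsilon> > 0\<close> by auto
    have lim: "norm (L - (transfer ^^ N) \<phi> y) \<le> \<epsilon> / 2" for y
      by (rule LIMSEQ_le_const2[OF tendsto_norm[OF tendsto_diff[OF L tendsto_const]]]) (use N in blast)
    have "norm ((transfer ^^ n) \<phi> x - L) \<le> \<epsilon>" if "n \<ge> N" for n x
      using N[OF that, of x x] lim[of x]
        dist_triangle2[of "(transfer ^^ n) \<phi> x" L "(transfer ^^ N) \<phi> x"] by (simp add: dist_norm)
    then show "\<exists>N. \<forall>n\<ge>N. \<forall>x. norm ((transfer ^^ n) \<phi> x - L) \<le> \<epsilon>" by blast
  qed
qed

section \<open>Existence and uniqueness of the invariant measure\<close>

definition invariant_prob :: "'a measure \<Rightarrow> bool" where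
  "invariant_prob \<mu> \<longleftrightarrow> prob_space \<mu> \<and> sets \<mu> = sets borel \<and>
     (\<forall>\<phi>::'a \<Rightarrow> complex. continuous_on UNIV \<phi> \<longrightarrow> (\<integral>z. transfer \<phi> z \<partial>\<mu>) = (\<integral>z. \<phi> z \<partial>\<mu>))"

lemma transfer_of_real: "transfer (\<lambda>x. complex_of_real (\<phi> x)) = (\<lambda>x. complex_of_real (transfer \<phi> x))"
  by (simp add: fun_eq_iff transfer_def avg_def scaleR_conv_of_real)

text \<open>Invariance is phrased with complex test functions to agree with
  \<open>stationary\<close>; weak convergence and the law of large numbers use real ones.\<close>

lemma invariant_prob_real:
  fixes \<phi> :: "'a \<Rightarrow> real"
  assumes "invariant_prob \<mu>" "continuous_on UNIV \<phi>"
  shows "(\<integral>z. transfer \<phi> z \<partial>\<mu>) = (\<integral>z. \<phi> z \<partial>\<mu>)"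
proof -
  have "(\<integral>z. transfer (\<lambda>x. complex_of_real (\<phi> x)) z \<partial>\<mu>) = (\<integral>z. complex_of_real (\<phi> z) \<partial>\<mu>)"
    using assms by (auto simp: invariant_prob_def intro!: continuous_on_of_real)
  then show ?thesis unfolding transfer_of_real by simp
qed

text \<open>Invariance lets \<open>\<phi>\<close> be replaced by any iterate under the integral, and
  the iterates approach the constant \<open>L\<close> uniformly. The value is thus forced, which
  yields uniqueness.\<close>

lemma invariant_prob_integral:
  fixes \<phi> :: "'a \<Rightarrow> real"
  assumes \<mu>: "invariant_prob \<mu>" and \<phi>: "continuous_on UNIV \<phi>"
    and L: "\<And>\<epsilon>. \<epsilon> > 0 \<Longrightarrow> \<exists>N. \<forall>n\<ge>N. \<forall>x. norm ((transfer ^^ n) \<phi> x - L) \<le> \<epsilon>"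
  shows "(\<integral>z. \<phi> z \<partial>\<mu>) = L"
proof -
  interpret prob_space \<mu> using \<mu> by (simp add: invariant_prob_def)
  have [measurable_cong]: "sets \<mu> = sets borel" using \<mu> by (simp add: invariant_prob_def)
  have id: "(\<lambda>x. x) \<in> \<mu> \<rightarrow>\<^sub>M borel" by measurable
  have int: "integrable \<mu> ((transfer ^^ n) \<phi>)" for n
    by (rule integrable_continuous[where Y="\<lambda>x. x", OF transfer_power_continuous[OF \<phi>] finite_measure_axioms id])
  have eq: "(\<integral>z. (transfer ^^ n) \<phi> z \<partial>\<mu>) = (\<integral>z. \<phi> z \<partial>\<mu>)" for n
    by (induction n) (simp_all add: invariant_prob_real[OF \<mu> transfer_power_continuous[OF \<phi>]])
  have "\<bar>(\<integral>z. \<phi> z \<partial>\<mu>) - L\<bar> \<le> \<epsilon>" if "\<epsilon> > 0" for \<epsilon>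
  proof -
    obtain n where n: "\<And>x. norm ((transfer ^^ n) \<phi> x - L) \<le> \<epsilon>" using L[OF \<open>\<epsilon> > 0\<close>] by blast
    have "(\<integral>z. \<phi> z \<partial>\<mu>) - L = (\<integral>z. (transfer ^^ n) \<phi> z - L \<partial>\<mu>)"
      using int[of n] eq[of n] by (simp add: Bochner_Integration.integral_diff prob_space)
    also have "norm \<dots> \<le> (\<integral>z. norm ((transfer ^^ n) \<phi> z - L) \<partial>\<mu>)"
      by (rule integral_norm_bound)
    also have "\<dots> \<le> (\<integral>z. \<epsilon> \<partial>\<mu>)"
      using n int[of n] by (intro integral_mono) auto
    finally show ?thesis by (simp add: prob_space)
  qed
  then show ?thesis using field_le_epsilon[of "\<bar>(\<integral>z. \<phi> z \<partial>\<mu>) - L\<bar>" 0] by simp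
qed

lemma invariant_prob_unique:
  assumes synchronizing "invariant_prob \<mu>" "invariant_prob \<nu>"
  shows "\<mu> = \<nu>"
proof (rule measure_eqI_continuous)
  fix \<phi> :: "'a \<Rightarrow> real" assume \<phi>: "continuous_on UNIV \<phi>"
  obtain L where L: "\<And>\<epsilon>. \<epsilon> > 0 \<Longrightarrow> \<exists>N. \<forall>n\<ge>N. \<forall>x. norm ((transfer ^^ n) \<phi> x - L) \<le> \<epsilon>"
    using transfer_limit[OF assms(1) \<phi>] by blast
  show "(\<integral>x. \<phi> x \<partial>\<mu>) = (\<integral>x. \<phi> x \<partial>\<nu>)"
    using invariant_prob_integral[OF assms(2) \<phi> L] invariant_prob_integral[OF assms(3) \<phi> L] by simp
qed (use assms in \<open>auto simp: invariant_prob_def prob_space_def\<close>)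

text \<open>The reversed products converge almost surely along a subsequence, and the law of the limit
  is invariant; this replaces the Riesz representation theorem.\<close>

lemma invariant_prob_exists:
  assumes synchronizing
  obtains \<mu> where "invariant_prob \<mu>"
proof -
  interpret prob_space P by (rule prob_space_P)
  define a :: 'a where "a = undefined"
  have "\<exists>N. \<forall>n\<ge>N. \<forall>x y. mean_dist n x y \<le> (1 / 2) ^ i" for i :: nat
    using assms unfolding synchronizing_def by simp
  then obtain N where N: "\<And>i n x y. n \<ge> N i \<Longrightarrow> mean_dist n x y \<le> (1 / 2) ^ i" by metis
  \<comment> \<open>The sum makes \<open>r\<close> strictly increasing while keeping
    \<open>r i\<close> at least \<open>N i\<close>, so that consecutive terms differ by at most
    \<open>(1 / 2) ^ i\<close> in mean.\<close>
  define r where "r i = (\<Sum>j\<le>i. N j + 1)" for i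
  have r_ge: "N i \<le> r i" for i
    using member_le_sum[of i "{..i}" "\<lambda>j. N j + 1"] by (simp add: r_def)
  have r_Suc: "r (Suc i) = r i + (N (Suc i) + 1)" for i by (simp add: r_def)
  have r_filter: "filterlim r sequentially sequentially"
    by (rule filterlim_subseq) (simp add: strict_mono_Suc_iff r_Suc)
  define X where "X i = rev_orbit (r i) a" for i
  have X [measurable]: "X i \<in> P \<rightarrow>\<^sub>M borel" for i unfolding X_def by (rule measurable_rev_orbit)
  have step: "(\<integral>\<^sup>+\<omega>. ennreal (dist (X i \<omega>) (X (Suc i) \<omega>)) \<partial>P) \<le> ennreal ((1 / 2) ^ i)" for i
  proof -
    obtain K where K: "\<And>x y::'a. dist x y \<le> K"
      using compact_imp_bounded[OF compact_space] unfolding bounded_two_points by blast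
    have "integrable P (\<lambda>\<omega>. dist (X i \<omega>) (X (Suc i) \<omega>))"
      using K by (intro integrable_const_bound[of _ K]) auto
    moreover have "(\<integral>\<omega>. dist (X i \<omega>) (X (Suc i) \<omega>) \<partial>P) \<le> (1 / 2) ^ i"
      unfolding X_def r_Suc by (intro expectation_dist_rev_orbit N r_ge)
    ultimately show ?thesis by (subst nn_integral_eq_integral) (auto intro: ennreal_leI)
  qed
  have "(\<integral>\<^sup>+\<omega>. (\<Sum>i. ennreal (dist (X i \<omega>) (X (Suc i) \<omega>))) \<partial>P) = (\<Sum>i. \<integral>\<^sup>+\<omega>. ennreal (dist (X i \<omega>) (X (Suc i) \<omega>)) \<partial>P)"
    by (intro nn_integral_suminf) measurable
  also have "\<dots> \<le> (\<Sum>i. ennreal ((1 / 2) ^ i))"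
    by (intro suminf_le step) auto
  also have "\<dots> < \<infinity>"
    by (subst suminf_ennreal2) (auto simp: less_top[symmetric])
  finally have "AE \<omega> in P. (\<Sum>i. ennreal (dist (X i \<omega>) (X (Suc i) \<omega>))) \<noteq> \<infinity>"
    by (intro nn_integral_PInf_AE) auto
  then have "AE \<omega> in P. convergent (\<lambda>i. X i \<omega>)"
  proof eventually_elim
    case (elim \<omega>)
    then have "summable (\<lambda>i. dist (X i \<omega>) (X (Suc i) \<omega>))"
      by (intro summable_suminf_not_top) auto
    then have "Cauchy (\<lambda>i. X i \<omega>)" by (rule Cauchy_summable_dist)
    then show ?case
      using completeE[OF compact_imp_complete[OF compact_space]] unfolding convergent_def by (metis UNIV_I)
  qed
  then obtain Z where Z: "{\<omega>\<in>space P. \<not> convergent (\<lambda>i. X i \<omega>)} \<subseteq> Z" "emeasure P Z = 0" "Z \<in> sets P"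
    by (rule AE_E)
  \<comment> \<open>Made constant on the exceptional null set, the sequence converges everywhere, so
    its limit is measurable.\<close>
  define Y where "Y i \<omega> = (if \<omega> \<in> Z then a else X i \<omega>)" for i \<omega>
  have Y [measurable]: "Y i \<in> P \<rightarrow>\<^sub>M borel" for i unfolding Y_def using Z(3) by measurable
  define Y' where "Y' \<omega> = lim (\<lambda>i. Y i \<omega>)" for \<omega>
  have lim: "(\<lambda>i. Y i \<omega>) \<longlonglongrightarrow> Y' \<omega>" if "\<omega> \<in> space P" for \<omega>
  proof -
    have "convergent (\<lambda>i. Y i \<omega>)"
      using Z(1) that by (cases "\<omega> \<in> Z") (auto simp: Y_def convergent_const)
    then show ?thesis unfolding Y'_def by (simp add: convergent_LIMSEQ_iff)
  qed
  have Y' [measurable]: "Y' \<in> P \<rightarrow>\<^sub>M borel"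
    by (rule borel_measurable_LIMSEQ_metric[OF Y lim])
  have XY: "AE \<omega> in P. X i \<omega> = Y i \<omega>" for i
    by (rule AE_I'[of Z]) (use Z in \<open>auto simp: Y_def null_sets_def\<close>)
  have main: "(\<integral>z. \<phi> z \<partial>distr P borel Y') = L"
    if \<phi>: "continuous_on UNIV \<phi>" and L: "(\<lambda>n. (transfer ^^ n) \<phi> a) \<longlonglongrightarrow> L" for \<phi> :: "'a \<Rightarrow> complex" and L
  proof -
    obtain C where C: "\<And>x. norm (\<phi> x) \<le> C" using continuous_bound[OF \<phi>] by blast
    have [measurable]: "\<phi> \<in> borel_measurable borel" using \<phi> by (rule borel_measurable_continuous_onI)
    have "(\<lambda>i. \<integral>\<omega>. \<phi> (Y i \<omega>) \<partial>P) \<longlonglongrightarrow> (\<integral>\<omega>. \<phi> (Y' \<omega>) \<partial>P)"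
    proof (rule integral_dominated_convergence[where w="\<lambda>_. C"])
      have "(\<lambda>i. \<phi> (Y i \<omega>)) \<longlonglongrightarrow> \<phi> (Y' \<omega>)" if "\<omega> \<in> space P" for \<omega>
        by (rule continuous_on_tendsto_compose[OF \<phi> lim[OF that]]) auto
      then show "AE \<omega> in P. (\<lambda>i. \<phi> (Y i \<omega>)) \<longlonglongrightarrow> \<phi> (Y' \<omega>)" by simp
    qed (use C in auto)
    moreover have "(\<integral>\<omega>. \<phi> (Y i \<omega>) \<partial>P) = (transfer ^^ r i) \<phi> a" for i
    proof -
      have "(\<integral>\<omega>. \<phi> (Y i \<omega>) \<partial>P) = (\<integral>\<omega>. \<phi> (X i \<omega>) \<partial>P)"
        using XY[of i] by (intro integral_cong_AE) auto
      also have "\<dots> = (transfer ^^ r i) \<phi> a"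
        unfolding X_def by (rule expectation_rev_orbit[OF \<phi>])
      finally show ?thesis .
    qed
    moreover have "(\<lambda>i. (transfer ^^ r i) \<phi> a) \<longlonglongrightarrow> L"
      by (rule filterlim_compose[OF L r_filter])
    ultimately have "(\<integral>\<omega>. \<phi> (Y' \<omega>) \<partial>P) = L" by (simp add: LIMSEQ_unique)
    then show ?thesis by (simp add: integral_distr)
  qed
  have "invariant_prob (distr P borel Y')"
    unfolding invariant_prob_def
  proof (intro conjI allI impI)
    show "prob_space (distr P borel Y')" by (rule prob_space_distr[OF Y'])
    fix \<phi> :: "'a \<Rightarrow> complex" assume \<phi>: "continuous_on UNIV \<phi>"
    obtain L where L: "\<And>\<epsilon>. \<epsilon> > 0 \<Longrightarrow> \<exists>N. \<forall>n\<ge>N. \<forall>x. norm ((transfer ^^ n) \<phi> x - L) \<le> \<epsilon>"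
      using transfer_limit[OF assms \<phi>] by blast
    have lim: "(\<lambda>n. (transfer ^^ n) \<phi> a) \<longlonglongrightarrow> L"
    proof (rule metric_LIMSEQ_I)
      fix e :: real assume "e > 0"
      then obtain N where N: "\<And>n. n \<ge> N \<Longrightarrow> norm ((transfer ^^ n) \<phi> a - L) \<le> e / 2"
        using L[of "e / 2"] by auto
      have "dist ((transfer ^^ n) \<phi> a) L < e" if "n \<ge> N" for n
        using N[OF that] \<open>e > 0\<close> by (simp add: dist_norm)
      then show "\<exists>N. \<forall>n\<ge>N. dist ((transfer ^^ n) \<phi> a) L < e" by blast
    qed
    \<comment> \<open>The iterates of \<open>transfer \<phi>\<close> are those of
      \<open>\<phi>\<close> shifted by one, so both integrals equal the same limit.\<close>
    have "(\<lambda>n. (transfer ^^ n) (transfer \<phi>) a) \<longlonglongrightarrow> L"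
      using LIMSEQ_Suc[OF lim] by (simp add: funpow_swap1)
    then show "(\<integral>z. transfer \<phi> z \<partial>distr P borel Y') = (\<integral>z. \<phi> z \<partial>distr P borel Y')"
      using main[OF \<phi> lim] main[OF transfer_continuous[OF \<phi>]] by simp
  qed simp
  then show ?thesis by (rule that)
qed

section \<open>Martingale deviations along the orbit\<close>

text \<open>The martingale whose increments compare the value after a step with its conditional
  expectation before the step.\<close>

definition deviation :: "('a \<Rightarrow> real) \<Rightarrow> 'a \<Rightarrow> nat \<Rightarrow> (nat \<Rightarrow> nat) \<Rightarrow> real" where
  "deviation \<phi> x n \<omega> = (\<Sum>j<n. \<phi> (orbit x \<omega> (Suc j)) - transfer \<phi> (orbit x \<omega> j))"

lemma deviation_0: "deviation \<phi> x 0 = (\<lambda>_. 0)"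
  by (simp add: fun_eq_iff deviation_def)

lemma deviation_case_nat:
  "deviation \<phi> x (Suc n) (case_nat i \<omega>) = (\<phi> (g i x) - transfer \<phi> x) + deviation \<phi> (g i x) n \<omega>"
  unfolding deviation_def sum.lessThan_Suc_shift orbit_case_nat by simp

lemma measurable_deviation:
  assumes "continuous_on UNIV \<phi>"
  shows "deviation \<phi> x n \<in> borel_measurable P"
proof -
  have "(\<lambda>\<omega>. \<phi> (orbit x \<omega> j)) \<in> borel_measurable P" "(\<lambda>\<omega>. transfer \<phi> (orbit x \<omega> j)) \<in> borel_measurable P" for j
    by (rule measurable_compose[OF measurable_orbit borel_measurable_continuous_onI], rule assms transfer_continuous[OF assms])+
  then show ?thesis unfolding deviation_def by (intro borel_measurable_sum borel_measurable_diff)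
qed

lemma deviation_step_le:
  fixes \<phi> :: "'a \<Rightarrow> real"
  assumes "\<And>x. norm (\<phi> x) \<le> C"
  shows "\<bar>\<phi> y - transfer \<phi> x\<bar> \<le> 2 * C"
proof -
  have "\<bar>transfer \<phi> x\<bar> \<le> C"
    unfolding transfer_def using norm_avg_le[of "\<lambda>j. \<phi> (g j x)"] avg_le[of "\<lambda>j. norm (\<phi> (g j x))" C] assms by auto
  then show ?thesis using assms[of y] by (simp add: abs_le_iff)
qed

lemma deviation_bound:
  assumes "\<And>x. norm (\<phi> x) \<le> C"
  shows "\<bar>deviation \<phi> x n \<omega>\<bar> \<le> 2 * C * real n"
proof -
  have "\<bar>deviation \<phi> x n \<omega>\<bar> \<le> (\<Sum>j<n. \<bar>\<phi> (orbit x \<omega> (Suc j)) - transfer \<phi> (orbit x \<omega> j)\<bar>)"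
    unfolding deviation_def by (rule sum_abs)
  also have "\<dots> \<le> (\<Sum>j<n. 2 * C)" by (intro sum_mono deviation_step_le assms)
  finally show ?thesis by (simp add: mult_ac)
qed

lemma integrable_deviation:
  assumes \<phi>: "continuous_on UNIV \<phi>"
  shows "integrable P (deviation \<phi> x n)" "integrable P (\<lambda>\<omega>. (deviation \<phi> x n \<omega>)\<^sup>2)"
proof -
  interpret prob_space P by (rule prob_space_P)
  note [measurable] = measurable_deviation[OF \<phi>]
  obtain C where C: "\<And>x. norm (\<phi> x) \<le> C" using continuous_bound[OF \<phi>] by blast
  have B: "\<bar>deviation \<phi> x n \<omega>\<bar> \<le> 2 * C * real n" for \<omega> by (rule deviation_bound[OF C])
  show "integrable P (deviation \<phi> x n)"
    using B by (intro integrable_const_bound[of _ "2 * C * real n"]) auto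
  have "(deviation \<phi> x n \<omega>)\<^sup>2 \<le> (2 * C * real n)\<^sup>2" for \<omega>
    using power_mono[OF B[of \<omega>], of 2] by simp
  then show "integrable P (\<lambda>\<omega>. (deviation \<phi> x n \<omega>)\<^sup>2)"
    by (intro integrable_const_bound[of _ "(2 * C * real n)\<^sup>2"]) auto
qed

text \<open>The first increment averages to 0 by the definition of \<open>transfer\<close>; the rest
  is a deviation from another starting point.\<close>

lemma expectation_deviation:
  assumes \<phi>: "continuous_on UNIV \<phi>"
  shows "(\<integral>\<omega>. deviation \<phi> x n \<omega> \<partial>P) = 0"
proof (induction n arbitrary: x)
  case (Suc n)
  interpret prob_space P by (rule prob_space_P)
  have "(\<integral>\<omega>. deviation \<phi> x (Suc n) \<omega> \<partial>P) = avg (\<lambda>i. \<integral>\<omega>. deviation \<phi> x (Suc n) (case_nat i \<omega>) \<partial>P)"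
    by (rule integral_peel[OF integrable_deviation(1)[OF \<phi>]])
  also have "\<dots> = avg (\<lambda>i. \<phi> (g i x) - transfer \<phi> x)"
    unfolding deviation_case_nat using integrable_deviation(1)[OF \<phi>] Suc
    by (simp add: Bochner_Integration.integral_add prob_space)
  finally show ?case by (simp add: avg_diff transfer_def)
qed (simp add: deviation_0)

text \<open>Given the first symbol, the first increment \<open>d\<close> is a constant and the
  remaining sum has mean 0, so the cross term vanishes and each step adds at most
  \<open>(2 * C)\<^sup>2\<close>.\<close>

lemma variance_deviation:
  assumes \<phi>: "continuous_on UNIV \<phi>" and C: "\<And>x. norm (\<phi> x) \<le> C"
  shows "(\<integral>\<omega>. (deviation \<phi> x n \<omega>)\<^sup>2 \<partial>P) \<le> (2 * C)\<^sup>2 * real n"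
proof (induction n arbitrary: x)
  case (Suc n)
  interpret prob_space P by (rule prob_space_P)
  have "(\<integral>\<omega>. (deviation \<phi> x (Suc n) \<omega>)\<^sup>2 \<partial>P) = avg (\<lambda>i. \<integral>\<omega>. (deviation \<phi> x (Suc n) (case_nat i \<omega>))\<^sup>2 \<partial>P)"
    by (rule integral_peel[OF integrable_deviation(2)[OF \<phi>]])
  also have "\<dots> \<le> (2 * C)\<^sup>2 * real (Suc n)"
  proof (rule avg_le)
    fix i
    define d where "d = \<phi> (g i x) - transfer \<phi> x"
    have "d\<^sup>2 \<le> (2 * C)\<^sup>2"
      using power_mono[OF deviation_step_le[where \<phi>=\<phi> and y="g i x" and x=x, OF C], of 2] by (simp add: d_def)
    have "(\<integral>\<omega>. (deviation \<phi> x (Suc n) (case_nat i \<omega>))\<^sup>2 \<partial>P)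
        = (\<integral>\<omega>. d\<^sup>2 + (2 * d * deviation \<phi> (g i x) n \<omega> + (deviation \<phi> (g i x) n \<omega>)\<^sup>2) \<partial>P)"
      unfolding deviation_case_nat d_def[symmetric] by (simp add: power2_sum algebra_simps)
    also have "\<dots> = d\<^sup>2 + (2 * d * (\<integral>\<omega>. deviation \<phi> (g i x) n \<omega> \<partial>P) + (\<integral>\<omega>. (deviation \<phi> (g i x) n \<omega>)\<^sup>2 \<partial>P))"
      using integrable_deviation[OF \<phi>] by (simp add: Bochner_Integration.integral_add prob_space)
    also have "\<dots> \<le> (2 * C)\<^sup>2 + (2 * C)\<^sup>2 * real n"
      using Suc[of "g i x"] \<open>d\<^sup>2 \<le> (2 * C)\<^sup>2\<close> by (simp add: expectation_deviation[OF \<phi>])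
    finally show "(\<integral>\<omega>. (deviation \<phi> x (Suc n) (case_nat i \<omega>))\<^sup>2 \<partial>P) \<le> (2 * C)\<^sup>2 * real (Suc n)"
      by (simp add: algebra_simps)
  qed
  finally show ?case .
qed (simp add: deviation_0)

lemma AE_deviation:
  assumes \<phi>: "continuous_on UNIV \<phi>"
  shows "AE \<omega> in P. (\<lambda>n. deviation \<phi> x n \<omega> / real n) \<longlonglongrightarrow> 0"
proof -
  interpret prob_space P by (rule prob_space_P)
  obtain C where C: "\<And>x. norm (\<phi> x) \<le> C" using continuous_bound[OF \<phi>] by blast
  show ?thesis
  proof (rule AE_quadratic_lln[where C="2 * C" and C'="(2 * C)\<^sup>2"])
    fix n \<omega>
    have "deviation \<phi> x (Suc n) \<omega> - deviation \<phi> x n \<omega> = \<phi> (orbit x \<omega> (Suc n)) - transfer \<phi> (orbit x \<omega> n)"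
      by (simp add: deviation_def)
    then show "\<bar>deviation \<phi> x (Suc n) \<omega> - deviation \<phi> x n \<omega>\<bar> \<le> 2 * C"
      using deviation_step_le[where \<phi>=\<phi> and y="orbit x \<omega> (Suc n)" and x="orbit x \<omega> n", OF C] by simp
  qed (intro measurable_deviation integrable_deviation variance_deviation \<phi> C)+
qed

section \<open>Time averages and weak convergence\<close>

definition orbit_mean :: "('a \<Rightarrow> real) \<Rightarrow> 'a \<Rightarrow> (nat \<Rightarrow> nat) \<Rightarrow> nat \<Rightarrow> real" where
  "orbit_mean \<phi> x \<omega> n = (\<Sum>j<n. \<phi> (orbit x \<omega> (Suc j))) / real n"

lemma orbit_mean_bound:
  assumes "\<And>x. \<bar>\<phi> x - c\<bar> \<le> \<epsilon>" "n \<ge> 1"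
  shows "\<bar>orbit_mean \<phi> x \<omega> n - c\<bar> \<le> \<epsilon>"
proof -
  have "orbit_mean \<phi> x \<omega> n - c = (\<Sum>j<n. \<phi> (orbit x \<omega> (Suc j)) - c) / real n"
    using assms(2) by (simp add: orbit_mean_def sum_subtractf diff_divide_distrib)
  also have "\<bar>\<dots>\<bar> \<le> (\<Sum>j<n. \<epsilon>) / real n"
    unfolding abs_divide by (intro divide_mono order_trans[OF sum_abs] sum_mono assms) (use assms(2) in auto)
  also have "\<dots> = \<epsilon>" using assms(2) by simp
  finally show ?thesis .
qed

text \<open>\<open>deviation\<close> compares \<open>\<phi>\<close> at time \<open>j + 1\<close>
  with \<open>transfer \<phi>\<close> at time \<open>j\<close>. Shifting the latter to time
  \<open>j + 1\<close> telescopes and leaves two bounded boundary terms divided by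
  \<open>n\<close>.\<close>

lemma orbit_mean_transfer_step:
  assumes \<phi>: "continuous_on UNIV \<phi>" and lim: "(\<lambda>n. deviation \<phi> x n \<omega> / real n) \<longlonglongrightarrow> 0"
  shows "(\<lambda>n. orbit_mean \<phi> x \<omega> n - orbit_mean (transfer \<phi>) x \<omega> n) \<longlonglongrightarrow> 0"
proof -
  let ?\<psi> = "transfer \<phi>"
  obtain C where C: "\<And>x. norm (?\<psi> x) \<le> C" using continuous_bound[OF transfer_continuous[OF \<phi>]] by blast
  have eq: "orbit_mean \<phi> x \<omega> n - orbit_mean ?\<psi> x \<omega> n
      = deviation \<phi> x n \<omega> / real n + (?\<psi> x - ?\<psi> (orbit x \<omega> n)) / real n" for n
  proof -
    have "(\<Sum>j<n. ?\<psi> (orbit x \<omega> (Suc j))) - (\<Sum>j<n. ?\<psi> (orbit x \<omega> j)) = ?\<psi> (orbit x \<omega> n) - ?\<psi> x"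
      unfolding sum_subtractf[symmetric] by (subst sum_lessThan_telescope) simp
    then have "(\<Sum>j<n. \<phi> (orbit x \<omega> (Suc j))) - (\<Sum>j<n. ?\<psi> (orbit x \<omega> (Suc j)))
      = deviation \<phi> x n \<omega> + (?\<psi> x - ?\<psi> (orbit x \<omega> n))"
      unfolding deviation_def sum_subtractf by linarith
    then show ?thesis unfolding orbit_mean_def diff_divide_distrib[symmetric] add_divide_distrib[symmetric] by simp
  qed
  have "(\<lambda>n. (?\<psi> x - ?\<psi> (orbit x \<omega> n)) / real n) \<longlonglongrightarrow> 0"
  proof (rule Lim_null_comparison)
    have "norm ((?\<psi> x - ?\<psi> (orbit x \<omega> n)) / real n) \<le> 2 * C / real n" for n
    proof -
      have "norm (?\<psi> x - ?\<psi> (orbit x \<omega> n)) \<le> 2 * C"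
        using C[of x] C[of "orbit x \<omega> n"] norm_triangle_ineq4[of "?\<psi> x" "?\<psi> (orbit x \<omega> n)"] by linarith
      then show ?thesis unfolding norm_divide by (simp add: divide_right_mono)
    qed
    then show "\<forall>\<^sub>F n in sequentially. norm ((?\<psi> x - ?\<psi> (orbit x \<omega> n)) / real n) \<le> 2 * C / real n" by simp
  qed (rule lim_const_over_n)
  from tendsto_add[OF lim this] show ?thesis unfolding eq by simp
qed

lemma orbit_mean_transfer_power:
  assumes \<phi>: "continuous_on UNIV \<phi>"
    and lim: "\<And>i. (\<lambda>n. deviation ((transfer ^^ i) \<phi>) x n \<omega> / real n) \<longlonglongrightarrow> 0"
  shows "(\<lambda>n. orbit_mean \<phi> x \<omega> n - orbit_mean ((transfer ^^ m) \<phi>) x \<omega> n) \<longlonglongrightarrow> 0"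
proof (induction m)
  case (Suc m)
  from tendsto_add[OF this orbit_mean_transfer_step[OF transfer_power_continuous[OF \<phi>, of m] lim[of m]]]
  show ?case by simp
qed simp

theorem AE_orbit_mean:
  fixes \<phi> :: "'a \<Rightarrow> real"
  assumes synchronizing "invariant_prob \<mu>" and \<phi>: "continuous_on UNIV \<phi>"
  shows "AE \<omega> in P. (\<lambda>n. orbit_mean \<phi> x \<omega> n) \<longlonglongrightarrow> (\<integral>z. \<phi> z \<partial>\<mu>)"
proof -
  obtain L where L: "\<And>\<epsilon>. \<epsilon> > 0 \<Longrightarrow> \<exists>N. \<forall>n\<ge>N. \<forall>x. norm ((transfer ^^ n) \<phi> x - L) \<le> \<epsilon>"
    using transfer_limit[OF assms(1) \<phi>] by blast
  have eq: "(\<integral>z. \<phi> z \<partial>\<mu>) = L" by (rule invariant_prob_integral[OF assms(2) \<phi> L])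
  \<comment> \<open>One null set for all powers, because the power \<open>m\<close> chosen below
    depends on \<open>e\<close>.\<close>
  have "AE \<omega> in P. \<forall>i. (\<lambda>n. deviation ((transfer ^^ i) \<phi>) x n \<omega> / real n) \<longlonglongrightarrow> 0"
    unfolding AE_all_countable by (rule allI, rule AE_deviation, rule transfer_power_continuous[OF \<phi>])
  then show ?thesis
  proof eventually_elim
    case (elim \<omega>)
    show ?case unfolding eq
    proof (rule LIMSEQ_I)
      fix e :: real assume "e > 0"
      obtain m where m: "\<And>x. norm ((transfer ^^ m) \<phi> x - L) \<le> e / 2"
        using L[of "e / 2"] \<open>e > 0\<close> by auto
      obtain N where N: "\<And>n. n \<ge> N \<Longrightarrow> norm (orbit_mean \<phi> x \<omega> n - orbit_mean ((transfer ^^ m) \<phi>) x \<omega> n) < e / 2"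
        using LIMSEQ_D[OF orbit_mean_transfer_power[OF \<phi>, of x \<omega> m], of "e / 2"] elim \<open>e > 0\<close> by auto
      have "norm (orbit_mean \<phi> x \<omega> n - L) < e" if "n \<ge> max N 1" for n
      proof -
        have "\<bar>orbit_mean \<phi> x \<omega> n - orbit_mean ((transfer ^^ m) \<phi>) x \<omega> n\<bar> < e / 2"
          using N[of n] that by simp
        moreover have "\<bar>orbit_mean ((transfer ^^ m) \<phi>) x \<omega> n - L\<bar> \<le> e / 2"
          using m that by (intro orbit_mean_bound) auto
        ultimately show ?thesis unfolding real_norm_def by linarith
      qed
      then show "\<exists>no. \<forall>n\<ge>no. norm (orbit_mean \<phi> x \<omega> n - L) < e" by blast
    qed
  qed
qed

theorem AE_weakly_converges:
  assumes synchronizing and \<mu>: "invariant_prob \<mu>"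
  shows "AE \<omega> in P. weakly_converges (\<lambda>n. empirical_measure (orbit x \<omega>) n) \<mu>"
proof -
  interpret \<mu>: prob_space \<mu> using \<mu> by (simp add: invariant_prob_def)
  have [measurable_cong]: "sets \<mu> = sets borel" using \<mu> by (simp add: invariant_prob_def)
  have int: "integrable \<mu> \<phi>" if "continuous_on UNIV \<phi>" for \<phi> :: "'a \<Rightarrow> real"
    by (rule integrable_continuous[where Y="\<lambda>x. x", OF that \<mu>.finite_measure_axioms]) measurable
  obtain C :: "nat \<Rightarrow> 'a set" and u :: "nat \<Rightarrow> 'a \<Rightarrow> 'a \<Rightarrow> real"
    where C: "\<And>m. finite (C m)" and u: "\<And>m c. continuous_on UNIV (u m c)"
    and approx: "\<And>\<phi> \<epsilon>. continuous_on UNIV \<phi> \<Longrightarrow> 0 < \<epsilon> \<Longrightarrow> \<exists>m. \<forall>x. \<bar>\<phi> x - (\<Sum>c\<in>C m. \<phi> c * u m c x)\<bar> \<le> \<epsilon>"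
    using compact_partition_of_unity[OF compact_space] by blast
  have "AE \<omega> in P. \<forall>m. \<forall>c\<in>C m. (\<lambda>n. orbit_mean (u m c) x \<omega> n) \<longlonglongrightarrow> (\<integral>z. u m c z \<partial>\<mu>)"
    unfolding AE_all_countable
  proof (intro allI)
    show "AE \<omega> in P. \<forall>c\<in>C m. (\<lambda>n. orbit_mean (u m c) x \<omega> n) \<longlonglongrightarrow> (\<integral>z. u m c z \<partial>\<mu>)" for m
      using AE_orbit_mean[OF assms u] by (simp add: AE_ball_countable[OF countable_finite[OF C]])
  qed
  then show ?thesis
  proof eventually_elim
    case (elim \<omega>)
    show ?case unfolding weakly_converges_def
    proof (intro allI impI, elim conjE)
      fix \<phi> :: "'a \<Rightarrow> real" assume \<phi>: "continuous_on UNIV \<phi>"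
      have lim: "(\<lambda>n. orbit_mean \<phi> x \<omega> n) \<longlonglongrightarrow> (\<integral>z. \<phi> z \<partial>\<mu>)"
      proof (rule LIMSEQ_I)
        fix e :: real assume "e > 0"
        then obtain m where m: "\<And>x. \<bar>\<phi> x - (\<Sum>c\<in>C m. \<phi> c * u m c x)\<bar> \<le> e / 3"
          using approx[OF \<phi>, of "e / 3"] by auto
        define \<psi> where "\<psi> x = (\<Sum>c\<in>C m. \<phi> c * u m c x)" for x
        have m': "\<bar>\<psi> x - \<phi> x\<bar> \<le> e / 3" for x using m[of x] by (simp add: \<psi>_def abs_minus_commute)
        have \<psi>: "continuous_on UNIV \<psi>" unfolding \<psi>_def by (intro continuous_on_sum continuous_on_mult continuous_on_const u)
        have "orbit_mean \<psi> x \<omega> n = (\<Sum>c\<in>C m. \<phi> c * orbit_mean (u m c) x \<omega> n)" for n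
          unfolding orbit_mean_def \<psi>_def
          by (subst sum.swap) (simp add: sum_divide_distrib[symmetric] sum_distrib_left[symmetric])
        moreover have "(\<integral>z. \<psi> z \<partial>\<mu>) = (\<Sum>c\<in>C m. \<phi> c * (\<integral>z. u m c z \<partial>\<mu>))"
          unfolding \<psi>_def using int[OF u] by (subst Bochner_Integration.integral_sum) auto
        moreover have "(\<lambda>n. \<Sum>c\<in>C m. \<phi> c * orbit_mean (u m c) x \<omega> n) \<longlonglongrightarrow> (\<Sum>c\<in>C m. \<phi> c * (\<integral>z. u m c z \<partial>\<mu>))"
          using elim by (intro tendsto_sum tendsto_mult tendsto_const) auto
        ultimately have "(\<lambda>n. orbit_mean \<psi> x \<omega> n) \<longlonglongrightarrow> (\<integral>z. \<psi> z \<partial>\<mu>)" by simp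
        then obtain N where N: "\<And>n. n \<ge> N \<Longrightarrow> norm (orbit_mean \<psi> x \<omega> n - (\<integral>z. \<psi> z \<partial>\<mu>)) < e / 3"
          using LIMSEQ_D[of "\<lambda>n. orbit_mean \<psi> x \<omega> n" _ "e / 3"] \<open>e > 0\<close> by auto
        have d1: "\<bar>(\<integral>z. \<psi> z \<partial>\<mu>) - (\<integral>z. \<phi> z \<partial>\<mu>)\<bar> \<le> e / 3"
        proof -
          have "(\<integral>z. \<psi> z \<partial>\<mu>) - (\<integral>z. \<phi> z \<partial>\<mu>) = (\<integral>z. \<psi> z - \<phi> z \<partial>\<mu>)"
            using int[OF \<psi>] int[OF \<phi>] by simp
          also have "norm \<dots> \<le> (\<integral>z. norm (\<psi> z - \<phi> z) \<partial>\<mu>)" by (rule integral_norm_bound)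
          also have "\<dots> \<le> (\<integral>z. e / 3 \<partial>\<mu>)"
            using m' int[OF \<psi>] int[OF \<phi>] by (intro integral_mono) auto
          finally show ?thesis by (simp add: \<mu>.prob_space)
        qed
        have d2: "\<bar>orbit_mean \<phi> x \<omega> n - orbit_mean \<psi> x \<omega> n\<bar> \<le> e / 3" if "n \<ge> 1" for n
        proof -
          have "orbit_mean \<phi> x \<omega> n - orbit_mean \<psi> x \<omega> n = orbit_mean (\<lambda>z. \<phi> z - \<psi> z) x \<omega> n - 0"
            unfolding orbit_mean_def by (simp add: sum_subtractf diff_divide_distrib)
          then show ?thesis
            using orbit_mean_bound[of "\<lambda>z. \<phi> z - \<psi> z" 0 "e / 3" n x \<omega>] m that by (simp add: \<psi>_def)
        qed
        have "norm (orbit_mean \<phi> x \<omega> n - (\<integral>z. \<phi> z \<partial>\<mu>)) < e" if "n \<ge> max N 1" for n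
          using N[of n] d1 d2[of n] that unfolding real_norm_def by linarith
        then show "\<exists>no. \<forall>n\<ge>no. norm (orbit_mean \<phi> x \<omega> n - (\<integral>z. \<phi> z \<partial>\<mu>)) < e" by blast
      qed
      \<comment> \<open>Both sides use the times 1 to \<open>n\<close> and leave out the starting
        point; only the summation index is shifted.\<close>
      have "(\<integral>z. \<phi> z \<partial>empirical_measure (orbit x \<omega>) n) = orbit_mean \<phi> x \<omega> n" if "n \<ge> 1" for n
        unfolding integral_empirical_measure[OF that borel_measurable_continuous_onI[OF \<phi>]] orbit_mean_def
        by (simp only: One_nat_def sum.shift_bounds_cl_Suc_ivl sum.atLeast1_atMost_eq)
      then have "\<forall>\<^sub>F n in sequentially. orbit_mean \<phi> x \<omega> n = (\<integral>z. \<phi> z \<partial>empirical_measure (orbit x \<omega>) n)"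
        by (intro eventually_sequentiallyI[of 1]) simp
      from Lim_transform_eventually[OF lim this]
      show "(\<lambda>n. \<integral>z. \<phi> z \<partial>empirical_measure (orbit x \<omega>) n) \<longlonglongrightarrow> (\<integral>z. \<phi> z \<partial>\<mu>)" .
    qed
  qed
qed

end

section \<open>Cross-ratios and the chordal metric\<close>

lemma stereo_Fin: "stereo (Fin z) = ((2 / (1 + (norm z)\<^sup>2)) *\<^sub>R z, 1 - 2 / (1 + (norm z)\<^sup>2))"
proof -
  have "1 + (norm z)\<^sup>2 > 0" by (simp add: add_pos_nonneg)
  then show ?thesis by (simp add: scaleR_conv_of_real field_simps)
qed

lemma norm_stereo: "norm (stereo x) = 1"
proof (cases x)
  case (Fin z)
  define q where "q = 1 + (norm z)\<^sup>2"
  have q: "q > 0" "(norm z)\<^sup>2 = q - 1" by (simp_all add: q_def add_pos_nonneg)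
  have "norm (stereo x) = sqrt ((2 / q * norm z)\<^sup>2 + (1 - 2 / q)\<^sup>2)"
    using q(1) by (simp only: Fin stereo_Fin q_def[symmetric] norm_Pair norm_scaleR) simp
  also have "(2 / q * norm z)\<^sup>2 + (1 - 2 / q)\<^sup>2 = 1"
    unfolding power_mult_distrib q(2) using q(1)
    by (simp add: divide_simps) (simp add: algebra_simps power2_eq_square)
  finally show ?thesis by simp
qed (simp add: norm_Pair)

lemma dist_Fin_Infinity: "dist (Fin z) Infinity = 2 / sqrt (1 + (norm z)\<^sup>2)"
proof -
  define q where "q = 1 + (norm z)\<^sup>2"
  have q: "q > 0" "(norm z)\<^sup>2 = q - 1" by (simp_all add: q_def add_pos_nonneg)
  have "dist (Fin z) Infinity = sqrt ((2 / q * norm z)\<^sup>2 + (- 2 / q)\<^sup>2)"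
    using q(1) by (simp only: dist_rsphere_def stereo_Fin stereo.simps(2) q_def[symmetric] dist_Pair_Pair)
      (simp add: dist_norm)
  also have "(2 / q * norm z)\<^sup>2 + (- 2 / q)\<^sup>2 = 4 / q"
    unfolding power_mult_distrib q(2) using q(1)
    by (simp add: divide_simps) (simp add: algebra_simps power2_eq_square)
  also have "sqrt (4 / q) = 2 / sqrt q" by (simp add: real_sqrt_divide)
  finally show ?thesis by (simp add: q_def)
qed

lemma dist_Fin_Fin:
  "dist (Fin z) (Fin w) = 2 * norm (z - w) / (sqrt (1 + (norm z)\<^sup>2) * sqrt (1 + (norm w)\<^sup>2))"
proof -
  define p q where "p = 1 + (norm z)\<^sup>2" and "q = 1 + (norm w)\<^sup>2"
  have pq: "p > 0" "q > 0" "(norm z)\<^sup>2 = p - 1" "(norm w)\<^sup>2 = q - 1"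
    by (simp_all add: p_def q_def add_pos_nonneg)
  have nrm: "(norm (a *\<^sub>R z - c *\<^sub>R w))\<^sup>2 = a\<^sup>2 * (norm z)\<^sup>2 + c\<^sup>2 * (norm w)\<^sup>2 - 2 * a * c * (z \<bullet> w)" for a c :: real
    by (simp only: power2_norm_eq_inner inner_diff_left inner_diff_right inner_scaleR_left inner_scaleR_right)
       (simp add: inner_commute algebra_simps power2_eq_square)
  have d2: "(norm (z - w))\<^sup>2 = p + q - 2 - 2 * (z \<bullet> w)"
    using nrm[of 1 1] pq by simp
  have "dist (Fin z) (Fin w) = sqrt ((norm ((2 / p) *\<^sub>R z - (2 / q) *\<^sub>R w))\<^sup>2 + ((1 - 2 / p) - (1 - 2 / q))\<^sup>2)"
    by (simp only: dist_rsphere_def stereo_Fin p_def[symmetric] q_def[symmetric] dist_Pair_Pair)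
      (simp add: dist_norm)
  also have "(norm ((2 / p) *\<^sub>R z - (2 / q) *\<^sub>R w))\<^sup>2 + ((1 - 2 / p) - (1 - 2 / q))\<^sup>2 = 4 * (norm (z - w))\<^sup>2 / (p * q)"
    unfolding nrm d2 pq(3,4) using pq(1,2)
    by (simp add: divide_simps) (simp add: algebra_simps power2_eq_square)
  also have "sqrt \<dots> = 2 * norm (z - w) / (sqrt p * sqrt q)"
    by (simp add: real_sqrt_divide real_sqrt_mult)
  finally show ?thesis by (simp add: p_def q_def)
qed

text \<open>Homogeneous coordinates on the projective line: Moebius maps become linear, and
  \<open>Infinity\<close> needs no separate treatment.\<close>

fun hom1 hom2 :: "rsphere \<Rightarrow> complex" where
  "hom1 (Fin z) = z" | "hom1 Infinity = 1"
| "hom2 (Fin z) = 1" | "hom2 Infinity = 0"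

definition hom_norm :: "rsphere \<Rightarrow> real" where
  "hom_norm x = sqrt ((norm (hom1 x))\<^sup>2 + (norm (hom2 x))\<^sup>2)"

lemma hom_norm_pos: "hom_norm x > 0"
  by (cases x) (auto simp: hom_norm_def add_nonneg_pos)

text \<open>The numerator contains the determinant of the two coordinate vectors, which a linear map
  multiplies by its own determinant.\<close>

lemma dist_rsphere_eq:
  "dist x y = 2 * norm (hom1 x * hom2 y - hom2 x * hom1 y) / (hom_norm x * hom_norm y)"
  by (cases x; cases y)
     (auto simp: dist_Fin_Fin dist_Fin_Infinity dist_commute[of Infinity] hom_norm_def add.commute)

lemma mobius_hom:
  assumes "\<alpha> * \<delta> - \<beta> * \<gamma> \<noteq> 0"
  obtains c where "c \<noteq> 0" "\<alpha> * hom1 x + \<beta> * hom2 x = c * hom1 (mobius \<alpha> \<beta> \<gamma> \<delta> x)"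
    "\<gamma> * hom1 x + \<delta> * hom2 x = c * hom2 (mobius \<alpha> \<beta> \<gamma> \<delta> x)"
proof (cases x)
  case (Fin z)
  show ?thesis
  proof (cases "\<gamma> * z + \<delta> = 0")
    case True
    have "\<alpha> * z + \<beta> \<noteq> 0"
    proof
      assume "\<alpha> * z + \<beta> = 0"
      then have "\<beta> = - (\<alpha> * z)" "\<delta> = - (\<gamma> * z)" using True by (simp_all add: eq_neg_iff_add_eq_0 add.commute)
      then show False using assms by simp
    qed
    then show ?thesis using that[of "\<alpha> * z + \<beta>"] Fin True by (simp add: mobius_def)
  next
    case False
    then show ?thesis using that[of "\<gamma> * z + \<delta>"] Fin by (simp add: mobius_def)
  qed
next
  case Infinity
  then show ?thesis
    using that[of \<gamma>] that[of \<alpha>] assms by (cases "\<gamma> = 0") (auto simp: mobius_def)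
qed

text \<open>This multiplicative form of conformality encodes the invariance of the absolute cross-ratio.\<close>

definition cross_conformal :: "('a::metric_space \<Rightarrow> 'a) \<Rightarrow> bool" where
  "cross_conformal h \<longleftrightarrow> (\<exists>\<tau>. (\<forall>x. 0 < \<tau> x) \<and> (\<forall>x y. dist (h x) (h y) = \<tau> x * \<tau> y * dist x y))"

text \<open>In the determinant formula for the chordal metric, the matrix contributes
  \<open>D\<close> once per pair, while the scalars \<open>c\<close> and the norms split into one
  factor for each point.\<close>

lemma is_mobius_cross_conformal:
  assumes "is_mobius h"
  shows "cross_conformal h"
proof -
  obtain \<alpha> \<beta> \<gamma> \<delta> where det: "\<alpha> * \<delta> - \<beta> * \<gamma> \<noteq> 0" and h: "h = mobius \<alpha> \<beta> \<gamma> \<delta>"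
    using assms by (auto simp: is_mobius_def)
  have "\<exists>c. c \<noteq> 0 \<and> \<alpha> * hom1 x + \<beta> * hom2 x = c * hom1 (h x) \<and> \<gamma> * hom1 x + \<delta> * hom2 x = c * hom2 (h x)" for x
    using mobius_hom[OF det, of x] h by metis
  then obtain c where c: "\<And>x. c x \<noteq> 0" "\<And>x. \<alpha> * hom1 x + \<beta> * hom2 x = c x * hom1 (h x)"
      "\<And>x. \<gamma> * hom1 x + \<delta> * hom2 x = c x * hom2 (h x)" by metis
  define D where "D = norm (\<alpha> * \<delta> - \<beta> * \<gamma>)"
  have "D > 0" using det by (simp add: D_def)
  \<comment> \<open>The square root shares \<open>D\<close> evenly between \<open>\<tau> x\<close>
    and \<open>\<tau> y\<close>.\<close>
  define d where "d = sqrt D"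
  have d: "d > 0" "D = d * d" using \<open>D > 0\<close> by (simp_all add: d_def)
  define \<tau> where "\<tau> x = d * hom_norm x / (norm (c x) * hom_norm (h x))" for x
  have "c x * c y * (hom1 (h x) * hom2 (h y) - hom2 (h x) * hom1 (h y))
      = (\<alpha> * \<delta> - \<beta> * \<gamma>) * (hom1 x * hom2 y - hom2 x * hom1 y)" for x y
  proof -
    have "c x * c y * (hom1 (h x) * hom2 (h y) - hom2 (h x) * hom1 (h y))
      = (c x * hom1 (h x)) * (c y * hom2 (h y)) - (c x * hom2 (h x)) * (c y * hom1 (h y))"
      by (simp add: algebra_simps)
    also have "\<dots> = (\<alpha> * \<delta> - \<beta> * \<gamma>) * (hom1 x * hom2 y - hom2 x * hom1 y)"
      unfolding c(2,3)[symmetric] by (simp add: algebra_simps)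
    finally show ?thesis .
  qed
  then have "norm (c x) * norm (c y) * norm (hom1 (h x) * hom2 (h y) - hom2 (h x) * hom1 (h y))
      = D * norm (hom1 x * hom2 y - hom2 x * hom1 y)" for x y
    unfolding D_def norm_mult[symmetric] by simp
  then have N: "norm (hom1 (h x) * hom2 (h y) - hom2 (h x) * hom1 (h y))
      = D * norm (hom1 x * hom2 y - hom2 x * hom1 y) / (norm (c x) * norm (c y))" for x y
    using c(1) by (simp add: field_simps)
  have arith: "2 * (d * d * e / (p * q)) / (u * v) = d * X / (p * u) * (d * Y / (q * v)) * (2 * e / (X * Y))"
    if "X \<noteq> 0" "Y \<noteq> 0" for e p q u v X Y :: real
    using that by (simp add: field_simps)
  have "dist (h x) (h y) = \<tau> x * \<tau> y * dist x y" for x y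
    unfolding dist_rsphere_eq N \<tau>_def d(2)
    using hom_norm_pos[of x] hom_norm_pos[of y] by (intro arith) auto
  moreover have "\<tau> x > 0" for x
    using hom_norm_pos[of x] hom_norm_pos[of "h x"] c(1)[of x] d(1) by (simp add: \<tau>_def)
  ultimately show ?thesis unfolding cross_conformal_def by blast
qed

lemma cross_conformal_inv:
  assumes "cross_conformal h" "bij h"
  shows "cross_conformal (inv h)"
proof -
  obtain \<tau> where \<tau>: "\<And>x. 0 < \<tau> x" "\<And>x y. dist (h x) (h y) = \<tau> x * \<tau> y * dist x y"
    using assms(1) by (auto simp: cross_conformal_def)
  have "dist (inv h x) (inv h y) = (1 / \<tau> (inv h x)) * (1 / \<tau> (inv h y)) * dist x y" for x y
    using \<tau>(2)[of "inv h x" "inv h y"] \<tau>(1)[of "inv h x"] \<tau>(1)[of "inv h y"] assms(2)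
    by (simp add: bij_inv_eq_iff bij_is_surj surj_f_inv_f field_simps)
  then show ?thesis unfolding cross_conformal_def using \<tau>(1) by (intro exI[of _ "\<lambda>x. 1 / \<tau> (inv h x)"]) auto
qed

lemma cross_conformal_comp:
  assumes "cross_conformal h" "cross_conformal h'"
  shows "cross_conformal (h \<circ> h')"
proof -
  obtain \<tau> \<tau>' where "\<And>x. 0 < \<tau> x" "\<And>x y. dist (h x) (h y) = \<tau> x * \<tau> y * dist x y"
    "\<And>x. 0 < \<tau>' x" "\<And>x y. dist (h' x) (h' y) = \<tau>' x * \<tau>' y * dist x y"
    using assms by (auto simp: cross_conformal_def)
  then show ?thesis unfolding cross_conformal_def
    by (intro exI[of _ "\<lambda>x. \<tau> (h' x) * \<tau>' x"]) (auto simp: mult_ac)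
qed

lemma cross_conformal_id: "cross_conformal id" "cross_conformal (\<lambda>x. x)"
  by (auto simp: cross_conformal_def intro!: exI[of _ "\<lambda>_. 1"])

text \<open>Both sides carry each of the four factors \<open>\<tau>\<close> once. The multiplied-out
  form also allows coinciding points.\<close>

lemma cross_ratio:
  assumes "cross_conformal h"
  shows "dist (h x) (h y) * dist (h u) (h v) * (dist x u * dist y v)
    = dist x y * dist u v * (dist (h x) (h u) * dist (h y) (h v))"
  using assms by (auto simp: cross_conformal_def mult_ac)

section \<open>Topology of the sphere\<close>

lemma stereo_surj:
  fixes p :: "complex \<times> real"
  assumes "norm p = 1"
  shows "\<exists>x. stereo x = p"
proof -
  obtain w t where p: "p = (w, t)" by (cases p)
  have n: "(norm w)\<^sup>2 + t\<^sup>2 = 1" using assms by (simp add: p norm_Pair)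
  show ?thesis
  proof (cases "t = 1")
    case True
    then show ?thesis using n p by (intro exI[of _ Infinity]) simp
  next
    case False
    have "t\<^sup>2 \<le> 1\<^sup>2" unfolding one_power2 using n zero_le_power2[of "norm w"] by linarith
    then have "t \<le> 1" by (intro power2_le_imp_le[of t 1]) auto
    then have "t < 1" using False by simp
    define z where "z = w / of_real (1 - t)"
    have "(norm z)\<^sup>2 = (1 - t\<^sup>2) / (1 - t)\<^sup>2"
      using n unfolding z_def norm_divide norm_of_real power_divide by simp
    also have "\<dots> = (1 + t) / (1 - t)"
      using \<open>t < 1\<close> by (simp add: divide_simps) (simp add: algebra_simps power2_eq_square)
    finally have z: "(norm z)\<^sup>2 = (1 + t) / (1 - t)" .
    have "2 / (1 + (norm z)\<^sup>2) = 1 - t" "((norm z)\<^sup>2 - 1) / ((norm z)\<^sup>2 + 1) = t"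
      unfolding z using \<open>t < 1\<close> by (simp_all add: field_simps)
    then have "stereo (Fin z) = (of_real (1 - t) * z, t)" by (simp only: stereo.simps)
    also have "\<dots> = p"
    proof -
      have "complex_of_real (1 - t) \<noteq> 0" using \<open>t < 1\<close> by (simp only: of_real_eq_0_iff)
      then show ?thesis unfolding z_def p by simp
    qed
    finally show ?thesis by blast
  qed
qed

lemma stereo_inv_stereo: "p \<in> sphere 0 1 \<Longrightarrow> stereo (inv stereo p) = p"
  using stereo_surj[of p] f_inv_into_f[of p stereo UNIV] unfolding mem_sphere_0 by blast

text \<open>By the choice of the metric, \<open>inv stereo\<close> is an isometry from the compact
  unit sphere onto \<open>rsphere\<close>.\<close>

lemma compact_rsphere: "compact (UNIV :: rsphere set)"
proof -
  have img: "UNIV = inv stereo ` sphere 0 1"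
  proof -
    have "x \<in> inv stereo ` sphere 0 1" for x
      by (rule image_eqI[of _ _ "stereo x"]) (simp_all only: inv_f_f[OF inj_stereo] mem_sphere_0 norm_stereo)
    then show ?thesis by auto
  qed
  have "continuous_on (sphere 0 1) (inv stereo)"
    unfolding continuous_on_iff dist_rsphere_def
  proof (intro ballI allI impI exI conjI)
    fix p q :: "complex \<times> real" and e :: real
    assume "p \<in> sphere 0 1" "q \<in> sphere 0 1" "dist q p < e"
    then show "dist (stereo (inv stereo q)) (stereo (inv stereo p)) < e"
      by (simp only: stereo_inv_stereo)
  qed
  from compact_continuous_image[OF this compact_sphere] show ?thesis by (simp only: img[symmetric])
qed

lemma continuous_on_stereo: "continuous_on UNIV stereo"
  unfolding continuous_on_iff dist_rsphere_def by blast

instance rsphere :: second_countable_topology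
proof
  obtain B :: "(complex \<times> real) set set" where B: "countable B" "topological_basis B"
    using ex_countable_basis by blast
  have "topological_basis ((\<lambda>U. stereo -` U) ` B)"
  proof -
    have op: "open (stereo -` U)" if "U \<in> B" for U
      by (rule open_vimage[OF topological_basis_open[OF B(2) that] continuous_on_stereo])
    show ?thesis
    proof (rule topological_basisI)
      fix O' :: "rsphere set" and x assume "open O'" "x \<in> O'"
      then obtain e where e: "e > 0" "ball x e \<subseteq> O'" by (auto simp: open_contains_ball)
      obtain U where U: "U \<in> B" "stereo x \<in> U" "U \<subseteq> ball (stereo x) e"
        using topological_basisE[OF B(2) open_ball, of "stereo x" "stereo x" e] e(1) by auto
      then have "stereo -` U \<subseteq> ball x e" unfolding ball_def dist_rsphere_def by blast
      with U e show "\<exists>B'\<in>(\<lambda>U. stereo -` U) ` B. x \<in> B' \<and> B' \<subseteq> O'"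
        by (intro bexI[of _ "stereo -` U"] conjI order_trans[OF _ e(2)] vimageI2 imageI)
    qed (use op in auto)
  qed
  then show "\<exists>B::rsphere set set. countable B \<and> open = generate_topology B"
    using B(1) topological_basis_imp_subbasis
    by (intro exI[of _ "(\<lambda>U. stereo -` U) ` B"] conjI countable_image)
qed

lemma dist_rsphere_le: "dist x y \<le> (2::real)" for x y :: rsphere
  unfolding dist_rsphere_def dist_norm
  using norm_triangle_ineq4[of "stereo x" "stereo y"] by (simp add: norm_stereo)

text \<open>Every ball is infinite, so two points can be avoided at once; this supplies the nearby
  third point for the cross-ratio argument.\<close>

lemma rsphere_not_isolated:
  fixes x :: rsphere
  assumes "d > 0"
  obtains u where "u \<noteq> x" "u \<noteq> y" "dist u x < d"
proof -
  have "infinite (ball x d)"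
  proof (cases x)
    case (Fin z)
    define t where "t n = min 1 d / 4 / real (Suc n)" for n
    have "Fin (z + of_real (t n)) \<in> ball x d" for n
    proof -
      have "min 1 d / 4 / real (Suc n) \<le> min 1 d / 4 / 1" using assms by (intro divide_left_mono) auto
      then have t: "0 < t n" "t n \<le> d / 4" using assms by (auto simp: t_def)
      have "dist (Fin z) (Fin (z + of_real (t n))) \<le> 2 * t n / (1 * 1)"
        unfolding dist_Fin_Fin using t(1)
        by (intro frac_le mult_mono) (auto simp: real_sqrt_ge_1_iff)
      then show ?thesis using Fin t assms by simp
    qed
    then have "range (\<lambda>n. Fin (z + of_real (t n))) \<subseteq> ball x d" by blast
    moreover have "inj (\<lambda>n. Fin (z + of_real (t n)))"
      using assms by (auto simp: inj_def t_def)
    ultimately show ?thesis using infinite_super range_inj_infinite by blast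
  next
    case Infinity
    obtain N where N: "2 / d < real N" using reals_Archimedean2 by blast
    have "Fin (of_nat (N + n)) \<in> ball x d" for n
    proof -
      have "real N \<le> sqrt (1 + (real (N + n))\<^sup>2)"
        by (intro real_le_rsqrt) (simp add: add_increasing power_mono)
      then have "2 / d < sqrt (1 + (real (N + n))\<^sup>2)" using N by linarith
      then have "2 / sqrt (1 + (real (N + n))\<^sup>2) < d"
        using assms by (subst pos_divide_less_eq) (auto simp: field_simps add_pos_nonneg)
      then show ?thesis
        unfolding Infinity mem_ball dist_commute[of Infinity] dist_Fin_Infinity norm_of_nat .
    qed
    then have "range (\<lambda>n. Fin (of_nat (N + n))) \<subseteq> ball x d" by blast
    moreover have "inj (\<lambda>n. Fin (of_nat (N + n)))" by (auto simp: inj_def)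
    ultimately show ?thesis using infinite_super range_inj_infinite by blast
  qed
  then have "infinite (ball x d - {x, y})" by simp
  then obtain u where "u \<in> ball x d - {x, y}" by (metis finite.emptyI ex_in_conv)
  then show ?thesis using that by (auto simp: dist_commute)
qed

section \<open>Semigroups preserving the cross-ratio\<close>

text \<open>Comparison with a fixed point \<open>u\<close> other than \<open>x\<close> bounds
  \<open>\<tau>\<close> near \<open>x\<close>, because the image distances are at most
  \<open>M\<close>; this gives a Lipschitz estimate at \<open>x\<close>.\<close>

lemma cross_conformal_continuous:
  fixes h :: "'a::metric_space \<Rightarrow> 'a"
  assumes h: "cross_conformal h" and M: "\<And>x y::'a. dist x y \<le> M"
  shows "continuous_on UNIV h"
  unfolding continuous_on_iff
proof (intro ballI allI impI)
  fix x :: 'a and e :: real assume "e > 0"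
  obtain \<tau> where \<tau>: "\<And>x. 0 < \<tau> x" "\<And>x y. dist (h x) (h y) = \<tau> x * \<tau> y * dist x y"
    using h by (auto simp: cross_conformal_def)
  show "\<exists>d>0. \<forall>x'\<in>UNIV. dist x' x < d \<longrightarrow> dist (h x') (h x) < e"
  proof (cases "\<exists>u. u \<noteq> x")
    case False
    then show ?thesis using \<open>e > 0\<close> by (metis dist_self zero_less_one)
  next
    case True
    then obtain u where u: "u \<noteq> x" by blast
    define \<rho> where "\<rho> = dist x u / 2"
    have \<rho>: "\<rho> > 0" using u by (simp add: \<rho>_def)
    define T where "T = \<tau> x * (M / (\<tau> u * \<rho>))"
    have "M \<ge> 0" using M[of x x] by simp
    have T: "T \<ge> 0" using \<open>M \<ge> 0\<close> \<tau>(1) \<rho> unfolding T_def by (intro mult_nonneg_nonneg divide_nonneg_pos mult_pos_pos) (auto intro: less_imp_le)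
    have lip: "dist (h y) (h x) \<le> T * dist y x" if "dist y x < \<rho>" for y
    proof -
      have yu: "\<rho> \<le> dist y u"
        using that dist_triangle3[of x u y] unfolding \<rho>_def by linarith
      have "\<tau> y * (\<tau> u * \<rho>) \<le> \<tau> y * (\<tau> u * dist y u)"
        using yu \<tau>(1)[of y] \<tau>(1)[of u] by (intro mult_left_mono) auto
      also have "\<dots> = dist (h y) (h u)" by (simp add: \<tau>(2))
      also have "\<dots> \<le> M" by (rule M)
      finally have "\<tau> y \<le> M / (\<tau> u * \<rho>)"
        using \<tau>(1)[of u] \<rho> by (simp add: pos_le_divide_eq)
      then have "\<tau> x * \<tau> y * dist y x \<le> T * dist y x"
        unfolding T_def using \<tau>(1)[of x] by (intro mult_right_mono mult_left_mono) auto
      then show ?thesis by (simp add: \<tau>(2) mult_ac)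
    qed
    show ?thesis
    proof (intro exI[of _ "min \<rho> (e / (T + 1))"] conjI ballI impI)
      show "0 < min \<rho> (e / (T + 1))" using \<rho> \<open>e > 0\<close> T by simp
      fix y assume y: "dist y x < min \<rho> (e / (T + 1))"
      have "dist (h y) (h x) \<le> T * dist y x" using lip y by simp
      also have "\<dots> \<le> (T + 1) * dist y x" by (intro mult_right_mono) auto
      also have "\<dots> < e" using y T by (simp add: pos_less_divide_eq mult.commute)
      finally show "dist (h y) (h x) < e" .
    qed
  qed
qed

locale conformal_system = random_system k b g
  for k b and g :: "nat \<Rightarrow> 'a::{metric_space, second_countable_topology} \<Rightarrow> 'a" +
  assumes conformal_g: "j \<in> {1..k} \<Longrightarrow> cross_conformal (g j)"
    and bij_g: "j \<in> {1..k} \<Longrightarrow> bij (g j)"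
    and not_isolated: "0 < d \<Longrightarrow> \<exists>u. u \<noteq> (x :: 'a) \<and> u \<noteq> y \<and> dist u x < d"
begin

lemma conformal_fold: "w \<in> lists {1..k} \<Longrightarrow> cross_conformal (fold g w)"
  by (induction w rule: list.induct) (auto simp: cross_conformal_id intro!: cross_conformal_comp conformal_g)

lemma bij_fold: "w \<in> lists {1..k} \<Longrightarrow> bij (fold g w)"
  by (induction w rule: list.induct) (auto intro!: bij_comp bij_g)

lemma space_bound: obtains M where "0 < M" "\<And>x y::'a. dist x y \<le> M"
proof -
  obtain K where K: "\<And>x y::'a. dist x y \<le> K"
    using compact_imp_bounded[OF compact_space] unfolding bounded_two_points by blast
  have "dist x y \<le> max K 1" for x y :: 'a using K[of x y] by simp
  then show ?thesis using that[of "max K 1"] by simp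
qed

lemma continuous_inv_fold:
  assumes "w \<in> lists {1..k}"
  shows "continuous_on UNIV (inv (fold g w))"
proof -
  obtain M where "\<And>x y::'a. dist x y \<le> M" using space_bound by blast
  then show ?thesis
    by (intro cross_conformal_continuous cross_conformal_inv conformal_fold bij_fold assms)
qed

text \<open>Points near the image of \<open>x\<close> come from points near \<open>x\<close> by
  continuity of the inverse, and a word \<open>v\<close> after \<open>w\<close> is the word
  \<open>w @ v\<close>.\<close>

lemma equi_set_invariant:
  assumes x: "x \<in> equi_set" and w: "w \<in> lists {1..k}"
  shows "fold g w x \<in> equi_set"
  unfolding equi_set_def
proof (intro CollectI allI impI)
  fix \<epsilon> :: real assume "\<epsilon> > 0"
  then obtain \<delta> where \<delta>: "\<delta> > 0"
      "\<And>v y. v \<in> lists {1..k} \<Longrightarrow> dist y x < \<delta> \<Longrightarrow> dist (fold g v y) (fold g v x) < \<epsilon>"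
    using x unfolding equi_set_def by blast
  let ?h = "fold g w"
  have inv1: "inv ?h (?h z) = z" and inv2: "?h (inv ?h z) = z" for z
    using bij_fold[OF w] by (simp_all add: bij_is_inj bij_is_surj surj_f_inv_f)
  obtain \<eta> where \<eta>: "\<eta> > 0" "\<And>y. dist y (?h x) < \<eta> \<Longrightarrow> dist (inv ?h y) (inv ?h (?h x)) < \<delta>"
    using continuous_inv_fold[OF w] \<delta>(1) unfolding continuous_on_iff by (meson UNIV_I)
  have "dist (fold g v y) (fold g v (?h x)) < \<epsilon>" if v: "v \<in> lists {1..k}" and y: "dist y (?h x) < \<eta>" for v y
  proof -
    have "w @ v \<in> lists {1..k}" using v w by simp
    from \<delta>(2)[OF this, of "inv ?h y"] \<eta>(2)[OF y] show ?thesis by (simp add: inv1 inv2)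
  qed
  then show "\<exists>\<delta>>0. \<forall>v\<in>lists {1..k}. \<forall>y. dist y (?h x) < \<delta> \<longrightarrow> dist (fold g v y) (fold g v (?h x)) < \<epsilon>"
    using \<eta>(1) by blast
qed

lemma interior_equi_set_invariant:
  assumes x: "x \<in> interior equi_set" and w: "w \<in> lists {1..k}"
  shows "fold g w x \<in> interior equi_set"
proof -
  let ?U = "inv (fold g w) -` interior equi_set"
  have inv1: "inv (fold g w) (fold g w z) = z" and inv2: "fold g w (inv (fold g w) z) = z" for z
    using bij_fold[OF w] by (simp_all add: bij_is_inj bij_is_surj surj_f_inv_f)
  have "open ?U" by (rule open_vimage[OF open_interior continuous_inv_fold[OF w]])
  moreover have "?U \<subseteq> equi_set"
  proof
    fix y assume "y \<in> ?U"
    then have "inv (fold g w) y \<in> equi_set" using interior_subset by blast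
    from equi_set_invariant[OF this w] show "y \<in> equi_set" by (simp add: inv2)
  qed
  ultimately have "?U \<subseteq> interior equi_set" by (intro interior_maximal)
  then show ?thesis using x inv1 by (metis subsetD vimageI)
qed

text \<open>As for quasi-Moebius maps, three points kept apart by the whole semigroup force
  equicontinuity everywhere.\<close>

lemma equi_set_UNIV_if_separated:
  assumes dist: "p1 \<noteq> p2" "p1 \<noteq> p3" "p2 \<noteq> p3" and "\<eta> > 0"
    and sep: "\<And>w. w \<in> lists {1..k} \<Longrightarrow> \<eta> \<le> dist (fold g w p1) (fold g w p2)"
      "\<And>w. w \<in> lists {1..k} \<Longrightarrow> \<eta> \<le> dist (fold g w p1) (fold g w p3)"
      "\<And>w. w \<in> lists {1..k} \<Longrightarrow> \<eta> \<le> dist (fold g w p2) (fold g w p3)"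
  shows "equi_set = UNIV"
proof -
  obtain M where M: "0 < M" "\<And>x y::'a. dist x y \<le> M" using space_bound by blast
  \<comment> \<open>Two points other than \<open>z\<close> with separated images suffice: the
    cross-ratio of \<open>t\<close>, \<open>z\<close>, \<open>p\<close>, \<open>q\<close> bounds the
    image distance of \<open>t\<close> and \<open>z\<close> linearly, with a constant independent of
    the word.\<close>
  have key: "z \<in> equi_set"
    if pq: "p \<noteq> z" "q \<noteq> z" and s: "\<And>w. w \<in> lists {1..k} \<Longrightarrow> \<eta> \<le> dist (fold g w p) (fold g w q)" for p q z
  proof -
    define \<rho> where "\<rho> = dist z p / 2"
    have \<rho>: "\<rho> > 0" using pq by (simp add: \<rho>_def)
    define c where "c = \<eta> * (\<rho> * dist z q)"
    have c: "c > 0" using \<rho> pq \<open>\<eta> > 0\<close> by (simp add: c_def)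
    have lip: "c * dist (fold g w t) (fold g w z) \<le> dist t z * M ^ 3"
      if w: "w \<in> lists {1..k}" and t: "dist t z < \<rho>" for w t
    proof -
      let ?h = "fold g w"
      have "\<rho> \<le> dist t p" using t dist_triangle3[of z p t] unfolding \<rho>_def by linarith
      then have "\<eta> * (\<rho> * dist z q) \<le> dist (?h p) (?h q) * (dist t p * dist z q)"
        using s[OF w] \<open>\<eta> > 0\<close> \<rho> by (intro mult_mono) auto
      then have "c * dist (?h t) (?h z) \<le> dist (?h p) (?h q) * (dist t p * dist z q) * dist (?h t) (?h z)"
        unfolding c_def by (intro mult_right_mono) auto
      also have "\<dots> = dist (?h t) (?h z) * dist (?h p) (?h q) * (dist t p * dist z q)" by (simp add: mult_ac)
      also have "\<dots> = dist t z * dist p q * (dist (?h t) (?h p) * dist (?h z) (?h q))"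
        by (rule cross_ratio[OF conformal_fold[OF w]])
      also have "\<dots> \<le> dist t z * M * (M * M)"
        using M by (intro mult_mono mult_nonneg_nonneg) auto
      finally show ?thesis by (simp add: power3_eq_cube mult_ac)
    qed
    show ?thesis unfolding equi_set_def
    proof (intro CollectI allI impI)
      fix \<epsilon> :: real assume "\<epsilon> > 0"
      have "dist (fold g w t) (fold g w z) < \<epsilon>"
        if w: "w \<in> lists {1..k}" and t: "dist t z < min \<rho> (c * \<epsilon> / M ^ 3)" for w t
      proof -
        have "dist t z * M ^ 3 < c * \<epsilon>" using t M(1) by (simp add: pos_less_divide_eq)
        then have "c * dist (fold g w t) (fold g w z) < c * \<epsilon>"
          using lip[OF w, of t] t by simp
        then show ?thesis using c by simp
      qed
      moreover have "0 < min \<rho> (c * \<epsilon> / M ^ 3)" using \<rho> c M(1) \<open>\<epsilon> > 0\<close> by simp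
      ultimately show "\<exists>\<delta>>0. \<forall>w\<in>lists {1..k}. \<forall>y. dist y z < \<delta> \<longrightarrow> dist (fold g w y) (fold g w z) < \<epsilon>" by blast
    qed
  qed
  have "z \<in> equi_set" for z
  proof -
    \<comment> \<open>Of three distinct points, at least two differ from \<open>z\<close>.\<close>
    consider "p1 \<noteq> z" "p2 \<noteq> z" | "p1 \<noteq> z" "p3 \<noteq> z" | "p2 \<noteq> z" "p3 \<noteq> z" using dist by metis
    then show ?thesis using key sep by cases blast+
  qed
  then show ?thesis by blast
qed

text \<open>The third point is a neighbour \<open>v\<close> of \<open>y\<close>. Equicontinuity at
  \<open>y\<close> keeps its image away from that of \<open>x\<close>, but would allow the images of
  \<open>v\<close> and \<open>y\<close> to merge; the cross-ratio with an auxiliary point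
  \<open>u\<close> near \<open>x\<close> excludes this.\<close>

lemma contract_on_equi_set:
  assumes ne: "equi_set \<noteq> UNIV" and x: "x \<in> equi_set" and y: "y \<in> equi_set" and "\<epsilon> > 0"
  shows "\<exists>w\<in>lists {1..k}. dist (fold g w x) (fold g w y) < \<epsilon>"
proof (rule ccontr)
  assume "\<not> ?thesis"
  then have far: "\<epsilon> \<le> dist (fold g w x) (fold g w y)" if "w \<in> lists {1..k}" for w
    using that by (meson not_le)
  then have "x \<noteq> y" using far[of "[]"] \<open>\<epsilon> > 0\<close> by auto
  obtain M where M: "0 < M" "\<And>x y::'a. dist x y \<le> M" using space_bound by blast
  have "\<epsilon> / 3 > 0" using \<open>\<epsilon> > 0\<close> by simp
  obtain \<delta> where \<delta>: "\<delta> > 0" "\<And>w v. w \<in> lists {1..k} \<Longrightarrow> dist v y < \<delta> \<Longrightarrow> dist (fold g w v) (fold g w y) < \<epsilon> / 3"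
    using y \<open>\<epsilon> / 3 > 0\<close> unfolding equi_set_def by blast
  obtain \<delta>' where \<delta>': "\<delta>' > 0" "\<And>w v. w \<in> lists {1..k} \<Longrightarrow> dist v x < \<delta>' \<Longrightarrow> dist (fold g w v) (fold g w x) < \<epsilon> / 3"
    using x \<open>\<epsilon> / 3 > 0\<close> unfolding equi_set_def by blast
  obtain v where v: "v \<noteq> y" "v \<noteq> x" "dist v y < \<delta>" using not_isolated[OF \<delta>(1), of y x] by blast
  obtain u where u: "u \<noteq> x" "dist u x < \<delta>'" using not_isolated[OF \<delta>'(1), of x x] by blast
  \<comment> \<open>The images of \<open>x\<close>, \<open>y\<close> stay \<open>\<epsilon>\<close>
    apart and those of \<open>u\<close>, \<open>v\<close> at least \<open>\<epsilon> / 3\<close>;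
    three other distances in the cross-ratio identity are bounded by \<open>M\<close>.\<close>
  define \<kappa> where "\<kappa> = \<epsilon> * (\<epsilon> / 3) * (dist x u * dist y v) / M ^ 3"
  have \<kappa>: "\<kappa> > 0" using u v M \<open>\<epsilon> > 0\<close> by (simp add: \<kappa>_def)
  have sep1: "\<epsilon> / 2 \<le> dist (fold g w x) (fold g w v)" if w: "w \<in> lists {1..k}" for w
    using far[OF w] \<delta>(2)[OF w v(3)] dist_triangle[of "fold g w x" "fold g w y" "fold g w v"] \<open>\<epsilon> > 0\<close> by linarith
  have sep2: "\<kappa> \<le> dist (fold g w y) (fold g w v)" if w: "w \<in> lists {1..k}" for w
  proof -
    let ?h = "fold g w"
    have "\<epsilon> / 3 \<le> dist (?h u) (?h v)"
      using far[OF w] \<delta>(2)[OF w v(3)] \<delta>'(2)[OF w u(2)] dist_triangle[of "?h x" "?h y" "?h u"]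
        dist_triangle[of "?h u" "?h y" "?h v"] dist_commute[of "?h u" "?h x"] by linarith
    then have "\<epsilon> * (\<epsilon> / 3) * (dist x u * dist y v) \<le> dist (?h x) (?h y) * dist (?h u) (?h v) * (dist x u * dist y v)"
      using far[OF w] \<open>\<epsilon> > 0\<close> by (intro mult_mono mult_nonneg_nonneg) auto
    also have "\<dots> = dist x y * dist u v * (dist (?h x) (?h u) * dist (?h y) (?h v))"
      by (rule cross_ratio[OF conformal_fold[OF w]])
    also have "\<dots> \<le> M * M * (M * dist (?h y) (?h v))"
      using M by (intro mult_mono mult_nonneg_nonneg) auto
    also have "\<dots> = dist (?h y) (?h v) * M ^ 3" by (simp add: power3_eq_cube mult_ac)
    finally show ?thesis unfolding \<kappa>_def using M(1) by (simp add: pos_divide_le_eq)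
  qed
  have "equi_set = UNIV"
  proof (rule equi_set_UNIV_if_separated)
    show "0 < min \<kappa> (\<epsilon> / 2)" using \<kappa> \<open>\<epsilon> > 0\<close> by simp
    show "min \<kappa> (\<epsilon> / 2) \<le> dist (fold g w x) (fold g w y)" if "w \<in> lists {1..k}" for w
      using far[OF that] \<open>\<epsilon> > 0\<close> by linarith
    show "min \<kappa> (\<epsilon> / 2) \<le> dist (fold g w x) (fold g w v)" if "w \<in> lists {1..k}" for w
      using sep1[OF that] by linarith
    show "min \<kappa> (\<epsilon> / 2) \<le> dist (fold g w y) (fold g w v)" if "w \<in> lists {1..k}" for w
      using sep2[OF that] by linarith
  qed (use v \<open>x \<noteq> y\<close> in auto)
  with ne show False by simp
qed

text \<open>First \<open>x\<close> is moved into the interior, then the image of \<open>y\<close>,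
  while that of \<open>x\<close> stays inside by invariance; a third word brings the two
  together.\<close>

theorem conformal_synchronizing:
  assumes reach: "\<And>x. \<exists>w\<in>lists {1..k}. fold g w x \<in> interior equi_set"
    and ne: "equi_set \<noteq> UNIV"
  shows synchronizing
proof (rule synchronizingI[OF reach])
  fix x y :: 'a and \<epsilon> :: real assume "\<epsilon> > 0"
  obtain w1 where w1: "w1 \<in> lists {1..k}" "fold g w1 x \<in> interior equi_set" using reach by blast
  obtain w2 where w2: "w2 \<in> lists {1..k}" "fold g w2 (fold g w1 y) \<in> interior equi_set" using reach by blast
  have "fold g w2 (fold g w1 x) \<in> equi_set" "fold g w2 (fold g w1 y) \<in> equi_set"
    using interior_equi_set_invariant[OF w1(2) w2(1)] w2(2) interior_subset by blast+
  from contract_on_equi_set[OF ne this \<open>\<epsilon> > 0\<close>] obtain w3 where w3: "w3 \<in> lists {1..k}"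
    "dist (fold g w3 (fold g w2 (fold g w1 x))) (fold g w3 (fold g w2 (fold g w1 y))) < \<epsilon>" by blast
  show "\<exists>w\<in>lists {1..k}. dist (fold g w x) (fold g w y) < \<epsilon>"
    using w1(1) w2(1) w3 by (intro bexI[of _ "w1 @ w2 @ w3"]) auto
qed

end

section \<open>Moebius semigroups\<close>

text \<open>Arzela-Ascoli for the conjugates by \<open>stereo\<close>, which take values in a normed
  space. The limit stays on the closed unit sphere and can be pulled back.\<close>

lemma uniform_limit_on_rsphere:
  assumes equi: "\<And>x \<epsilon>. \<epsilon> > 0 \<Longrightarrow> \<exists>\<delta>>0. \<forall>n::nat. \<forall>y. dist y x < \<delta> \<longrightarrow> dist (h n y) (h n x) < \<epsilon>"
  obtains r l where "strict_mono r" "uniform_limit (UNIV :: rsphere set) (\<lambda>n. h (r n)) (l :: rsphere \<Rightarrow> rsphere) sequentially"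
proof -
  let ?S = "sphere 0 1 :: (complex \<times> real) set"
  define F where "F n p = stereo (h n (inv stereo p))" for n p
  have "\<exists>d. 0 < d \<and> (\<forall>n y. y \<in> ?S \<and> norm (x - y) < d \<longrightarrow> norm (F n x - F n y) < e)"
    if "x \<in> ?S" "0 < e" for x e
  proof -
    obtain \<delta> where \<delta>: "\<delta> > 0"
      "\<And>n y. dist y (inv stereo x) < \<delta> \<Longrightarrow> dist (h n y) (h n (inv stereo x)) < e"
      using equi[OF \<open>0 < e\<close>] by blast
    have "norm (F n x - F n y) < e" if "y \<in> ?S" "norm (x - y) < \<delta>" for n y
    proof -
      have "dist (inv stereo y) (inv stereo x) < \<delta>"
        unfolding dist_rsphere_def stereo_inv_stereo[OF \<open>x \<in> ?S\<close>] stereo_inv_stereo[OF \<open>y \<in> ?S\<close>]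
        using that(2) by (simp add: dist_norm norm_minus_commute)
      from \<delta>(2)[OF this, of n] show ?thesis
        unfolding F_def dist_rsphere_def by (simp add: dist_norm norm_minus_commute)
    qed
    then show ?thesis using \<delta>(1) by blast
  qed
  moreover have "norm (F n p) \<le> 1" for n p by (simp add: F_def norm_stereo)
  ultimately obtain G r where r: "strict_mono (r :: nat \<Rightarrow> nat)"
    and G: "\<And>e. 0 < e \<Longrightarrow> \<exists>N. \<forall>n p. n \<ge> N \<and> p \<in> ?S \<longrightarrow> norm (F (r n) p - G p) < e"
    using Arzela_Ascoli[of ?S F 1] compact_sphere by metis
  have GS: "G p \<in> ?S" if "p \<in> ?S" for p
  proof -
    have lim: "(\<lambda>n. F (r n) p) \<longlonglongrightarrow> G p"
    proof (rule LIMSEQ_I)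
      fix e :: real assume "0 < e"
      from G[OF this] show "\<exists>no. \<forall>n\<ge>no. norm (F (r n) p - G p) < e" using that by blast
    qed
    show ?thesis
      by (rule closed_sequentially[OF closed_sphere _ lim]) (simp add: F_def norm_stereo)
  qed
  define l where "l x = inv stereo (G (stereo x))" for x
  have S: "stereo x \<in> ?S" for x by (simp add: norm_stereo)
  have d: "dist (h (r n) x) (l x) = norm (F (r n) (stereo x) - G (stereo x))" for n x
    unfolding dist_rsphere_def l_def F_def stereo_inv_stereo[OF GS[OF S]] inv_f_f[OF inj_stereo] dist_norm ..
  have "uniform_limit UNIV (\<lambda>n. h (r n)) l sequentially"
    unfolding uniform_limit_iff eventually_sequentially
  proof (intro allI impI)
    fix e :: real assume "0 < e"
    from G[OF this] show "\<exists>N. \<forall>n\<ge>N. \<forall>x\<in>UNIV. dist (h (r n) x) (l x) < e"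
      unfolding d using S by blast
  qed
  with r show ?thesis by (rule that)
qed

locale mobius_system =
  fixes k :: nat and b :: "nat \<Rightarrow> real" and f :: "nat \<Rightarrow> rsphere \<Rightarrow> rsphere"
  assumes prob_vector_b: "prob_vector k b"
    and mobius_f: "j \<in> {1..k} \<Longrightarrow> is_mobius (f j)"
begin

definition g :: "nat \<Rightarrow> rsphere \<Rightarrow> rsphere" where
  "g j = inv (f j)"

abbreviation H :: "(rsphere \<Rightarrow> rsphere) set" where
  "H \<equiv> inverse_semigroup (semigroup_gen (f ` {1..k}))"

sublocale conformal_system k b g
proof
  fix j assume j: "j \<in> {1..k}"
  have bij: "bij (f j)" by (rule is_mobius_imp_bij[OF mobius_f[OF j]])
  show conf: "cross_conformal (g j)"
    unfolding g_def by (rule cross_conformal_inv[OF is_mobius_cross_conformal[OF mobius_f[OF j]] bij])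
  show "continuous_on UNIV (g j)" by (rule cross_conformal_continuous[OF conf dist_rsphere_le])
  show "bij (g j)" unfolding g_def by (rule bij_imp_bij_inv[OF bij])
next
  fix d :: real and x y :: rsphere assume "0 < d"
  then show "\<exists>u. u \<noteq> x \<and> u \<noteq> y \<and> dist u x < d" using rsphere_not_isolated by metis
qed (rule prob_vector_b compact_rsphere)+

text \<open>Inversion reverses a composition, and \<open>fold\<close> applies the first part of a
  concatenation first; the two reversals fit, so the words are concatenated in the given
  order.\<close>

lemma semigroup_gen_inv:
  assumes "s \<in> semigroup_gen (f ` {1..k})"
  shows "bij s \<and> (\<exists>w\<in>lists {1..k}. w \<noteq> [] \<and> inv s = fold g w)"
  using assms
proof induction
  case (gen s)
  then obtain j where j: "j \<in> {1..k}" "s = f j" by blast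
  have "inv s = fold g [j]" by (simp add: j(2) g_def)
  moreover have "[j] \<in> lists {1..k}" using j(1) by simp
  moreover have "bij s" unfolding j(2) by (rule is_mobius_imp_bij[OF mobius_f[OF j(1)]])
  ultimately show ?case by (metis list.distinct(1))
next
  case (comp s t)
  then obtain v where v: "v \<in> lists {1..k}" "v \<noteq> []" "inv s = fold g v" by blast
  from comp obtain w where w: "w \<in> lists {1..k}" "inv t = fold g w" by blast
  have st: "bij s" "bij t" using comp by blast+
  have "inv (s \<circ> t) = fold g (v @ w)"
    unfolding o_inv_distrib[OF st] v(3) w(2) fold_append ..
  moreover have "v @ w \<in> lists {1..k}" "v @ w \<noteq> []" using v w by simp_all
  ultimately show ?case using bij_comp[OF st(2,1)] by metis
qed

lemma H_eq_fold:
  assumes "h \<in> H"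
  obtains w where "w \<in> lists {1..k}" "h = fold g w"
proof -
  obtain s where s: "s \<in> semigroup_gen (f ` {1..k})" "h = inv s"
    using assms unfolding inverse_semigroup_def by blast
  obtain w where "w \<in> lists {1..k}" "inv s = fold g w"
    using semigroup_gen_inv[OF s(1)] by blast
  then show ?thesis using that s(2) by simp
qed

lemma fold_in_H:
  assumes "w \<in> lists {1..k}" "w \<noteq> []"
  shows "fold g w \<in> H"
  using assms
proof (induction w rule: list.induct)
  case (Cons j w)
  have j: "f j \<in> semigroup_gen (f ` {1..k})" using Cons.prems by (intro semigroup_gen.gen) auto
  show ?case
  proof (cases "w = []")
    case True
    have "fold g [j] = inv (f j)" by (simp add: g_def)
    then show ?thesis unfolding True inverse_semigroup_def using j by (metis imageI)
  next
    case False
    then have "fold g w \<in> H" using Cons.prems by (intro Cons.IH) auto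
    then obtain s where s: "s \<in> semigroup_gen (f ` {1..k})" "fold g w = inv s"
      unfolding inverse_semigroup_def by blast
    have bij: "bij (f j)" "bij s" using semigroup_gen_inv j s(1) by blast+
    have "fold g (j # w) = inv (f j \<circ> s)"
      unfolding o_inv_distrib[OF bij] s(2)[symmetric] by (simp add: g_def)
    then show ?thesis unfolding inverse_semigroup_def using semigroup_gen.comp[OF j s(1)] by (metis imageI)
  qed
qed simp

text \<open>If equicontinuity failed at \<open>z\<close>, there would be words separating
  \<open>z\<close> from points tending to it; a subsequence converging uniformly on a closed ball
  has a continuous limit, a contradiction.\<close>

lemma fatou_subset_equi_set: "fatou H \<subseteq> equi_set"
proof
  fix z assume "z \<in> fatou H"
  then obtain U where U: "open U" "z \<in> U" "normal_family_on U H" by (auto simp: fatou_def)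
  obtain e where e: "e > 0" "cball z e \<subseteq> U" using U open_contains_cball by blast
  have comp: "compact (cball z e)"
    using compact_Int_closed[OF compact_rsphere closed_cball] by simp
  show "z \<in> equi_set"
  proof (rule ccontr)
    assume "z \<notin> equi_set"
    then have "\<exists>\<epsilon>>0. \<forall>\<delta>>0. \<exists>w\<in>lists {1..k}. \<exists>y. dist y z < \<delta> \<and> \<not> dist (fold g w y) (fold g w z) < \<epsilon>"
      unfolding equi_set_def by blast
    then obtain \<epsilon> where \<epsilon>: "\<epsilon> > 0"
      "\<And>\<delta>. \<delta> > 0 \<Longrightarrow> \<exists>w\<in>lists {1..k}. \<exists>y. dist y z < \<delta> \<and> \<epsilon> \<le> dist (fold g w y) (fold g w z)"
      unfolding not_less by blast
    \<comment> \<open>The bound \<open>e\<close> keeps the points in the ball, and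
      \<open>\<epsilon>\<close> excludes the empty word, whose identity map need not belong to
      \<open>H\<close>.\<close>
    have "\<exists>w y. w \<in> lists {1..k} \<and> dist y z < min (min e \<epsilon>) (1 / real (Suc n)) \<and> \<epsilon> \<le> dist (fold g w y) (fold g w z)" for n
      using \<epsilon>(2)[of "min (min e \<epsilon>) (1 / real (Suc n))"] e(1) \<epsilon>(1) by auto
    then obtain w y where wy: "\<And>n. w n \<in> lists {1..k}" "\<And>n. dist (y n) z < min (min e \<epsilon>) (1 / real (Suc n))"
      "\<And>n. \<epsilon> \<le> dist (fold g (w n) (y n)) (fold g (w n) z)" by metis
    have "w n \<noteq> []" for n
    proof
      assume "w n = []"
      then show False using wy(2)[of n] wy(3)[of n] by simp
    qed
    then have "range (\<lambda>n. fold g (w n)) \<subseteq> H" using fold_in_H wy(1) by blast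
    then obtain r l where r: "strict_mono r"
      and l: "\<forall>K. compact K \<and> K \<subseteq> U \<longrightarrow> uniform_limit K (\<lambda>n. fold g (w (r n))) l sequentially"
      using U(3) unfolding normal_family_on_def by meson
    have ul: "uniform_limit (cball z e) (\<lambda>n. fold g (w (r n))) l sequentially" using l comp e by blast
    have cl: "continuous_on (cball z e) l"
      by (rule uniform_limit_theorem[OF _ ul])
        (auto intro!: eventuallyI continuous_on_subset[OF continuous_fold[OF wy(1)]])
    have y_lim: "(\<lambda>n. y (r n)) \<longlonglongrightarrow> z"
    proof -
      have "y \<longlonglongrightarrow> z"
      proof (rule metric_LIMSEQ_I)
        fix \<rho> :: real assume "\<rho> > 0"
        then obtain N where N: "1 / real (Suc N) < \<rho>" using nat_approx_posE by blast
        have "dist (y n) z < \<rho>" if "n \<ge> N" for n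
        proof -
          have "1 / real (Suc n) \<le> 1 / real (Suc N)" using that by (intro divide_left_mono) auto
          then show ?thesis using wy(2)[of n] N by simp
        qed
        then show "\<exists>no. \<forall>n\<ge>no. dist (y n) z < \<rho>" by blast
      qed
      from LIMSEQ_subseq_LIMSEQ[OF this r] show ?thesis by (simp add: comp_def)
    qed
    have y_in: "y n \<in> cball z e" for n using wy(2)[of n] by (simp add: dist_commute)
    have z_in: "z \<in> cball z e" using e by simp
    have "(\<lambda>n. l (y (r n))) \<longlonglongrightarrow> l z"
      by (rule continuous_on_tendsto_compose[OF cl y_lim z_in]) (simp only: y_in eventually_True)
    then have "\<forall>\<^sub>F n in sequentially. dist (l (y (r n))) (l z) < \<epsilon> / 3"
      using \<epsilon>(1) by (intro tendstoD) auto
    moreover have "\<forall>\<^sub>F n in sequentially. \<forall>x\<in>cball z e. dist (fold g (w (r n)) x) (l x) < \<epsilon> / 3"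
      using ul \<epsilon>(1) by (intro uniform_limitD) auto
    ultimately have "\<forall>\<^sub>F n in sequentially. False"
    proof eventually_elim
      case (elim n)
      have "dist (fold g (w (r n)) (y (r n))) (l (y (r n))) < \<epsilon> / 3" "dist (fold g (w (r n)) z) (l z) < \<epsilon> / 3"
        using elim(2) y_in z_in by blast+
      then show False
        using elim(1) wy(3)[of "r n"]
          dist_triangle[of "fold g (w (r n)) (y (r n))" "fold g (w (r n)) z" "l (y (r n))"]
          dist_triangle[of "l (y (r n))" "fold g (w (r n)) z" "l z"]
          dist_commute[of "l z" "fold g (w (r n)) z"] by linarith
    qed
    then show False by simp
  qed
qed

lemma fatou_subset_interior: "fatou H \<subseteq> interior equi_set"
proof (rule interior_maximal[OF fatou_subset_equi_set])
  have "fatou H = \<Union>{U. open U \<and> normal_family_on U H}" by (auto simp: fatou_def)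
  then show "open (fatou H)" by auto
qed

text \<open>Equicontinuity on the whole sphere would make \<open>H\<close> normal there, so the
  Julia set would be empty.\<close>

lemma equi_set_ne_UNIV:
  assumes "julia H \<noteq> {}"
  shows "equi_set \<noteq> UNIV"
proof
  assume E: "equi_set = UNIV"
  have "normal_family_on UNIV H"
    unfolding normal_family_on_def
  proof (intro allI impI)
    fix h :: "nat \<Rightarrow> rsphere \<Rightarrow> rsphere" assume h: "range h \<subseteq> H"
    have "\<exists>\<delta>>0. \<forall>n. \<forall>y. dist y x < \<delta> \<longrightarrow> dist (h n y) (h n x) < \<epsilon>" if pos: "\<epsilon> > 0" for x \<epsilon>
    proof -
      have "x \<in> equi_set" unfolding E by (rule UNIV_I)
      then obtain \<delta> where \<delta>: "\<delta> > 0"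
        "\<And>w y. w \<in> lists {1..k} \<Longrightarrow> dist y x < \<delta> \<Longrightarrow> dist (fold g w y) (fold g w x) < \<epsilon>"
        using pos unfolding equi_set_def by blast
      have "dist (h n y) (h n x) < \<epsilon>" if "dist y x < \<delta>" for n y
      proof -
        have "h n \<in> H" using h by blast
        then obtain w where "w \<in> lists {1..k}" "h n = fold g w" by (rule H_eq_fold)
        then show ?thesis using \<delta>(2)[OF _ that] by simp
      qed
      then show ?thesis using \<delta>(1) by blast
    qed
    from uniform_limit_on_rsphere[OF this]
    obtain r l where rl: "strict_mono r" "uniform_limit UNIV (\<lambda>n. h (r n)) l sequentially" .
    show "\<exists>r l. strict_mono r \<and> (\<forall>K. compact K \<and> K \<subseteq> UNIV \<longrightarrow> uniform_limit K (\<lambda>n. h (r n)) l sequentially)"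
      by (intro exI conjI allI impI) (rule rl(1), rule uniform_limit_on_subset[OF rl(2) subset_UNIV])
  qed
  then have "z \<in> fatou H" for z
    unfolding fatou_def by (intro CollectI exI[of _ UNIV] conjI open_UNIV UNIV_I)
  then have "fatou H = UNIV" by blast
  then show False using assms by (simp add: julia_def)
qed

text \<open>An empty kernel Julia set means that each point is sent into the Fatou set by some
  element of \<open>H\<close>.\<close>

lemma reach_interior:
  assumes "kernel_julia H = {}"
  shows "\<exists>w\<in>lists {1..k}. fold g w x \<in> interior equi_set"
proof -
  have "x \<notin> kernel_julia H" using assms by simp
  then obtain h where h: "h \<in> H" "h x \<in> fatou H" by (auto simp: kernel_julia_def julia_def)
  from h(1) obtain w where w: "w \<in> lists {1..k}" "h = fold g w" by (rule H_eq_fold)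
  with h(2) fatou_subset_interior show ?thesis by blast
qed

lemma transfer_eq_transition_op: "transfer \<phi> = transition_op k f b \<phi>"
  by (simp add: fun_eq_iff transfer_def transition_op_def avg_def g_def scaleR_conv_of_real)

lemma invariant_prob_eq_stationary: "invariant_prob \<mu> \<longleftrightarrow> stationary k f b \<mu>"
  by (simp add: invariant_prob_def stationary_def transfer_eq_transition_op)

lemma orbit_eq_backward_orbit: "orbit a \<omega> = backward_orbit f a \<omega>"
proof
  show "orbit a \<omega> n = backward_orbit f a \<omega> n" for n
  proof (induction n)
    case (Suc n)
    have "orbit a \<omega> (Suc n) = g (\<omega> n) (backward_orbit f a \<omega> n)" by (simp add: Suc)
    also have "\<dots> = backward_orbit f a \<omega> (Suc n)" by (simp only: g_def backward_orbit.simps)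
    finally show ?case .
  qed simp
qed

lemma AE_backward_orbit:
  assumes "kernel_julia H = {}" "julia H \<noteq> {}"
  shows "AE \<omega> in bernoulli k b.
    weakly_converges (\<lambda>n. empirical_measure (backward_orbit f a \<omega>) n) (stationary_measure k f b)"
proof -
  have sync: synchronizing
    by (rule conformal_synchronizing[OF reach_interior[OF assms(1)] equi_set_ne_UNIV[OF assms(2)]])
  obtain \<mu> where \<mu>: "invariant_prob \<mu>" using invariant_prob_exists[OF sync] .
  \<comment> \<open>Existence and uniqueness together give meaning to the definite
    description.\<close>
  have "stationary_measure k f b = \<mu>"
    unfolding stationary_measure_def invariant_prob_eq_stationary[symmetric]
    using \<mu> invariant_prob_unique[OF sync] by blast
  then show ?thesis
    using AE_weakly_converges[OF sync \<mu>, of a] by (simp add: orbit_eq_backward_orbit)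
qed

end

theorem theorem3p1:
  fixes k :: nat and f :: "nat \<Rightarrow> rsphere \<Rightarrow> rsphere" and a :: rsphere and b :: "nat \<Rightarrow> real"
  assumes "k \<ge> 1"
    and "\<And>j. j \<in> {1..k} \<Longrightarrow> is_mobius (f j)"
    and "prob_vector k b"
    and "kernel_julia (inverse_semigroup (semigroup_gen (f ` {1..k}))) = {}"
    and "julia (inverse_semigroup (semigroup_gen (f ` {1..k}))) \<noteq> {}"
  shows "AE \<omega> in bernoulli k b.
           weakly_converges (\<lambda>n. empirical_measure (backward_orbit f a \<omega>) n)
             (stationary_measure k f b)"
proof -
  interpret mobius_system k b f
    by (rule mobius_system.intro[OF assms(3,2)])
  show ?thesis using assms(4,5) by (rule AE_backward_orbit)
qed

end
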